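(* Let $w$ be a majorant and let $\mu$ be a positive finite singular Borel measure on $\partial\mathbb{D}$, decomposed as $\mu=\mu_P+\mu_C$ with respect to sets of finite $w$-entropy. Then the singular inner function $S_{\mu_C}$ is cyclic in $\mathcal{G}_w$.
   Context: $\mathbb{D}$ is the open unit disc, $\partial\mathbb{D}$ the unit circle, $m$ the normalized Lebesgue measure on $\partial\mathbb{D}$. "Singular" for measures means singular with respect to $m$. A modulus of continuity is a continuous, non-decreasing, sub-additive function on $[0,1]$ vanishing at $0$. A majorant is a continuous non-decreasing $w:[0,1]\to[0,\infty)$ with $w(0)=0$, not identically zero, such that $w^\lambda$ is a modulus of continuity for some $\lambda>0$. $\mathcal{G}_w$ is the Banach space of analytic functions $g$ in $\mathbb{D}$ with $\lim_{|z|\to1-}w(1-|z|)g(z)=0$, with norm $\|g\|_{\mathcal{G}_w}=\sup_{z\in\mathbb{D}}w(1-|z|)|g(z)|$. A function $g\in\mathcal{G}_w$ is cyclic in $\mathcal{G}_w$ if the smallest closed subspace of $\mathcal{G}_w$ containing $g$ and invariant under multiplication by $z$ is $\mathcal{G}_w$; equivalently, there are polynomials $Q_n$ with $\|gQ_n-1\|_{\mathcal{G}_w}\to0$. For a positive finite singular Borel measure $\sigma$, $S_\sigma(z)=\exp\big(-\int_{\partial\mathbb{D}}\frac{\zeta+z}{\zeta-z}\,d\sigma(\zeta)\big)$, $z\in\mathbb{D}$. A closed set $E\subset\partial\mathbb{D}$ of Lebesgue measure zero has finite $w$-entropy if $\int_{\partial\mathbb{D}}\log w(\mathrm{dist}(\zeta,E))\,dm(\zeta)>-\infty$,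 where $\mathrm{dist}$ is the unit-normalized arc-length distance on $\partial\mathbb{D}$. Each positive finite singular Borel measure $\mu$ on $\partial\mathbb{D}$ decomposes uniquely as $\mu=\mu_P+\mu_C$ with $\mu_P,\mu_C\geq 0$ where $\mu_P$ is concentrated on a countable union of sets of finite $w$-entropy and $\mu_C$ assigns measure zero to every set of finite $w$-entropy. *)

theory Defs
  imports "HOL-Complex_Analysis.Complex_Analysis"
begin

section \<open>Majorants\<close>

definition modulus_of_continuity :: "(real \<Rightarrow> real) \<Rightarrow> bool" where
  "modulus_of_continuity u \<longleftrightarrow>
     continuous_on {0..1} u \<and> mono_on {0..1} u \<and> u 0 = 0 \<and>
     (\<forall>s\<in>{0..1}. \<forall>t\<in>{0..1}. s + t \<le> 1 \<longrightarrow> u (s + t) \<le> u s + u t)"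

text \<open>Only the values of \<open>w\<close> on \<open>[0,1]\<close> matter.\<close>

definition majorant :: "(real \<Rightarrow> real) \<Rightarrow> bool" where
  "majorant w \<longleftrightarrow>
     continuous_on {0..1} w \<and> mono_on {0..1} w \<and> (\<forall>t\<in>{0..1}. 0 \<le> w t) \<and> w 0 = 0 \<and>
     (\<exists>t\<in>{0..1}. w t \<noteq> 0) \<and>
     (\<exists>l>0. modulus_of_continuity (\<lambda>t. w t powr l))"

section \<open>The space \<open>\<G>\<^sub>w\<close> and cyclicity\<close>

text \<open>
  Analytic functions in the disc are represented by functions on the whole complex plane with
  arbitrary values off the open disc, so \<open>growth_norm w\<close> is a seminorm whose null functions are
  those vanishing on the disc. A closed set (in the sense of \<open>closed_subspace\<close>) contains with a
  function all those agreeing with it on the disc, so closed subspaces are exactly the preimages of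
  the closed subspaces of the Banach space of functions on the disc.
\<close>

definition growth_space :: "(real \<Rightarrow> real) \<Rightarrow> (complex \<Rightarrow> complex) set" where
  "growth_space w =
     {g. g holomorphic_on ball 0 1 \<and>
         ((\<lambda>z. of_real (w (1 - cmod z)) * g z) \<longlongrightarrow> 0) (filtercomap cmod (at_left 1))}"

definition growth_norm :: "(real \<Rightarrow> real) \<Rightarrow> (complex \<Rightarrow> complex) \<Rightarrow> real" where
  "growth_norm w g = (SUP z\<in>ball 0 1. w (1 - cmod z) * cmod (g z))"

definition closed_subspace :: "(real \<Rightarrow> real) \<Rightarrow> (complex \<Rightarrow> complex) set \<Rightarrow> bool" where
  "closed_subspace w M \<longleftrightarrow>
     M \<subseteq> growth_space w \<and>
     (\<lambda>z. 0) \<in> M \<and>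
     (\<forall>f\<in>M. \<forall>g\<in>M. (\<lambda>z. f z + g z) \<in> M) \<and>
     (\<forall>c. \<forall>f\<in>M. (\<lambda>z. c * f z) \<in> M) \<and>
     (\<forall>f\<in>growth_space w.
        (\<forall>e>0. \<exists>h\<in>M. growth_norm w (\<lambda>z. f z - h z) < e) \<longrightarrow> f \<in> M)"

definition shift_invariant :: "(complex \<Rightarrow> complex) set \<Rightarrow> bool" where
  "shift_invariant M \<longleftrightarrow> (\<forall>f\<in>M. (\<lambda>z. z * f z) \<in> M)"

definition cyclic_in_growth_space :: "(real \<Rightarrow> real) \<Rightarrow> (complex \<Rightarrow> complex) \<Rightarrow> bool" where
  "cyclic_in_growth_space w g \<longleftrightarrow>
     g \<in> growth_space w \<and>
     \<Inter>{M. closed_subspace w M \<and> shift_invariant M \<and> g \<in> M} = growth_space w"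

section \<open>Measures on the unit circle\<close>

definition circle_borel :: "complex measure" where
  "circle_borel = restrict_space borel (sphere 0 1)"

definition circle_lebesgue :: "complex measure" where
  "circle_lebesgue =
     distr (uniform_measure lborel {0..1}) circle_borel (\<lambda>t. cis (2 * pi * t))"

definition finite_borel_on_circle :: "complex measure \<Rightarrow> bool" where
  "finite_borel_on_circle \<mu> \<longleftrightarrow> sets \<mu> = sets circle_borel \<and> finite_measure \<mu>"

definition singular_on_circle :: "complex measure \<Rightarrow> bool" where
  "singular_on_circle \<mu> \<longleftrightarrow>
     (\<exists>N\<in>sets circle_borel.
        emeasure circle_lebesgue N = 0 \<and> emeasure \<mu> (sphere 0 1 - N) = 0)"

definition singular_inner :: "complex measure \<Rightarrow> complex \<Rightarrow> complex" where
  "singular_inner \<sigma> z = exp (- (LINT \<zeta>|\<sigma>. (\<zeta> + z) / (\<zeta> - z)))"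

section \<open>Sets of finite \<open>w\<close>-entropy\<close>

text \<open>Arc length is normalized so that the whole circle has length 1.\<close>

definition arc_dist :: "complex \<Rightarrow> complex \<Rightarrow> real" where
  "arc_dist \<zeta> \<xi> = \<bar>Arg (\<zeta> / \<xi>)\<bar> / (2 * pi)"

text \<open>
  The distance to the empty set is set to 1/2, the diameter of the circle, so that the empty
  set has finite entropy.
\<close>

definition arc_setdist :: "complex \<Rightarrow> complex set \<Rightarrow> real" where
  "arc_setdist \<zeta> E = (if E = {} then 1 / 2 else INF \<xi>\<in>E. arc_dist \<zeta> \<xi>)"

text \<open>
  The extended-real integral of \<open>log w(dist(\<cdot>, E))\<close>, as integral of the positive part minus
  integral of the negative part (\<open>ennreal\<close> truncates negative values to 0). The positive part is
  bounded for a majorant \<open>w\<close>. On \<open>E\<close> itself, where the integrand should be \<open>-\<infinity>\<close>, Isabelle has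
  \<open>ln 0 = 0\<close>; this is immaterial since only null sets \<open>E\<close> are considered.
\<close>

definition log_entropy_integral :: "(real \<Rightarrow> real) \<Rightarrow> complex set \<Rightarrow> ereal" where
  "log_entropy_integral w E =
     enn2ereal (\<integral>\<^sup>+\<zeta>. ennreal (ln (w (arc_setdist \<zeta> E))) \<partial>circle_lebesgue) -
     enn2ereal (\<integral>\<^sup>+\<zeta>. ennreal (- ln (w (arc_setdist \<zeta> E))) \<partial>circle_lebesgue)"

definition finite_entropy :: "(real \<Rightarrow> real) \<Rightarrow> complex set \<Rightarrow> bool" where
  "finite_entropy w E \<longleftrightarrow>
     closed E \<and> E \<subseteq> sphere 0 1 \<and> emeasure circle_lebesgue E = 0 \<and>
     log_entropy_integral w E > -\<infinity>"

definition entropy_decomposition ::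
  "(real \<Rightarrow> real) \<Rightarrow> complex measure \<Rightarrow> complex measure \<Rightarrow> complex measure \<Rightarrow> bool" where
  "entropy_decomposition w \<mu> \<mu>P \<mu>C \<longleftrightarrow>
     sets \<mu>P = sets \<mu> \<and> sets \<mu>C = sets \<mu> \<and>
     (\<forall>A\<in>sets \<mu>. emeasure \<mu> A = emeasure \<mu>P A + emeasure \<mu>C A) \<and>
     (\<exists>\<E>. countable \<E> \<and> (\<forall>E\<in>\<E>. finite_entropy w E) \<and> emeasure \<mu>P (sphere 0 1 - \<Union>\<E>) = 0) \<and>
     (\<forall>E. finite_entropy w E \<longrightarrow> emeasure \<mu>C E = 0)"

end

theory Submission
  imports Defs
begin

text \<open>
  Roberts' stopping-time argument along dyadic scales \<open>n\<^sub>k = 2 ^ m k\<close>, chosen such that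
  \<open>- ln (w (1 / n\<^sub>k))\<close> is comparable to \<open>L\<^sub>k = 2 ^ k * L\<close>, splits the measure into pieces
  \<open>\<sigma>\<^sub>k\<close> that give each dyadic arc of length \<open>1 / n\<^sub>k\<close> mass at most a small multiple of
  \<open>L\<^sub>k / n\<^sub>k\<close>, plus a remainder that lives on the arcs which are overloaded at all scales. The
  limit set of these arcs has finite \<open>w\<close>-entropy, so the remainder tends to zero. No corona theorem
  is needed to invert the pieces in the growth norm: with \<open>r\<^sub>k = 1 - 1 / n\<^sub>k\<close>, the dilation
  \<open>f\<^sub>k z = 1 / S\<^sub>k (r\<^sub>k * z)\<close> of the reciprocal of the singular inner function \<open>S\<^sub>k\<close> of
  \<open>\<sigma>\<^sub>k\<close> is bounded by a small power of \<open>exp L\<^sub>k\<close>, and \<open>f\<^sub>k * S\<^sub>k - 1\<close> is small well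
  inside the disc of radius \<open>r\<^sub>k\<close>, whereas closer to the circle the weight \<open>w\<close> beats the bound
  on \<open>f\<^sub>k\<close>. As \<open>L\<^sub>k\<close> doubles, the errors in the product of the \<open>f\<^sub>k * S\<^sub>k\<close> are summable.
\<close>

section \<open>Growth spaces\<close>

text \<open>Polynomials only reach functions holomorphic across the circle, while the reciprocal of
  a singular inner function may be unbounded there. Dilation repairs this, and its cost has to be
  balanced against the weight, not at distance \<open>1 / n_k\<close> from the circle but at
  \<open>A / n_k\<close> with \<open>A = exp (l * L_k / 2)\<close>, where \<open>w powr l\<close> is
  a modulus of continuity. On the inner side the factor \<open>A\<close> makes the change of the
  Herglotz integral under dilation exponentially small in \<open>L_k\<close>. On the outer side the
  modulus property lets \<open>w\<close> grow by at most a constant times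
  \<open>A powr (1 / l) = exp (L_k / 2)\<close>, half of the decay \<open>exp (- L_k)\<close> that
  \<open>w (1 / n_k)\<close> offers. What is left must absorb the bound
  \<open>exp (\<kappa> * L_k)\<close> for \<open>f_k\<close> and the same bound for the product of
  all earlier factors, as \<open>L_0 + ... + L_(k-1) < L_k\<close>; hence \<open>\<kappa>\<close> is
  small against both \<open>1\<close> and \<open>l\<close>. The parameter \<open>L\<close> is fixed
  by the desired accuracy before the measure is decomposed, the number of stages only
  afterwards.\<close>

lemma modulus_of_continuity_mult:
  assumes "modulus_of_continuity u" "0 \<le> x" "real i * x \<le> 1"
  shows "u (real i * x) \<le> real i * u x"
  using assms(3)
proof (induction i)
  case 0
  then show ?case using assms by (simp add: modulus_of_continuity_def)
next
  case (Suc i)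
  have le: "real i * x + x \<le> 1" using Suc.prems by (simp add: algebra_simps)
  have ix: "0 \<le> real i * x" using assms by simp
  have "u (real (Suc i) * x) = u (real i * x + x)" by (simp add: algebra_simps)
  also have "\<dots> \<le> u (real i * x) + u x"
  proof -
    have "real i * x \<in> {0..1}" "x \<in> {0..1}" using le ix assms(2) by (auto intro: order_trans[of x "real i * x + x"])
    then show ?thesis using assms(1) le unfolding modulus_of_continuity_def by blast
  qed
  also have "\<dots> \<le> real i * u x + u x"
    using Suc.IH le assms(2) by linarith
  also have "\<dots> = real (Suc i) * u x" by (simp add: algebra_simps)
  finally show ?case .
qed

text \<open>Cut \<open>t\<close> into \<open>ceil (t / s)\<close> equal steps of length at most
  \<open>s\<close>. Applied to \<open>w powr l\<close>, this bounds the growth of \<open>w\<close>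
  from \<open>s\<close> to a larger \<open>t\<close> by a constant times the \<open>1 / l\<close>-th
  power of \<open>t / s\<close>.\<close>

lemma modulus_of_continuity_le:
  assumes u: "modulus_of_continuity u" and "0 < s" "s \<le> 1" "0 \<le> t" "t \<le> 1"
  shows "u t \<le> (t / s + 1) * u s"
proof -
  have us: "0 \<le> u s"
  proof -
    have "mono_on {0..1} u" "u 0 = 0" using u unfolding modulus_of_continuity_def by auto
    then show ?thesis using mono_onD[of "{0..1}" u 0 s] assms by simp
  qed
  show ?thesis
  proof (cases "t = 0")
    case True
    then show ?thesis using us u by (simp add: modulus_of_continuity_def)
  next
    case False
    define N where "N = nat \<lceil>t / s\<rceil>"
    have pos: "0 < t / s" using False assms by simp
    have N: "t / s \<le> real N" "real N \<le> t / s + 1" unfolding N_def using pos by linarith+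
    then have Npos: "0 < real N" using pos by linarith
    have ts: "t / real N \<le> s" using N(1) Npos \<open>0 < s\<close> by (simp add: field_simps)
    have "u t = u (real N * (t / real N))" using Npos by simp
    also have "\<dots> \<le> real N * u (t / real N)"
      by (rule modulus_of_continuity_mult[OF u]) (use Npos assms in auto)
    also have "\<dots> \<le> real N * u s"
    proof (rule mult_left_mono)
      show "u (t / real N) \<le> u s"
        using u ts assms Npos unfolding modulus_of_continuity_def by (auto elim!: mono_onD)
    qed simp
    also have "\<dots> \<le> (t / s + 1) * u s"
      by (rule mult_right_mono[OF N(2) us])
    finally show ?thesis .
  qed
qed

section \<open>Elementary properties of majorants\<close>

lemma majorant_mono: "majorant w \<Longrightarrow> 0 \<le> s \<Longrightarrow> s \<le> t \<Longrightarrow> t \<le> 1 \<Longrightarrow> w s \<le> w t"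
  unfolding majorant_def by (auto elim!: mono_onD)

lemma majorant_nonneg: "majorant w \<Longrightarrow> 0 \<le> t \<Longrightarrow> t \<le> 1 \<Longrightarrow> 0 \<le> w t"
  unfolding majorant_def by auto

text \<open>Taking logarithms of \<open>w\<close> requires positivity. A zero at some
  \<open>t > 0\<close> would spread by \<open>modulus_of_continuity_le\<close> to the whole unit
  interval, but \<open>w\<close> is not identically zero.\<close>

lemma majorant_pos:
  assumes w: "majorant w" and "0 < t" "t \<le> 1"
  shows "0 < w t"
proof (rule ccontr)
  assume "\<not> 0 < w t"
  then have wt: "w t = 0" using majorant_nonneg[OF w, of t] assms by simp
  obtain l where l: "l > 0" "modulus_of_continuity (\<lambda>t. w t powr l)"
    using w unfolding majorant_def by blast
  obtain s where s: "s \<in> {0..1}" "w s \<noteq> 0" using w unfolding majorant_def by blast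
  have "w s powr l \<le> (s / t + 1) * w t powr l"
    using modulus_of_continuity_le[OF l(2), of t s] assms s(1) by auto
  then show False using wt s(2) by simp
qed

lemma majorant_tendsto_0:
  assumes w: "majorant w" and "0 < e"
  obtains d where "0 < d" "d \<le> 1" "\<And>t. 0 \<le> t \<Longrightarrow> t \<le> d \<Longrightarrow> w t < e"
proof -
  have "continuous (at 0 within {0..1}) w" "w 0 = 0"
    using w unfolding majorant_def continuous_on_eq_continuous_within by auto
  then obtain d where d: "0 < d" "\<And>t. t \<in> {0..1} \<Longrightarrow> dist t 0 < d \<Longrightarrow> dist (w t) 0 < e"
    using \<open>0 < e\<close> unfolding continuous_within_eps_delta by metis
  show thesis
  proof (rule that[of "min 1 (d / 2)"])
    fix t assume "0 \<le> t" "t \<le> min 1 (d / 2)"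
    then show "w t < e" using d(2)[of t] d(1) by (auto simp: abs_less_iff)
  qed (use d in auto)
qed

section \<open>Membership in the growth space\<close>

lemma eventually_cmod_at_left_1:
  "eventually P (filtercomap cmod (at_left 1)) \<longleftrightarrow>
     (\<exists>d<1. \<forall>z. d < cmod z \<and> cmod z < 1 \<longrightarrow> P z)"
proof -
  have "eventually P (filtercomap cmod (at_left 1)) \<longleftrightarrow>
      (\<exists>Q. (\<exists>d<1. \<forall>y>d. y < 1 \<longrightarrow> Q y) \<and> (\<forall>z. Q (cmod z) \<longrightarrow> P z))"
    \<comment> \<open>The instance \<open>0\<close> only supplies some number below
      \<open>1\<close>, which the rule about left neighbourhoods asks for.\<close>
    unfolding eventually_filtercomap by (subst eventually_at_left[of 0]) auto
  also have "\<dots> \<longleftrightarrow> (\<exists>d<1. \<forall>z. d < cmod z \<and> cmod z < 1 \<longrightarrow> P z)"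
  proof
    assume "\<exists>d<1. \<forall>z. d < cmod z \<and> cmod z < 1 \<longrightarrow> P z"
    then obtain d where "d < 1" "\<forall>z. d < cmod z \<and> cmod z < 1 \<longrightarrow> P z" by blast
    then show "\<exists>Q. (\<exists>d<1. \<forall>y>d. y < 1 \<longrightarrow> Q y) \<and> (\<forall>z. Q (cmod z) \<longrightarrow> P z)"
      by (intro exI[of _ "\<lambda>y. d < y \<and> y < 1"]) auto
  qed blast
  finally show ?thesis .
qed

lemma growth_space_iff:
  assumes "majorant w"
  shows "g \<in> growth_space w \<longleftrightarrow> g holomorphic_on ball 0 1 \<and>
    (\<forall>e>0. \<exists>d<1. \<forall>z. d < cmod z \<and> cmod z < 1 \<longrightarrow> w (1 - cmod z) * cmod (g z) < e)"
proof -
  have *: "(\<exists>d<1. \<forall>z. d < cmod z \<and> cmod z < 1 \<longrightarrow> \<bar>w (1 - cmod z)\<bar> * cmod (g z) < e) \<longleftrightarrow>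
      (\<exists>d<1. \<forall>z. d < cmod z \<and> cmod z < 1 \<longrightarrow> w (1 - cmod z) * cmod (g z) < e)" for e
  proof -
    have "\<bar>w (1 - cmod z)\<bar> = w (1 - cmod z)" if "cmod z < 1" for z
      using majorant_nonneg[OF assms, of "1 - cmod z"] that by simp
    then show ?thesis by auto
  qed
  show ?thesis
    unfolding growth_space_def tendsto_iff eventually_cmod_at_left_1
    by (simp add: norm_mult *)
qed

lemma growth_space_bounded:
  assumes w: "majorant w" and g: "g holomorphic_on ball 0 1"
    and B: "\<And>z. cmod z < 1 \<Longrightarrow> cmod (g z) \<le> B"
  shows "g \<in> growth_space w"
  unfolding growth_space_iff[OF w]
proof (intro conjI g allI impI)
  fix e :: real assume "0 < e"
  define B' where "B' = max B 1"
  have "0 < e / B'" using \<open>0 < e\<close> by (simp add: B'_def)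
  from majorant_tendsto_0[OF w this] obtain d
    where d: "0 < d" "d \<le> 1" "\<And>t. 0 \<le> t \<Longrightarrow> t \<le> d \<Longrightarrow> w t < e / B'" by blast
  have "w (1 - cmod z) * cmod (g z) < e" if "1 - d < cmod z" "cmod z < 1" for z
  proof -
    have "w (1 - cmod z) * cmod (g z) \<le> w (1 - cmod z) * B'"
      using B[of z] that by (intro mult_left_mono majorant_nonneg[OF w]) (auto simp: B'_def)
    also have "\<dots> < e / B' * B'"
      using d(3)[of "1 - cmod z"] that by (intro mult_strict_right_mono) (auto simp: B'_def)
    also have "\<dots> = e" by (simp add: B'_def)
    finally show ?thesis .
  qed
  then show "\<exists>d<1. \<forall>z. d < cmod z \<and> cmod z < 1 \<longrightarrow> w (1 - cmod z) * cmod (g z) < e"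
    using d(1) by (intro exI[of _ "1 - d"]) auto
qed

lemma growth_space_dominated:
  assumes w: "majorant w" and f: "f \<in> growth_space w" and g: "g holomorphic_on ball 0 1"
    and le: "\<And>z. cmod z < 1 \<Longrightarrow> cmod (g z) \<le> C * cmod (f z)"
  shows "g \<in> growth_space w"
  unfolding growth_space_iff[OF w]
proof (intro conjI g allI impI)
  fix e :: real assume "0 < e"
  define D where "D = max C 1"
  have "0 < e / D" using \<open>0 < e\<close> by (simp add: D_def)
  then obtain d where d: "d < 1" "\<And>z. d < cmod z \<Longrightarrow> cmod z < 1 \<Longrightarrow> w (1 - cmod z) * cmod (f z) < e / D"
    using f unfolding growth_space_iff[OF w] by blast
  have "w (1 - cmod z) * cmod (g z) < e" if "d < cmod z" "cmod z < 1" for z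
  proof -
    have "cmod (g z) \<le> D * cmod (f z)"
      using le[of z] that mult_right_mono[of C D "cmod (f z)"] by (simp add: D_def)
    then have "w (1 - cmod z) * cmod (g z) \<le> w (1 - cmod z) * (D * cmod (f z))"
      using that by (intro mult_left_mono majorant_nonneg[OF w]) auto
    also have "\<dots> = D * (w (1 - cmod z) * cmod (f z))" by simp
    also have "\<dots> < D * (e / D)" using d(2)[OF that] by (intro mult_strict_left_mono) (auto simp: D_def)
    also have "\<dots> = e" by (simp add: D_def)
    finally show ?thesis .
  qed
  then show "\<exists>d<1. \<forall>z. d < cmod z \<and> cmod z < 1 \<longrightarrow> w (1 - cmod z) * cmod (g z) < e"
    using d(1) by blast
qed

section \<open>Closed invariant subspaces\<close>

lemma closed_subspace_growth_space:
  assumes w: "majorant w"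
  shows "closed_subspace w (growth_space w)"
  unfolding closed_subspace_def
proof (intro conjI ballI allI impI)
  show "(\<lambda>z. 0) \<in> growth_space w" by (rule growth_space_bounded[OF w, of _ 0]) auto
next
  fix f g assume f: "f \<in> growth_space w" and g: "g \<in> growth_space w"
  show "(\<lambda>z. f z + g z) \<in> growth_space w"
    unfolding growth_space_iff[OF w]
  proof (intro conjI allI impI)
    show "(\<lambda>z. f z + g z) holomorphic_on ball 0 1"
      using f g by (intro holomorphic_intros) (auto simp: growth_space_def)
    fix e :: real assume "0 < e"
    then have "0 < e / 2" by simp
    obtain d1 where d1: "d1 < 1" "\<And>z. d1 < cmod z \<Longrightarrow> cmod z < 1 \<Longrightarrow> w (1 - cmod z) * cmod (f z) < e / 2"
      using f \<open>0 < e / 2\<close> unfolding growth_space_iff[OF w] by blast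
    obtain d2 where d2: "d2 < 1" "\<And>z. d2 < cmod z \<Longrightarrow> cmod z < 1 \<Longrightarrow> w (1 - cmod z) * cmod (g z) < e / 2"
      using g \<open>0 < e / 2\<close> unfolding growth_space_iff[OF w] by blast
    have "w (1 - cmod z) * cmod (f z + g z) < e" if "max d1 d2 < cmod z" "cmod z < 1" for z
    proof -
      have "w (1 - cmod z) * cmod (f z + g z) \<le> w (1 - cmod z) * (cmod (f z) + cmod (g z))"
        using that by (intro mult_left_mono norm_triangle_ineq majorant_nonneg[OF w]) auto
      also have "\<dots> < e" using d1(2)[of z] d2(2)[of z] that by (simp add: algebra_simps)
      finally show ?thesis .
    qed
    then show "\<exists>d<1. \<forall>z. d < cmod z \<and> cmod z < 1 \<longrightarrow> w (1 - cmod z) * cmod (f z + g z) < e"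
      using d1(1) d2(1) by (intro exI[of _ "max d1 d2"]) auto
  qed
next
  fix f :: "complex \<Rightarrow> complex" and c assume f: "f \<in> growth_space w"
  show "(\<lambda>z. c * f z) \<in> growth_space w"
    by (rule growth_space_dominated[OF w f, of _ "cmod c"])
      (use f in \<open>auto simp: growth_space_def norm_mult intro!: holomorphic_intros\<close>)
qed auto

lemma shift_invariant_growth_space:
  assumes w: "majorant w"
  shows "shift_invariant (growth_space w)"
  unfolding shift_invariant_def
proof
  fix f assume f: "f \<in> growth_space w"
  show "(\<lambda>z. z * f z) \<in> growth_space w"
  proof (rule growth_space_dominated[OF w f, of _ 1])
    show "(\<lambda>z. z * f z) holomorphic_on ball 0 1"
      using f by (intro holomorphic_intros) (auto simp: growth_space_def)
    show "cmod (z * f z) \<le> 1 * cmod (f z)" if "cmod z < 1" for z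
      using that by (simp add: norm_mult mult_left_le_one_le)
  qed
qed

text \<open>A pointwise bound with \<open>\<le>\<close> suffices: it bounds the supremum in
  \<open>growth_norm\<close> without a separate boundedness argument, and using it for
  \<open>e / 2\<close> restores the strict inequality in \<open>closed_subspace\<close>.\<close>

lemma closed_subspace_memI:
  assumes "closed_subspace w M" "f \<in> growth_space w"
    and approx: "\<And>e. 0 < e \<Longrightarrow>
      \<exists>h\<in>M. \<forall>z. cmod z < 1 \<longrightarrow> w (1 - cmod z) * cmod (f z - h z) \<le> e"
  shows "f \<in> M"
proof -
  have "\<exists>h\<in>M. growth_norm w (\<lambda>z. f z - h z) < e" if "0 < e" for e
  proof -
    have "0 < e / 2" using that by simp
    from approx[OF this] obtain h where "h \<in> M"
      and h: "\<And>z. cmod z < 1 \<Longrightarrow> w (1 - cmod z) * cmod (f z - h z) \<le> e / 2" by blast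
    have "growth_norm w (\<lambda>z. f z - h z) \<le> e / 2"
      unfolding growth_norm_def by (rule cSUP_least) (use h in auto)
    then show ?thesis using \<open>h \<in> M\<close> that by (intro bexI[of _ h]) auto
  qed
  then show ?thesis using assms(1,2) unfolding closed_subspace_def by blast
qed

lemma closed_subspace_poly_mult:
  assumes "closed_subspace w M" "shift_invariant M" "g \<in> M"
  shows "(\<lambda>z. poly p z * g z) \<in> M"
proof (induction p)
  case 0
  then show ?case using assms(1) by (simp add: closed_subspace_def)
next
  case (pCons a p)
  have "(\<lambda>z. z * (poly p z * g z)) \<in> M"
    using bspec[OF assms(2)[unfolded shift_invariant_def] pCons.IH] .
  moreover have add: "\<forall>f\<in>M. \<forall>g\<in>M. (\<lambda>z. f z + g z) \<in> M"
    and scale: "\<forall>c. \<forall>f\<in>M. (\<lambda>z. c * f z) \<in> M"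
    using assms(1) unfolding closed_subspace_def by blast+
  have "(\<lambda>z. a * g z) \<in> M" using bspec[OF spec[OF scale, of a] assms(3)] .
  ultimately have "(\<lambda>z. a * g z + z * (poly p z * g z)) \<in> M"
    using bspec[OF bspec[OF add]] by simp
  then show ?case by (simp add: algebra_simps)
qed

section \<open>Polynomial approximation and a criterion for cyclicity\<close>

lemma holomorphic_poly_approx:
  assumes F: "F holomorphic_on ball 0 R" and "1 < R" "0 < e"
  obtains p where "\<And>z. cmod z \<le> 1 \<Longrightarrow> cmod (F z - poly p z) \<le> e"
proof -
  define a where "a n = (deriv ^^ n) F 0 / fact n" for n
  have sums: "(\<lambda>n. a n * z ^ n) sums F z" if "cmod z < R" for z
    using holomorphic_power_series[OF F, of z] that by (simp add: a_def)
  \<comment> \<open>A point between the unit circle and the circle of radius \<open>R\<close>: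
    convergence of the Taylor series there pushes its radius of convergence strictly above
    \<open>1\<close>, so that it converges uniformly on the closed unit disc.\<close>
  define x :: complex where "x = of_real ((1 + R) / 2)"
  have x: "cmod x = (1 + R) / 2" using \<open>1 < R\<close> unfolding x_def norm_of_real by simp
  have "summable (\<lambda>n. a n * x ^ n)"
    using sums[of x] x \<open>1 < R\<close> by (auto simp: sums_iff)
  then have "ereal (cmod x) \<le> conv_radius a" by (rule conv_radius_geI)
  moreover have "ereal 1 < ereal (cmod x)" using x \<open>1 < R\<close> by simp
  ultimately have "ereal 1 < conv_radius a" by (rule order_less_le_trans[rotated])
  from powser_uniform_limit[OF this, of 0]
  have "uniform_limit (cball 0 1) (\<lambda>n z. \<Sum>i<n. a i * z ^ i) (\<lambda>z. suminf (\<lambda>i. a i * z ^ i)) sequentially"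
    by simp
  then obtain n where n: "\<forall>z\<in>cball 0 1. dist (\<Sum>i<n. a i * z ^ i) (suminf (\<lambda>i. a i * z ^ i)) < e"
    using \<open>0 < e\<close> unfolding uniform_limit_sequentially_iff by blast
  show thesis
  proof (rule that[of "\<Sum>i<n. monom (a i) i"])
    fix z :: complex assume z: "cmod z \<le> 1"
    then have "suminf (\<lambda>i. a i * z ^ i) = F z" using sums[of z] \<open>1 < R\<close> by (simp add: sums_iff)
    then show "cmod (F z - poly (\<Sum>i<n. monom (a i) i) z) \<le> e"
      using bspec[OF n, of z] z
      by (simp add: poly_sum poly_monom dist_norm norm_minus_commute[of "F z"])
  qed
qed

text \<open>Near the circle \<open>f z\<close> and \<open>f (r * z)\<close> are both small against
  the weight, the second because \<open>r * z\<close> lies deeper in the disc and \<open>w\<close>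
  is monotone. On a smaller closed disc uniform continuity takes over.\<close>

lemma growth_space_dilation_approx:
  assumes w: "majorant w" and f: "f \<in> growth_space w" and "0 < e"
  obtains r where "0 < r" "r < 1"
    "\<And>z. cmod z < 1 \<Longrightarrow> w (1 - cmod z) * cmod (f z - f (of_real r * z)) \<le> e"
proof -
  have holf: "f holomorphic_on ball 0 1" using f by (simp add: growth_space_def)
  have "0 < e / 2" using \<open>0 < e\<close> by simp
  then obtain d0 where "d0 < 1" "\<And>z. d0 < cmod z \<Longrightarrow> cmod z < 1 \<Longrightarrow> w (1 - cmod z) * cmod (f z) < e / 2"
    using f unfolding growth_space_iff[OF w] by blast
  moreover define d where "d = max d0 0"
  ultimately have d: "d < 1" "0 \<le> d" "\<And>z. d < cmod z \<Longrightarrow> cmod z < 1 \<Longrightarrow> w (1 - cmod z) * cmod (f z) < e / 2"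
    by auto
  define d' where "d' = (1 + d) / 2"
  have d': "d < d'" "d' < 1" using d by (auto simp: d'_def)
  have w1: "0 < w 1" using majorant_pos[OF w] by simp
  have "continuous_on (cball 0 d') f"
    by (rule continuous_on_subset[OF holomorphic_on_imp_continuous_on[OF holf]]) (use d' in auto)
  then have "uniformly_continuous_on (cball 0 d') f"
    by (intro compact_uniformly_continuous) auto
  then obtain \<delta> where \<delta>: "0 < \<delta>"
    "\<And>x y. x \<in> cball 0 d' \<Longrightarrow> y \<in> cball 0 d' \<Longrightarrow> dist y x < \<delta> \<Longrightarrow> dist (f y) (f x) < e / w 1"
    using \<open>0 < e\<close> w1 unfolding uniformly_continuous_on_def by (metis divide_pos_pos)
  \<comment> \<open>Two demands on \<open>r\<close>: being above \<open>q\<close> keeps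
    \<open>r * z\<close> outside radius \<open>d\<close> whenever \<open>z\<close> is outside radius
    \<open>d'\<close>, and \<open>1 - r < \<delta>\<close> serves uniform continuity inside.\<close>
  define q where "q = d / d'"
  define r where "r = max (1 - \<delta> / 2) ((q + 1) / 2)"
  have q: "0 \<le> q" "q < 1" using d d' by (auto simp: q_def field_simps)
  have r1: "1 - \<delta> / 2 \<le> r" and r2: "(q + 1) / 2 \<le> r" and r3: "r < 1"
    unfolding r_def using \<delta>(1) q by auto
  have r: "0 < r" "r < 1" "q < r" "1 - r \<le> \<delta> / 2"
    using r1 r2 r3 q by argo+
  show thesis
  proof (rule that[OF r(1,2)])
    fix z :: complex assume z: "cmod z < 1"
    have rz: "cmod (of_real r * z) = r * cmod z" using r by (simp add: norm_mult)
    have rz_le: "r * cmod z \<le> cmod z" using r by (simp add: mult_left_le_one_le)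
    show "w (1 - cmod z) * cmod (f z - f (of_real r * z)) \<le> e"
    proof (cases "cmod z \<le> d'")
      case True
      have "dist z (of_real r * z) = (1 - r) * cmod z"
      proof -
        have "z - of_real r * z = of_real (1 - r) * z" by (simp add: algebra_simps)
        then show ?thesis using r by (simp only: dist_norm norm_mult norm_of_real)
      qed
      also have "\<dots> \<le> 1 - r" using z r by (simp add: mult_left_le)
      also have "\<dots> < \<delta>" using r(4) \<delta>(1) by simp
      finally have "dist (f z) (f (of_real r * z)) < e / w 1"
        using True rz rz_le by (intro \<delta>(2)) auto
      then have "w (1 - cmod z) * cmod (f z - f (of_real r * z)) \<le> w 1 * (e / w 1)"
        unfolding dist_norm using z w1
        by (intro mult_mono majorant_mono[OF w]) auto
      then show ?thesis using w1 by simp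
    next
      case False
      have "d < r * d'" using r(3) d d' by (simp add: q_def field_simps)
      also have "\<dots> \<le> r * cmod z" using False r by (simp add: mult_left_mono)
      finally have gt: "d < cmod (of_real r * z)" using rz by simp
      have "w (1 - cmod z) * cmod (f z - f (of_real r * z))
          \<le> w (1 - cmod z) * (cmod (f z) + cmod (f (of_real r * z)))"
        using z by (intro mult_left_mono norm_triangle_ineq4 majorant_nonneg[OF w]) auto
      also have "\<dots> \<le> w (1 - cmod z) * cmod (f z)
          + w (1 - cmod (of_real r * z)) * cmod (f (of_real r * z))"
        using z rz rz_le r
        by (simp only: distrib_left) (intro add_left_mono mult_right_mono majorant_mono[OF w], auto)
      also have "\<dots> \<le> e"
        using d(3)[of z] d(3)[OF gt] False d' z rz rz_le by simp
      finally show ?thesis .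
    qed
  qed
qed

text \<open>Since \<open>F\<close> extends beyond the closed disc, it is uniformly close to a
  polynomial there, and \<open>g\<close> is bounded by \<open>1\<close>; so polynomial multiples of
  \<open>g\<close> approach the constant \<open>1\<close>. A closed invariant subspace containing
  \<open>1\<close> contains all polynomials, and these are dense because dilations approximate every
  element of the growth space.\<close>

lemma cyclic_in_growth_spaceI:
  assumes w: "majorant w" and g: "g holomorphic_on ball 0 1"
    and g_le: "\<And>z. cmod z < 1 \<Longrightarrow> cmod (g z) \<le> 1"
    and approx: "\<And>e. 0 < e \<Longrightarrow> \<exists>F R. 1 < R \<and> F holomorphic_on ball 0 R \<and>
      (\<forall>z. cmod z < 1 \<longrightarrow> w (1 - cmod z) * cmod (F z * g z - 1) \<le> e)"
  shows "cyclic_in_growth_space w g"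
proof -
  have gG: "g \<in> growth_space w" by (rule growth_space_bounded[OF w g g_le])
  have w1: "0 < w 1" using majorant_pos[OF w] by simp
  have "f \<in> M" if M: "closed_subspace w M" "shift_invariant M" "g \<in> M" and f: "f \<in> growth_space w"
    for f M
  proof -
    \<comment> \<open>As \<open>w\<close> is largest at \<open>1\<close>, a uniform error costs at
      most the factor \<open>w 1\<close>.\<close>
    have poly_err: "w (1 - cmod z) * cmod (F z - poly p z) \<le> e"
      if "cmod (F z - poly p z) \<le> e / w 1" "cmod z < 1" for F :: "complex \<Rightarrow> complex" and p z e
    proof -
      have "w (1 - cmod z) * cmod (F z - poly p z) \<le> w 1 * (e / w 1)"
        using that w1 by (intro mult_mono majorant_mono[OF w]) auto
      then show ?thesis using w1 by simp
    qed
    have one: "(\<lambda>z. 1) \<in> M"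
    proof (rule closed_subspace_memI[OF M(1)])
      show "(\<lambda>z. 1) \<in> growth_space w" by (rule growth_space_bounded[OF w, of _ 1]) auto
      fix e :: real assume "0 < e"
      then have e2: "0 < e / 2" "0 < e / 2 / w 1" using w1 by auto
      from approx[OF e2(1)] obtain F R where F: "1 < R" "F holomorphic_on ball 0 R"
        "\<And>z. cmod z < 1 \<Longrightarrow> w (1 - cmod z) * cmod (F z * g z - 1) \<le> e / 2" by blast
      from holomorphic_poly_approx[OF F(2,1) e2(2)] obtain p
        where p: "\<And>z. cmod z \<le> 1 \<Longrightarrow> cmod (F z - poly p z) \<le> e / 2 / w 1" by blast
      have "w (1 - cmod z) * cmod (1 - poly p z * g z) \<le> e" if z: "cmod z < 1" for z
      proof -
        have nn: "0 \<le> w (1 - cmod z)" using z by (intro majorant_nonneg[OF w]) auto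
        have "1 - poly p z * g z = (F z - poly p z) * g z - (F z * g z - 1)" by (simp add: algebra_simps)
        then have "cmod (1 - poly p z * g z) \<le> cmod ((F z - poly p z) * g z) + cmod (F z * g z - 1)"
          using norm_triangle_ineq4 by metis
        also have "cmod ((F z - poly p z) * g z) \<le> cmod (F z - poly p z)"
          using g_le[OF z] by (simp add: norm_mult mult_left_le)
        finally have "w (1 - cmod z) * cmod (1 - poly p z * g z)
            \<le> w (1 - cmod z) * cmod (F z - poly p z) + w (1 - cmod z) * cmod (F z * g z - 1)"
          using nn by (simp add: mult_left_mono flip: distrib_left)
        also have "\<dots> \<le> e / 2 + e / 2"
          using F(3)[OF z] poly_err[of F z p, OF p] z by (intro add_mono) auto
        finally show ?thesis by simp
      qed
      then show "\<exists>h\<in>M. \<forall>z. cmod z < 1 \<longrightarrow> w (1 - cmod z) * cmod (1 - h z) \<le> e"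
        by (intro bexI[of _ "\<lambda>z. poly p z * g z"] closed_subspace_poly_mult[OF M]) auto
    qed
    show "f \<in> M"
    proof (rule closed_subspace_memI[OF M(1) f])
      fix e :: real assume "0 < e"
      then have e2: "0 < e / 2" "0 < e / 2 / w 1" using w1 by auto
      from growth_space_dilation_approx[OF w f e2(1)] obtain r where r: "0 < r" "r < 1"
        "\<And>z. cmod z < 1 \<Longrightarrow> w (1 - cmod z) * cmod (f z - f (of_real r * z)) \<le> e / 2" by blast
      have "f holomorphic_on ball 0 1" using f by (simp add: growth_space_def)
      then have "(f \<circ> (\<lambda>z. of_real r * z)) holomorphic_on ball 0 (1 / r)"
        using r by (intro holomorphic_on_compose_gen holomorphic_intros)
          (auto simp: norm_mult field_simps)
      then obtain p where p: "\<And>z. cmod z \<le> 1 \<Longrightarrow> cmod (f (of_real r * z) - poly p z) \<le> e / 2 / w 1"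
        using holomorphic_poly_approx[of _ "1 / r", OF _ _ e2(2)] r by (auto simp: o_def)
      have "w (1 - cmod z) * cmod (f z - poly p z) \<le> e" if z: "cmod z < 1" for z
      proof -
        have nn: "0 \<le> w (1 - cmod z)" using z by (intro majorant_nonneg[OF w]) auto
        have "cmod (f z - poly p z) \<le> cmod (f z - f (of_real r * z)) + cmod (f (of_real r * z) - poly p z)"
          using norm_triangle_ineq[of "f z - f (of_real r * z)" "f (of_real r * z) - poly p z"] by simp
        then have "w (1 - cmod z) * cmod (f z - poly p z)
            \<le> w (1 - cmod z) * cmod (f z - f (of_real r * z)) + w (1 - cmod z) * cmod (f (of_real r * z) - poly p z)"
          using nn by (simp add: mult_left_mono flip: distrib_left)
        also have "\<dots> \<le> e / 2 + e / 2"
          using r(3)[OF z] poly_err[of "\<lambda>z. f (of_real r * z)" z p, OF p] z by (intro add_mono) auto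
        finally show ?thesis by simp
      qed
      then show "\<exists>h\<in>M. \<forall>z. cmod z < 1 \<longrightarrow> w (1 - cmod z) * cmod (f z - h z) \<le> e"
        using closed_subspace_poly_mult[OF M(1,2) one, of p] by auto
    qed
  qed
  moreover have "growth_space w \<in> {M. closed_subspace w M \<and> shift_invariant M \<and> g \<in> M}"
    using closed_subspace_growth_space[OF w] shift_invariant_growth_space[OF w] gG by simp
  ultimately show ?thesis unfolding cyclic_in_growth_space_def using gG by blast
qed

section \<open>Herglotz integrals\<close>

lemma space_finite_borel_on_circle: "finite_borel_on_circle \<sigma> \<Longrightarrow> space \<sigma> = sphere 0 1"
  using sets_eq_imp_space_eq[of \<sigma> circle_borel]
  by (simp add: finite_borel_on_circle_def circle_borel_def space_restrict_space)

lemma borel_measurable_on_circle: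
  fixes f :: "complex \<Rightarrow> 'a::topological_space"
  assumes "finite_borel_on_circle \<sigma>" and "continuous_on (sphere 0 1) f"
  shows "f \<in> borel_measurable \<sigma>"
proof -
  have "f \<in> borel_measurable circle_borel"
    unfolding circle_borel_def by (rule borel_measurable_continuous_on_restrict[OF assms(2)])
  moreover have "borel_measurable \<sigma> = (borel_measurable circle_borel :: (complex \<Rightarrow> 'a) set)"
    using assms(1) by (intro measurable_cong_sets refl) (simp add: finite_borel_on_circle_def)
  ultimately show ?thesis by blast
qed

lemma integrable_bounded_on_circle:
  fixes f :: "complex \<Rightarrow> 'a::{banach, second_countable_topology}"
  assumes \<sigma>: "finite_borel_on_circle \<sigma>" and f: "f \<in> borel_measurable \<sigma>"
    and "\<And>\<zeta>. cmod \<zeta> = 1 \<Longrightarrow> norm (f \<zeta>) \<le> B"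
  shows "integrable \<sigma> f"
proof -
  interpret finite_measure \<sigma> using \<sigma> by (simp add: finite_borel_on_circle_def)
  show ?thesis
    by (rule integrable_const_bound[OF _ f, of B])
      (use assms(3) space_finite_borel_on_circle[OF \<sigma>] in auto)
qed

lemma integrable_continuous_on_circle:
  fixes f :: "complex \<Rightarrow> 'a::{banach, second_countable_topology}"
  assumes \<sigma>: "finite_borel_on_circle \<sigma>" and f: "continuous_on (sphere 0 1) f"
  shows "integrable \<sigma> f"
proof -
  have "compact (f ` sphere 0 1)" by (intro compact_continuous_image f) auto
  then obtain B where B: "\<And>\<zeta>. \<zeta> \<in> sphere 0 1 \<Longrightarrow> norm (f \<zeta>) \<le> B"
    by (metis bounded_iff compact_imp_bounded imageI)
  show ?thesis
    by (rule integrable_bounded_on_circle[OF \<sigma> borel_measurable_on_circle[OF \<sigma> f], of B]) (use B in auto)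
qed

section \<open>The Herglotz transform and its Poisson part\<close>

definition herglotz :: "complex measure \<Rightarrow> complex \<Rightarrow> complex" where
  "herglotz \<sigma> z = (LINT \<zeta>|\<sigma>. (\<zeta> + z) / (\<zeta> - z))"

text \<open>The Poisson integral of \<open>\<sigma>\<close> without the factor
  \<open>1 - |z|^2\<close>. With this factor split off, one quantity serves both for the real part
  of the Herglotz integral and for its change under dilation.\<close>

definition inverse_square_potential :: "complex measure \<Rightarrow> complex \<Rightarrow> real" where
  "inverse_square_potential \<sigma> z = (LINT \<zeta>|\<sigma>. 1 / (cmod (\<zeta> - z))\<^sup>2)"

lemma singular_inner_eq: "singular_inner \<sigma> z = exp (- herglotz \<sigma> z)"
  by (simp add: singular_inner_def herglotz_def)

lemma circle_minus_nz: "cmod \<zeta> = 1 \<Longrightarrow> cmod z < 1 \<Longrightarrow> \<zeta> - z \<noteq> 0"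
  by auto

lemma circle_minus_ge: "cmod \<zeta> = 1 \<Longrightarrow> 1 - cmod z \<le> cmod (\<zeta> - z)"
  using norm_triangle_ineq2[of \<zeta> z] by simp

lemma integrable_herglotz:
  assumes "finite_borel_on_circle \<sigma>" "cmod z < 1"
  shows "integrable \<sigma> (\<lambda>\<zeta>. (\<zeta> + z) / (\<zeta> - z))"
  using circle_minus_nz[of _ z] assms
  by (intro integrable_continuous_on_circle continuous_intros) simp_all

lemma integrable_inverse_square:
  assumes "finite_borel_on_circle \<sigma>" "cmod z < 1"
  shows "integrable \<sigma> (\<lambda>\<zeta>. 1 / (cmod (\<zeta> - z))\<^sup>2)"
  using circle_minus_nz[of _ z] assms
  by (intro integrable_continuous_on_circle continuous_intros) simp_all

lemma inverse_square_potential_nonneg: "0 \<le> inverse_square_potential \<sigma> z"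
  unfolding inverse_square_potential_def by (intro Bochner_Integration.integral_nonneg) auto

text \<open>This is the Poisson kernel: the mixed terms of
  \<open>(\<zeta> + z) * cnj (\<zeta> - z)\<close> add up to an imaginary number.\<close>

lemma Re_herglotz_kernel:
  assumes "cmod \<zeta> = 1" "cmod z < 1"
  shows "Re ((\<zeta> + z) / (\<zeta> - z)) = (1 - (cmod z)\<^sup>2) * (1 / (cmod (\<zeta> - z))\<^sup>2)"
proof -
  have "(\<zeta> + z) / (\<zeta> - z) = (\<zeta> + z) * cnj (\<zeta> - z) / of_real ((cmod (\<zeta> - z))\<^sup>2)"
    using complex_div_cnj by (metis of_real_power)
  then have "Re ((\<zeta> + z) / (\<zeta> - z)) = Re ((\<zeta> + z) * cnj (\<zeta> - z)) / (cmod (\<zeta> - z))\<^sup>2"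
    by (simp add: Re_divide_of_real del: of_real_power)
  also have "Re ((\<zeta> + z) * cnj (\<zeta> - z)) = (cmod \<zeta>)\<^sup>2 - (cmod z)\<^sup>2"
    unfolding cmod_power2 by (simp add: algebra_simps power2_eq_square)
  finally show ?thesis using assms by simp
qed

lemma Re_herglotz:
  assumes \<sigma>: "finite_borel_on_circle \<sigma>" and z: "cmod z < 1"
  shows "Re (herglotz \<sigma> z) = (1 - (cmod z)\<^sup>2) * inverse_square_potential \<sigma> z"
proof -
  have "Re (herglotz \<sigma> z) = (LINT \<zeta>|\<sigma>. Re ((\<zeta> + z) / (\<zeta> - z)))"
    unfolding herglotz_def by (rule integral_Re[OF integrable_herglotz[OF assms], symmetric])
  also have "\<dots> = (LINT \<zeta>|\<sigma>. (1 - (cmod z)\<^sup>2) * (1 / (cmod (\<zeta> - z))\<^sup>2))"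
    using z space_finite_borel_on_circle[OF \<sigma>]
    by (intro Bochner_Integration.integral_cong refl Re_herglotz_kernel) auto
  also have "\<dots> = (1 - (cmod z)\<^sup>2) * inverse_square_potential \<sigma> z"
    unfolding inverse_square_potential_def by (rule Bochner_Integration.integral_mult_right_zero)
  finally show ?thesis .
qed

lemma Re_herglotz_nonneg:
  assumes "finite_borel_on_circle \<sigma>" "cmod z < 1"
  shows "0 \<le> Re (herglotz \<sigma> z)"
  unfolding Re_herglotz[OF assms] using assms(2) power_le_one[of "cmod z" 2]
  by (intro mult_nonneg_nonneg inverse_square_potential_nonneg) simp

lemma cmod_herglotz_le:
  assumes \<sigma>: "finite_borel_on_circle \<sigma>" and z: "cmod z < 1"
  shows "cmod (herglotz \<sigma> z) \<le> 2 / (1 - cmod z) * measure \<sigma> (space \<sigma>)"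
proof -
  interpret finite_measure \<sigma> using \<sigma> by (simp add: finite_borel_on_circle_def)
  have "cmod (herglotz \<sigma> z) \<le> (LINT \<zeta>|\<sigma>. cmod ((\<zeta> + z) / (\<zeta> - z)))"
    unfolding herglotz_def by (rule integral_norm_bound)
  also have "\<dots> \<le> (LINT \<zeta>|\<sigma>. 2 / (1 - cmod z))"
  proof (rule integral_mono)
    show "cmod ((\<zeta> + z) / (\<zeta> - z)) \<le> 2 / (1 - cmod z)" if "\<zeta> \<in> space \<sigma>" for \<zeta>
    proof -
      have "cmod \<zeta> = 1" using that space_finite_borel_on_circle[OF \<sigma>] by simp
      then show ?thesis
        unfolding norm_divide using z circle_minus_ge[of \<zeta> z] norm_triangle_ineq[of \<zeta> z]
        by (intro frac_le) auto
    qed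
  qed (use integrable_herglotz[OF assms] in auto)
  finally show ?thesis by (simp add: mult.commute)
qed

text \<open>The kernels differ by \<open>2 * \<zeta> * (1 - r) * z / ((\<zeta> - z) * (\<zeta> - r *
  z))\<close>. Passing from \<open>z\<close> to \<open>r * z\<close> moves by at most
  \<open>1 - r\<close>, itself at most \<open>|\<zeta> - r * z|\<close>; so
  \<open>|\<zeta> - z| \<le> 2 * |\<zeta> - r * z|\<close>, and the second factor of the denominator
  is traded for the first. The \<open>4\<close> is this \<open>2\<close> times the \<open>2\<close>
  of the kernel.\<close>

lemma herglotz_diff_le:
  assumes \<sigma>: "finite_borel_on_circle \<sigma>" and z: "cmod z < 1" and r: "0 \<le> r" "r < 1"
  shows "cmod (herglotz \<sigma> z - herglotz \<sigma> (of_real r * z))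
    \<le> 4 * (1 - r) * inverse_square_potential \<sigma> z"
proof -
  have rz: "cmod (of_real r * z) < 1"
    using z r mult_left_le_one_le[of "cmod z" r] by (simp add: norm_mult)
  let ?d = "\<lambda>\<zeta>. (\<zeta> + z) / (\<zeta> - z) - (\<zeta> + of_real r * z) / (\<zeta> - of_real r * z)"
  have int: "integrable \<sigma> ?d" using integrable_herglotz[OF \<sigma>] z rz by auto
  have "herglotz \<sigma> z - herglotz \<sigma> (of_real r * z) = (LINT \<zeta>|\<sigma>. ?d \<zeta>)"
    unfolding herglotz_def using integrable_herglotz[OF \<sigma>] z rz by simp
  then have "cmod (herglotz \<sigma> z - herglotz \<sigma> (of_real r * z)) \<le> (LINT \<zeta>|\<sigma>. cmod (?d \<zeta>))"
    by simp
  also have "\<dots> \<le> (LINT \<zeta>|\<sigma>. 4 * (1 - r) * (1 / (cmod (\<zeta> - z))\<^sup>2))"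
  proof (rule integral_mono)
    show "integrable \<sigma> (\<lambda>\<zeta>. cmod (?d \<zeta>))" using int by simp
    show "integrable \<sigma> (\<lambda>\<zeta>. 4 * (1 - r) * (1 / (cmod (\<zeta> - z))\<^sup>2))"
      by (intro Bochner_Integration.integrable_mult_right) (use integrable_inverse_square[OF \<sigma> z] in auto)
    fix \<zeta> assume "\<zeta> \<in> space \<sigma>"
    then have \<zeta>: "cmod \<zeta> = 1" using space_finite_borel_on_circle[OF \<sigma>] by simp
    define x where "x = cmod (\<zeta> - z)"
    define y where "y = cmod (\<zeta> - of_real r * z)"
    have nz: "\<zeta> - z \<noteq> 0" "\<zeta> - of_real r * z \<noteq> 0" using \<zeta> z rz by auto
    then have pos: "0 < x" "0 < y" by (auto simp: x_def y_def)
    have "r * cmod z \<le> r" using z r by (simp add: mult_left_le)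
    then have y_ge: "1 - r \<le> y"
      using circle_minus_ge[OF \<zeta>, of "of_real r * z"] r by (simp add: y_def norm_mult)
    have "x \<le> y + cmod (of_real r * z - z)"
      unfolding x_def y_def using norm_triangle_ineq[of "\<zeta> - of_real r * z" "of_real r * z - z"] by simp
    also have "of_real r * z - z = - (of_real (1 - r) * z)" by (simp add: algebra_simps)
    also have "cmod (- (of_real (1 - r) * z)) = (1 - r) * cmod z"
      using r by (simp only: norm_minus_cancel norm_mult norm_of_real)
    also have "(1 - r) * cmod z \<le> 1 - r" using z r by (simp add: mult_left_le)
    finally have xy: "x \<le> 2 * y" using y_ge by simp
    have "?d \<zeta> = 2 * \<zeta> * of_real (1 - r) * z / ((\<zeta> - z) * (\<zeta> - of_real r * z))"
      using nz by (simp add: divide_simps) (simp add: algebra_simps)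
    then have "cmod (?d \<zeta>) = 2 * (1 - r) * cmod z / (x * y)"
      using \<zeta> r by (simp only: norm_divide norm_mult norm_of_real x_def y_def) simp
    also have "\<dots> \<le> 2 * (1 - r) / (x * y)"
      using z r pos by (intro divide_right_mono) (auto simp: mult_left_le)
    also have "\<dots> \<le> 4 * (1 - r) * (1 / x\<^sup>2)"
    proof -
      have "2 * (1 - r) * x \<le> 2 * (1 - r) * (2 * y)" using xy r by (intro mult_left_mono) auto
      then show ?thesis using pos by (simp add: divide_simps power2_eq_square) (simp add: algebra_simps)
    qed
    finally show "cmod (?d \<zeta>) \<le> 4 * (1 - r) * (1 / (cmod (\<zeta> - z))\<^sup>2)" by (simp add: x_def)
  qed
  also have "\<dots> = 4 * (1 - r) * inverse_square_potential \<sigma> z"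
    unfolding inverse_square_potential_def by (rule Bochner_Integration.integral_mult_right_zero)
  finally show ?thesis .
qed

text \<open>Differentiation under the integral sign by hand: the difference quotient of the kernel
  minus its derivative \<open>2 * \<zeta> / (\<zeta> - a)^2\<close> is
  \<open>2 * \<zeta> * (z - a) / ((\<zeta> - z) * (\<zeta> - a)^2)\<close>, which tends to
  \<open>0\<close> uniformly in \<open>\<zeta>\<close>.\<close>

lemma herglotz_holomorphic:
  assumes \<sigma>: "finite_borel_on_circle \<sigma>"
  shows "herglotz \<sigma> holomorphic_on ball 0 1"
  unfolding holomorphic_on_open[OF open_ball]
proof
  interpret finite_measure \<sigma> using \<sigma> by (simp add: finite_borel_on_circle_def)
  fix a :: complex assume "a \<in> ball 0 1"
  then have a: "cmod a < 1" by simp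
  \<comment> \<open>Half the distance of \<open>a\<close> to the circle, so that every
    \<open>z\<close> within \<open>c\<close> of \<open>a\<close> still keeps distance
    \<open>c\<close> from the circle.\<close>
  define c where "c = (1 - cmod a) / 2"
  have c: "0 < c" using a by (simp add: c_def)
  define D where "D = (LINT \<zeta>|\<sigma>. 2 * \<zeta> / (\<zeta> - a)\<^sup>2)"
  have intD: "integrable \<sigma> (\<lambda>\<zeta>. 2 * \<zeta> / (\<zeta> - a)\<^sup>2)"
    using a by (intro integrable_continuous_on_circle[OF \<sigma>] continuous_intros) auto
  have bound: "cmod ((herglotz \<sigma> z - herglotz \<sigma> a) / (z - a) - D)
      \<le> cmod (z - a) * (2 / c ^ 3 * measure \<sigma> (space \<sigma>))"
    if z: "z \<noteq> a" "cmod (z - a) < c" for z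
  proof -
    have "cmod z \<le> cmod a + cmod (z - a)" using norm_triangle_ineq[of a "z - a"] by simp
    then have zc: "cmod z < 1 - c" using z(2) by (simp add: c_def field_simps)
    then have z1: "cmod z < 1" using c by simp
    let ?q = "\<lambda>\<zeta>. ((\<zeta> + z) / (\<zeta> - z) - (\<zeta> + a) / (\<zeta> - a)) / (z - a) - 2 * \<zeta> / (\<zeta> - a)\<^sup>2"
    have "(herglotz \<sigma> z - herglotz \<sigma> a) / (z - a) - D = (LINT \<zeta>|\<sigma>. ?q \<zeta>)"
      unfolding herglotz_def D_def using integrable_herglotz[OF \<sigma>] a z1 intD by simp
    then have "cmod ((herglotz \<sigma> z - herglotz \<sigma> a) / (z - a) - D) \<le> (LINT \<zeta>|\<sigma>. cmod (?q \<zeta>))"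
      by simp
    also have "\<dots> \<le> (LINT \<zeta>|\<sigma>. cmod (z - a) * (2 / c ^ 3))"
    proof (rule integral_mono)
      show "integrable \<sigma> (\<lambda>\<zeta>. cmod (?q \<zeta>))"
        using integrable_herglotz[OF \<sigma>] a z1 intD by simp
      fix \<zeta> assume "\<zeta> \<in> space \<sigma>"
      then have \<zeta>: "cmod \<zeta> = 1" using space_finite_borel_on_circle[OF \<sigma>] by simp
      have nz: "\<zeta> - z \<noteq> 0" "\<zeta> - a \<noteq> 0" "z - a \<noteq> 0" using \<zeta> z1 a z by auto
      have "(\<zeta> + z) / (\<zeta> - z) - (\<zeta> + a) / (\<zeta> - a) = 2 * \<zeta> * (z - a) / ((\<zeta> - z) * (\<zeta> - a))"
        using nz by (simp add: divide_simps) (simp add: algebra_simps)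
      then have "?q \<zeta> = 2 * \<zeta> / ((\<zeta> - z) * (\<zeta> - a)) - 2 * \<zeta> / (\<zeta> - a)\<^sup>2"
        using nz by simp
      also have "\<dots> = 2 * \<zeta> * (z - a) / ((\<zeta> - z) * (\<zeta> - a)\<^sup>2)"
        using nz by (simp add: divide_simps power2_eq_square) (simp add: algebra_simps)
      finally have "cmod (?q \<zeta>) = cmod (z - a) * (2 / (cmod (\<zeta> - z) * (cmod (\<zeta> - a))\<^sup>2))"
        using \<zeta> by (simp add: norm_divide norm_mult norm_power)
      also have "\<dots> \<le> cmod (z - a) * (2 / (c * c\<^sup>2))"
      proof -
        have "1 - cmod a = 2 * c" by (simp add: c_def)
        then have "c \<le> cmod (\<zeta> - z)" "c \<le> cmod (\<zeta> - a)"
          using circle_minus_ge[OF \<zeta>, of z] circle_minus_ge[OF \<zeta>, of a] zc c by linarith+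
        then have "c * c\<^sup>2 \<le> cmod (\<zeta> - z) * (cmod (\<zeta> - a))\<^sup>2" "0 < c * c\<^sup>2"
          using c by (auto intro!: mult_mono power_mono)
        then have "2 / (cmod (\<zeta> - z) * (cmod (\<zeta> - a))\<^sup>2) \<le> 2 / (c * c\<^sup>2)"
          by (intro frac_le) auto
        then show ?thesis by (intro mult_left_mono) auto
      qed
      finally show "cmod (?q \<zeta>) \<le> cmod (z - a) * (2 / c ^ 3)"
        by (simp add: power3_eq_cube power2_eq_square)
    qed simp
    finally show ?thesis by (simp add: algebra_simps)
  qed
  have "((\<lambda>z. (herglotz \<sigma> z - herglotz \<sigma> a) / (z - a) - D) \<longlongrightarrow> 0) (at a)"
  proof (rule Lim_null_comparison)
    show "\<forall>\<^sub>F z in at a. cmod ((herglotz \<sigma> z - herglotz \<sigma> a) / (z - a) - D)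
        \<le> cmod (z - a) * (2 / c ^ 3 * measure \<sigma> (space \<sigma>))"
      unfolding eventually_at using c bound by (intro exI[of _ c]) (auto simp: dist_norm)
    have "((\<lambda>z. cmod (z - a) * (2 / c ^ 3 * measure \<sigma> (space \<sigma>))) \<longlongrightarrow>
        cmod (a - a) * (2 / c ^ 3 * measure \<sigma> (space \<sigma>))) (at a)"
      by (intro tendsto_intros)
    then show "((\<lambda>z. cmod (z - a) * (2 / c ^ 3 * measure \<sigma> (space \<sigma>))) \<longlongrightarrow> 0) (at a)"
      by simp
  qed
  then have "(herglotz \<sigma> has_field_derivative D) (at a)"
    unfolding has_field_derivative_iff using Lim_null by blast
  then show "\<exists>f'. (herglotz \<sigma> has_field_derivative f') (at a)" by blast
qed

text \<open>The Poisson kernel has mean \<open>1\<close>. Cauchy's formula at \<open>z\<close> is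
  applied to \<open>1 / (1 - cnj z * u)\<close>, holomorphic on the closed disc; on the circle
  \<open>1 / u = cnj u\<close>, and with the factor \<open>u\<close> from the derivative of the path
  the integrand becomes \<open>1 / |u - z|^2\<close>.\<close>

lemma has_integral_poisson_kernel:
  assumes z: "cmod z < 1"
  shows "((\<lambda>t. 1 / (cmod (cis (2 * pi * t) - z))\<^sup>2) has_integral 1 / (1 - (cmod z)\<^sup>2)) {0..1}"
proof -
  define f where "f u = 1 / (1 - cnj z * u)" for u
  have nz: "1 - cnj z * u \<noteq> 0" if "cmod u \<le> 1" for u
  proof
    assume "1 - cnj z * u = 0"
    then have "cmod (cnj z * u) = 1" by (metis eq_iff_diff_eq_0 norm_one)
    moreover have "cmod (cnj z * u) \<le> cmod z" using that by (simp add: norm_mult mult_left_le)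
    ultimately show False using z by simp
  qed
  have "f holomorphic_on cball 0 1"
    unfolding f_def by (intro holomorphic_intros) (use nz in auto)
  then have "((\<lambda>u. f u / (u - z)) has_contour_integral (2 * of_real pi * \<i> * f z)) (circlepath 0 1)"
    by (rule Cauchy_integral_circlepath_simple) (use z in auto)
  then have "((\<lambda>t. f (cis (2 * pi * t)) / (cis (2 * pi * t) - z) * (2 * pi * \<i> * cis (2 * pi * t)))
      has_integral (2 * of_real pi * \<i> * f z)) {0..1}"
    unfolding has_contour_integral_def
  proof (rule has_integral_eq[rotated])
    fix t :: real assume t: "t \<in> {0..1}"
    have cp: "circlepath 0 1 t = cis (2 * pi * t)" by (simp add: circlepath cis_conv_exp mult_ac)
    have "vector_derivative (circlepath 0 1) (at t within {0..1}) = 2 * pi * \<i> * cis (2 * pi * t)"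
      using t vector_derivative_circlepath01[of t 0 1] by (simp add: cis_conv_exp mult_ac)
    then show "f (circlepath 0 1 t) / (circlepath 0 1 t - z)
          * vector_derivative (circlepath 0 1) (at t within {0..1})
        = f (cis (2 * pi * t)) / (cis (2 * pi * t) - z) * (2 * pi * \<i> * cis (2 * pi * t))"
      unfolding cp by simp
  qed
  from has_integral_mult_right[OF this, of "1 / (2 * of_real pi * \<i>)"]
  have "((\<lambda>t. f (cis (2 * pi * t)) / (cis (2 * pi * t) - z) * cis (2 * pi * t))
      has_integral f z) {0..1}"
    by (simp add: mult_ac)
  moreover have "f (cis x) / (cis x - z) * cis x = of_real (1 / (cmod (cis x - z))\<^sup>2)" for x
  proof -
    have "cis x * (cnj (cis x) - cnj z) = 1 - cnj z * cis x"
      using complex_norm_square[of "cis x"] by (simp add: algebra_simps)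
    moreover have "cis x \<noteq> 0" by simp
    ultimately have "f (cis x) * cis x = 1 / (cnj (cis x) - cnj z)"
      unfolding f_def by (metis nonzero_mult_divide_mult_cancel_left mult.commute mult.right_neutral times_divide_eq_left)
    then have "f (cis x) * cis x / (cis x - z) = 1 / (cnj (cis x) - cnj z) / (cis x - z)" by (rule arg_cong)
    then have "f (cis x) / (cis x - z) * cis x = 1 / ((cis x - z) * cnj (cis x - z))"
      by (simp add: mult.commute)
    then show ?thesis by (simp only: complex_norm_square of_real_divide of_real_1)
  qed
  moreover have "f z = of_real (1 / (1 - (cmod z)\<^sup>2))"
    unfolding f_def using complex_norm_square[of z] by (simp add: mult.commute)
  ultimately have "((\<lambda>t. complex_of_real (1 / (cmod (cis (2 * pi * t) - z))\<^sup>2))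
      has_integral of_real (1 / (1 - (cmod z)\<^sup>2))) {0..1}"
    by simp
  from has_integral_linear[OF this bounded_linear_Re] show ?thesis by (simp add: o_def)
qed

section \<open>Dyadic arcs\<close>

text \<open>In this coordinate with values in \<open>[0, 1)\<close>, \<open>circle_lebesgue\<close>
  is Lebesgue measure on the unit interval, and the half-open dyadic intervals partition the circle
  into arcs.\<close>

definition turn :: "complex \<Rightarrow> real" where
  "turn \<zeta> = Arg2pi \<zeta> / (2 * pi)"

definition dyadic_index :: "nat \<Rightarrow> complex \<Rightarrow> nat" where
  "dyadic_index m \<zeta> = nat \<lfloor>2 ^ m * turn \<zeta>\<rfloor>"

lemma turn_ge_0: "0 \<le> turn \<zeta>" and turn_less_1: "turn \<zeta> < 1"
  using Arg2pi_ge_0[of \<zeta>] Arg2pi_lt_2pi[of \<zeta>] by (auto simp: turn_def)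

lemma cis_turn: "cmod \<zeta> = 1 \<Longrightarrow> cis (2 * pi * turn \<zeta>) = \<zeta>"
  using complex_norm_eq_1_exp[of \<zeta>] by (simp add: turn_def cis_conv_exp)

lemma turn_cis: "0 \<le> t \<Longrightarrow> t < 1 \<Longrightarrow> turn (cis (2 * pi * t)) = t"
  using Arg2pi_unique[of 1 "2 * pi * t" "cis (2 * pi * t)"]
  by (simp add: turn_def cis_conv_exp)

text \<open>The angle jumps across the positive real axis, yet its sublevel sets are closed.\<close>

lemma borel_measurable_turn [measurable]: "turn \<in> borel_measurable borel"
proof -
  have "Arg2pi \<in> borel_measurable borel"
    unfolding borel_measurable_iff_le using closed_Arg2pi2pi_le by auto
  then show ?thesis unfolding turn_def by measurable
qed

lemma measurable_dyadic_index [measurable]: "dyadic_index m \<in> measurable borel (count_space UNIV)"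
  unfolding dyadic_index_def by measurable

lemma dyadic_index_bounds:
  "real (dyadic_index m \<zeta>) / 2 ^ m \<le> turn \<zeta>" "turn \<zeta> < (real (dyadic_index m \<zeta>) + 1) / 2 ^ m"
proof -
  have "0 \<le> \<lfloor>2 ^ m * turn \<zeta>\<rfloor>" using turn_ge_0[of \<zeta>] by simp
  then have "real (dyadic_index m \<zeta>) = of_int \<lfloor>2 ^ m * turn \<zeta>\<rfloor>" by (simp add: dyadic_index_def)
  then have "real (dyadic_index m \<zeta>) \<le> 2 ^ m * turn \<zeta>" "2 ^ m * turn \<zeta> < real (dyadic_index m \<zeta>) + 1"
    by linarith+
  then show "real (dyadic_index m \<zeta>) / 2 ^ m \<le> turn \<zeta>" "turn \<zeta> < (real (dyadic_index m \<zeta>) + 1) / 2 ^ m"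
    by (simp_all add: field_simps)
qed

lemma dyadic_index_less: "dyadic_index m \<zeta> < 2 ^ m"
proof -
  have "real (dyadic_index m \<zeta>) / 2 ^ m < 1"
    using dyadic_index_bounds(1)[of m \<zeta>] turn_less_1[of \<zeta>] by linarith
  then have "real (dyadic_index m \<zeta>) < real (2 ^ m)" by simp
  then show ?thesis by (simp only: of_nat_less_iff)
qed

lemma dist_cis_le: "cmod (cis a - cis b) \<le> \<bar>a - b\<bar>"
proof -
  have "cis a - cis b = cis b * (exp (\<i> * of_real (a - b)) - 1)"
    unfolding cis_conv_exp[symmetric] by (simp add: right_diff_distrib cis_mult)
  then have "cmod (cis a - cis b) = 2 * \<bar>sin ((a - b) / 2)\<bar>"
    by (simp only: norm_mult norm_cis dist_exp_i_1)
  also have "\<dots> \<le> 2 * \<bar>(a - b) / 2\<bar>" by (intro mult_left_mono abs_sin_x_le_abs_x) auto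
  finally show ?thesis by simp
qed

text \<open>A Harnack-type comparison. If \<open>z\<close> keeps distance \<open>1 / n\<close> from
  the circle, \<open>n = 2 ^ m\<close>, then the kernel varies over an arc of generation
  \<open>m\<close> by at most the factor \<open>(1 + 2 * pi)^2\<close>, as such an arc has Euclidean
  length \<open>2 * pi / n\<close>. Up to this factor the kernel may be averaged over each arc,
  which replaces \<open>\<sigma>\<close> by \<open>b\<close> times normalized Lebesgue measure,
  whose Poisson integral is \<open>b\<close>.\<close>

lemma inverse_square_potential_le:
  assumes \<sigma>: "finite_borel_on_circle \<sigma>" and "0 \<le> b"
    and small: "\<And>j. j < 2 ^ m \<Longrightarrow> measure \<sigma> {\<zeta> \<in> space \<sigma>. dyadic_index m \<zeta> = j} \<le> b / 2 ^ m"
    and z: "cmod z \<le> 1 - 1 / 2 ^ m"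
  shows "(1 - (cmod z)\<^sup>2) * inverse_square_potential \<sigma> z \<le> (1 + 2 * pi)\<^sup>2 * b"
proof -
  interpret finite_measure \<sigma> using \<sigma> by (simp add: finite_borel_on_circle_def)
  define n :: real where "n = 2 ^ m"
  define K where "K = (1 + 2 * pi)\<^sup>2"
  have "0 < 1 + 2 * pi" using pi_gt_zero by linarith
  then have n: "0 < n" and K: "0 < K" by (auto simp: n_def K_def)
  have z': "cmod z \<le> 1 - 1 / n" using z by (simp add: n_def)
  then have z1: "cmod z < 1" using n by (smt (verit) divide_pos_pos)
  let ?k = "\<lambda>t. 1 / (cmod (cis (2 * pi * t) - z))\<^sup>2"
  define A where "A j = {real j / n..(real j + 1) / n}" for j
  define I where "I j = integral (A j) ?k" for j
  have cont: "continuous_on T ?k" for T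
    using circle_minus_nz[OF norm_cis z1] by (intro continuous_intros) simp
  have int: "?k integrable_on {a..b}" for a b
    using cont by (intro integrable_continuous_real)
  have I_nonneg: "0 \<le> I j" for j
    unfolding I_def A_def by (rule integral_nonneg[OF int]) auto
  have sum_I: "(\<Sum>j<i. I j) = integral {0..real i / n} ?k" for i
  proof (induction i)
    case (Suc i)
    then show ?case
      using n Henstock_Kurzweil_Integration.integral_combine[of 0 "real i / n" "(real i + 1) / n" ?k, OF _ _ int]
      by (simp add: I_def A_def add.commute divide_right_mono)
  qed simp
  have total: "(\<Sum>j<2 ^ m. I j) = 1 / (1 - (cmod z)\<^sup>2)"
    unfolding sum_I using integral_unique[OF has_integral_poisson_kernel[OF z1]] by (simp add: n_def)
  have cells[measurable]: "{\<zeta> \<in> space \<sigma>. dyadic_index m \<zeta> = j} \<in> sets \<sigma>" for j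
  proof -
    have "dyadic_index m \<in> measurable \<sigma> (count_space UNIV)"
      using \<sigma> measurable_cong_sets[of \<sigma> circle_borel] measurable_restrict_space1[OF measurable_dyadic_index]
      by (auto simp: finite_borel_on_circle_def circle_borel_def)
    then show ?thesis by measurable
  qed
  have int_cells: "integrable \<sigma> (indicat_real {\<zeta> \<in> space \<sigma>. dyadic_index m \<zeta> = j})" for j
    by (intro integrable_real_indicator cells) (simp add: emeasure_eq_measure)
  have pointwise: "1 / (cmod (\<zeta> - z))\<^sup>2
      \<le> (\<Sum>j<2 ^ m. K * n * I j * indicat_real {\<zeta> \<in> space \<sigma>. dyadic_index m \<zeta> = j} \<zeta>)"
    if "\<zeta> \<in> space \<sigma>" for \<zeta>
  proof -
    have \<zeta>: "cmod \<zeta> = 1" using that space_finite_borel_on_circle[OF \<sigma>] by simp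
    define j where "j = dyadic_index m \<zeta>"
    have j: "real j / n \<le> turn \<zeta>" "turn \<zeta> < (real j + 1) / n"
      using dyadic_index_bounds[where m = m and \<zeta> = \<zeta>] by (simp_all add: j_def n_def)
    have "1 / (cmod (\<zeta> - z))\<^sup>2 \<le> K * ?k t" if t: "t \<in> A j" for t
    proof -
      have "\<bar>t - turn \<zeta>\<bar> \<le> 1 / n" using t j n by (simp add: A_def field_simps abs_le_iff)
      then have "2 * pi * \<bar>t - turn \<zeta>\<bar> \<le> 2 * pi * (1 / n)" by (intro mult_left_mono) auto
      moreover have "2 * pi * \<bar>t - turn \<zeta>\<bar> = \<bar>2 * pi * t - 2 * pi * turn \<zeta>\<bar>"
        by (simp add: abs_mult flip: right_diff_distrib)
      ultimately have d: "cmod (cis (2 * pi * t) - \<zeta>) \<le> 2 * pi * (1 / n)"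
        using dist_cis_le[of "2 * pi * t" "2 * pi * turn \<zeta>"] cis_turn[OF \<zeta>] by simp
      have ge: "1 / n \<le> cmod (\<zeta> - z)" using circle_minus_ge[OF \<zeta>, of z] z' by simp
      have "cmod (cis (2 * pi * t) - z) \<le> cmod (cis (2 * pi * t) - \<zeta>) + cmod (\<zeta> - z)"
        using norm_triangle_ineq[of "cis (2 * pi * t) - \<zeta>" "\<zeta> - z"] by simp
      also have "\<dots> \<le> 2 * pi * cmod (\<zeta> - z) + cmod (\<zeta> - z)"
        using d mult_left_mono[OF ge, of "2 * pi"] by simp
      finally have "cmod (cis (2 * pi * t) - z) \<le> (1 + 2 * pi) * cmod (\<zeta> - z)"
        by (simp add: algebra_simps)
      then have "(cmod (cis (2 * pi * t) - z))\<^sup>2 \<le> K * (cmod (\<zeta> - z))\<^sup>2"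
        unfolding K_def power_mult_distrib[symmetric] by (rule power_mono) auto
      moreover have "0 < cmod (\<zeta> - z)" using \<zeta> z1 by auto
      moreover have "0 < cmod (cis (2 * pi * t) - z)" using z1 by auto
      ultimately show ?thesis by (simp add: divide_simps)
    qed
    \<comment> \<open>Integration over \<open>A j\<close>, which has length \<open>1 / n\<close>,
      passes from the kernel at single points to its average over the arc.\<close>
    then have "integral (A j) (\<lambda>_. 1 / (cmod (\<zeta> - z))\<^sup>2) \<le> integral (A j) (\<lambda>t. K * ?k t)"
      unfolding A_def by (intro integral_le integrable_on_mult_right int integrable_const_ivl)
    moreover have "integral (A j) (\<lambda>_. 1 / (cmod (\<zeta> - z))\<^sup>2) = 1 / n * (1 / (cmod (\<zeta> - z))\<^sup>2)"
      using n by (simp add: A_def divide_right_mono add_divide_distrib)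
    moreover have "integral (A j) (\<lambda>t. K * ?k t) = K * I j" unfolding I_def by (rule integral_mult_right)
    ultimately have "1 / n * (1 / (cmod (\<zeta> - z))\<^sup>2) \<le> K * I j" by linarith
    then have "n * (1 / n * (1 / (cmod (\<zeta> - z))\<^sup>2)) \<le> n * (K * I j)"
      using n by (intro mult_left_mono) auto
    then have "1 / (cmod (\<zeta> - z))\<^sup>2 \<le> K * n * I j" using n by (simp add: mult_ac)
    also have "\<dots> = (\<Sum>i<2 ^ m. (if j = i then K * n * I i else 0))"
      using dyadic_index_less[of m \<zeta>] by (simp add: j_def)
    also have "\<dots> = (\<Sum>i<2 ^ m. K * n * I i * indicat_real {\<zeta> \<in> space \<sigma>. dyadic_index m \<zeta> = i} \<zeta>)"
      using that by (intro sum.cong) (auto simp: j_def)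
    finally show ?thesis .
  qed
  have "inverse_square_potential \<sigma> z
      \<le> (LINT \<zeta>|\<sigma>. (\<Sum>j<2 ^ m. K * n * I j * indicat_real {\<zeta> \<in> space \<sigma>. dyadic_index m \<zeta> = j} \<zeta>))"
    unfolding inverse_square_potential_def
    by (intro integral_mono integrable_inverse_square[OF \<sigma> z1] pointwise
          Bochner_Integration.integrable_sum Bochner_Integration.integrable_mult_right int_cells)
  also have "\<dots> = (\<Sum>j<2 ^ m. K * n * I j * measure \<sigma> {\<zeta> \<in> space \<sigma>. dyadic_index m \<zeta> = j})"
    using int_cells by (subst Bochner_Integration.integral_sum) auto
  also have "\<dots> \<le> (\<Sum>j<2 ^ m. K * n * I j * (b / n))"
    using small I_nonneg K n by (intro sum_mono mult_left_mono) (auto simp: n_def)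
  also have "\<dots> = K * b * (\<Sum>j<2 ^ m. I j)"
    using n by (simp add: sum_distrib_left mult_ac)
  also have "\<dots> = K * b / (1 - (cmod z)\<^sup>2)" using total by simp
  finally have "inverse_square_potential \<sigma> z \<le> K * b / (1 - (cmod z)\<^sup>2)" .
  moreover have "0 < 1 - (cmod z)\<^sup>2" using z1 by (simp add: power_less_one_iff)
  ultimately show ?thesis by (simp add: K_def field_simps)
qed

section \<open>Dyadic sets of finite entropy\<close>

lemma measurable_cis_turn: "(\<lambda>t. cis (2 * pi * t)) \<in> measurable borel circle_borel"
  unfolding circle_borel_def
  by (intro measurable_restrict_space2 borel_measurable_continuous_onI continuous_intros) auto

text \<open>On the unit interval \<open>turn\<close> undoes the parametrization except at the
  endpoint \<open>1\<close>, which is sent to \<open>0\<close>; this single point is null.\<close>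

lemma nn_integral_circle_lebesgue:
  assumes F: "F \<in> borel_measurable borel"
  shows "(\<integral>\<^sup>+\<zeta>. F (turn \<zeta>) \<partial>circle_lebesgue) = (\<integral>\<^sup>+t. F t * indicator {0..<1} t \<partial>lborel)"
proof -
  have Ft: "(\<lambda>\<zeta>. F (turn \<zeta>)) \<in> borel_measurable borel"
    using F by measurable
  have "(\<lambda>\<zeta>. F (turn \<zeta>)) \<in> borel_measurable circle_borel"
    unfolding circle_borel_def by (rule measurable_restrict_space1[OF Ft])
  then have "(\<integral>\<^sup>+\<zeta>. F (turn \<zeta>) \<partial>circle_lebesgue)
      = (\<integral>\<^sup>+t. F (turn (cis (2 * pi * t))) \<partial>uniform_measure lborel {0..1})"
    unfolding circle_lebesgue_def using measurable_cis_turn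
    by (subst nn_integral_distr) (auto simp: measurable_def uniform_measure_def)
  also have "\<dots> = (\<integral>\<^sup>+t. F (turn (cis (2 * pi * t))) * indicator {0..1} t \<partial>lborel)"
  proof -
    have "(\<lambda>t. F (turn (cis (2 * pi * t)))) \<in> borel_measurable lborel"
    proof -
      have "(\<lambda>t. cis (2 * pi * t)) \<in> borel_measurable borel"
        by (intro borel_measurable_continuous_onI continuous_intros)
      from measurable_compose[OF this Ft] show ?thesis by simp
    qed
    then show ?thesis by (subst nn_integral_uniform_measure) (auto simp: divide_ennreal_def)
  qed
  also have "\<dots> = (\<integral>\<^sup>+t. F t * indicator {0..<1} t \<partial>lborel)"
  proof (rule nn_integral_cong_AE)
    have "AE t in lborel. t \<noteq> (1::real)" by (rule AE_lborel_singleton)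
    then show "AE t in lborel. F (turn (cis (2 * pi * t))) * indicator {0..1} t = F t * indicator {0..<1} t"
      by eventually_elim (auto simp: turn_cis indicator_def)
  qed
  finally show ?thesis .
qed

text \<open>The endpoints of dyadic arcs of all generations form a countable set. Away from them,
  membership in a closed arc and \<open>dyadic_index\<close> agree.\<close>

lemma AE_circle_lebesgue_nondyadic:
  "AE \<zeta> in circle_lebesgue. \<forall>m::nat. frac (2 ^ m * turn \<zeta>) \<noteq> 0"
proof -
  have "AE \<zeta> in circle_lebesgue. frac (2 ^ m * turn \<zeta>) \<noteq> 0" for m :: nat
  proof -
    let ?F = "\<lambda>t::real. indicator {t. frac (2 ^ m * t) = 0} t :: ennreal"
    have F[measurable]: "{t::real. frac (2 ^ m * t) = 0} \<in> sets borel"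
      unfolding frac_def by measurable
    have meas: "{\<zeta> \<in> space circle_lebesgue. frac (2 ^ m * turn \<zeta>) \<noteq> 0} \<in> sets circle_lebesgue"
    proof -
      have "{\<zeta>. frac (2 ^ m * turn \<zeta>) \<noteq> 0} \<in> sets borel" unfolding frac_def by measurable
      then show ?thesis
        by (auto simp: circle_lebesgue_def circle_borel_def space_restrict_space sets_restrict_space
            intro!: image_eqI[of _ _ "{\<zeta>. frac (2 ^ m * turn \<zeta>) \<noteq> 0}"])
    qed
    have "countable {t::real. frac (2 ^ m * t) = 0}"
    proof (rule countable_subset)
      show "{t::real. frac (2 ^ m * t) = 0} \<subseteq> range (\<lambda>i::int. of_int i / 2 ^ m)"
      proof
        fix t :: real assume "t \<in> {t. frac (2 ^ m * t) = 0}"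
        then obtain i :: int where "2 ^ m * t = of_int i" by (auto simp: frac_eq_0_iff elim: Ints_cases)
        then have "t = of_int i / 2 ^ m" by (simp add: field_simps)
        then show "t \<in> range (\<lambda>i::int. of_int i / 2 ^ m)" by blast
      qed
    qed auto
    then have "{t::real. frac (2 ^ m * t) = 0} \<in> null_sets lborel"
      by (rule countable_imp_null_set_lborel)
    then have "AE t in lborel. frac (2 ^ m * t) \<noteq> (0::real)"
      by (drule_tac AE_not_in) auto
    then have "AE t in lborel. ?F t * indicator {0..<1} t = 0"
      by eventually_elim simp
    moreover have "(\<lambda>t. ?F t * indicator {0..<1} t) \<in> borel_measurable lborel" by measurable
    ultimately have "(\<integral>\<^sup>+t. ?F t * indicator {0..<1} t \<partial>lborel) = 0"
      by (simp only: nn_integral_0_iff_AE)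
    then have "(\<integral>\<^sup>+\<zeta>. ?F (turn \<zeta>) \<partial>circle_lebesgue) = 0"
    proof -
      have "?F \<in> borel_measurable borel" by measurable
      then show ?thesis
        using \<open>(\<integral>\<^sup>+t. ?F t * indicator {0..<1} t \<partial>lborel) = 0\<close> nn_integral_circle_lebesgue by metis
    qed
    moreover have "(\<integral>\<^sup>+\<zeta>. ?F (turn \<zeta>) \<partial>circle_lebesgue)
        = (\<integral>\<^sup>+\<zeta>. indicator {\<zeta>. \<not> frac (2 ^ m * turn \<zeta>) \<noteq> 0} \<zeta> \<partial>circle_lebesgue)"
      by (intro nn_integral_cong) (auto simp: indicator_def)
    ultimately show ?thesis using AE_iff_nn_integral[OF meas] by simp
  qed
  then show ?thesis by (subst AE_all_countable) blast
qed

text \<open>The substitution \<open>t = (j + x) / N\<close> stretches the cell to the unit interval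
  and turns \<open>frac (N * t)\<close> into \<open>x\<close>.\<close>

lemma nn_integral_grid_interval:
  fixes g :: "real \<Rightarrow> ennreal" and N j :: nat
  assumes g[measurable]: "g \<in> borel_measurable borel" and N: "0 < N"
  shows "(\<integral>\<^sup>+t. g (frac (N * t)) * indicator {real j / N..<(real j + 1) / N} t \<partial>lborel)
    = ennreal (1 / N) * (\<integral>\<^sup>+t. g t * indicator {0..<1} t \<partial>lborel)"
proof -
  have "(\<integral>\<^sup>+t. g (frac (N * t)) * indicator {real j / N..<(real j + 1) / N} t \<partial>lborel)
     = \<bar>1 / N\<bar> * (\<integral>\<^sup>+x. g (frac (N * (real j / N + 1 / N * x)))
          * indicator {real j / N..<(real j + 1) / N} (real j / N + 1 / N * x) \<partial>lborel)"
    using N by (intro nn_integral_real_affine) (auto simp: frac_def)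
  also have "(\<integral>\<^sup>+x. g (frac (N * (real j / N + 1 / N * x)))
          * indicator {real j / N..<(real j + 1) / N} (real j / N + 1 / N * x) \<partial>lborel)
      = (\<integral>\<^sup>+t. g t * indicator {0..<1} t \<partial>lborel)"
  proof (rule nn_integral_cong)
    fix x :: real
    have a: "N * (real j / N + 1 / N * x) = x + of_int (int j)" using N by (simp add: field_simps)
    have b: "real j / N + 1 / N * x \<in> {real j / N..<(real j + 1) / N} \<longleftrightarrow> x \<in> {0..<1}"
      using N by (auto simp: field_simps)
    show "g (frac (N * (real j / N + 1 / N * x)))
          * indicator {real j / N..<(real j + 1) / N} (real j / N + 1 / N * x) = g x * indicator {0..<1} x"
    proof -
      have "frac (x + of_int (int j)) = frac x" by (simp add: frac_def)
      then show ?thesis unfolding a indicator_def b by (auto simp: frac_eq)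
    qed
  qed
  finally show ?thesis by simp
qed

lemma nn_integral_frac_multiple:
  fixes g :: "real \<Rightarrow> ennreal" and N :: nat
  assumes g[measurable]: "g \<in> borel_measurable borel" and N: "0 < N"
  shows "(\<integral>\<^sup>+t. g (frac (N * t)) * indicator {0..<1} t \<partial>lborel)
    = (\<integral>\<^sup>+t. g t * indicator {0..<1} t \<partial>lborel)"
proof -
  have ind: "indicator {0..<1} t = (\<Sum>j<N. indicator {real j / N..<(real j + 1) / N} t :: ennreal)" for t :: real
  proof -
    have iff: "t \<in> {real j / N..<(real j + 1) / N} \<longleftrightarrow> 0 \<le> t \<and> j = nat \<lfloor>N * t\<rfloor>" for j :: nat
    proof -
      have "t \<in> {real j / N..<(real j + 1) / N} \<longleftrightarrow> real j \<le> N * t \<and> N * t < real j + 1"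
        using N by (auto simp: field_simps)
      also have "\<dots> \<longleftrightarrow> \<lfloor>N * t\<rfloor> = int j" by (auto simp: floor_eq_iff)
      also have "\<dots> \<longleftrightarrow> 0 \<le> t \<and> j = nat \<lfloor>N * t\<rfloor>"
      proof -
        have "0 \<le> \<lfloor>N * t\<rfloor> \<longleftrightarrow> 0 \<le> t" using N by (simp add: zero_le_mult_iff)
        moreover have "x = int j \<longleftrightarrow> 0 \<le> x \<and> j = nat x" for x by auto
        ultimately show ?thesis by metis
      qed
      finally show ?thesis .
    qed
    have "(\<Sum>j<N. indicator {real j / N..<(real j + 1) / N} t :: ennreal)
        = (\<Sum>j<N. if nat \<lfloor>N * t\<rfloor> = j then (if 0 \<le> t then 1 else 0) else 0)"
      by (intro sum.cong refl) (simp only: indicator_def iff, auto)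
    also have "\<dots> = (if nat \<lfloor>N * t\<rfloor> < N then (if 0 \<le> t then 1 else 0) else 0)" by simp
    also have "\<dots> = indicator {0..<1} t"
    proof (cases "0 \<le> t")
      case True
      then have "nat \<lfloor>N * t\<rfloor> < N \<longleftrightarrow> \<lfloor>N * t\<rfloor> < int N" using N by (simp add: nat_less_iff)
      also have "\<dots> \<longleftrightarrow> t < 1" using N by (simp add: floor_less_iff)
      finally show ?thesis using True by (simp add: indicator_def)
    qed (simp add: indicator_def)
    finally show ?thesis by simp
  qed
  have [measurable]: "(\<lambda>t::real. frac (N * t)) \<in> borel_measurable borel" unfolding frac_def by measurable
  have "(\<integral>\<^sup>+t. g (frac (N * t)) * indicator {0..<1} t \<partial>lborel)
      = (\<integral>\<^sup>+t. (\<Sum>j<N. g (frac (N * t)) * indicator {real j / N..<(real j + 1) / N} t) \<partial>lborel)"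
    unfolding ind by (simp add: sum_distrib_left)
  also have "\<dots> = (\<Sum>j<N. (\<integral>\<^sup>+t. g (frac (N * t)) * indicator {real j / N..<(real j + 1) / N} t \<partial>lborel))"
    by (rule nn_integral_sum) measurable
  also have "\<dots> = of_nat N * (ennreal (1 / N) * (\<integral>\<^sup>+t. g t * indicator {0..<1} t \<partial>lborel))"
    unfolding nn_integral_grid_interval[OF g N] by simp
  also have "\<dots> = (\<integral>\<^sup>+t. g t * indicator {0..<1} t \<partial>lborel)"
  proof -
    have "of_nat N * ennreal (1 / N) = ennreal (real N * (1 / N))"
      by (subst ennreal_mult) (auto simp: ennreal_of_nat_eq_real_of_nat)
    then show ?thesis using N by (simp flip: mult.assoc)
  qed
  finally show ?thesis .
qed

text \<open>Each arc of generation \<open>m\<close> consists of \<open>2 ^ (m' - m)\<close> arcs of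
  generation \<open>m'\<close>, so the relative position within the fine arcs is uniformly
  distributed inside every coarse arc. This independence lets the entropy integral factor into a
  count of arcs and an integral over one arc.\<close>

lemma nn_integral_dyadic_frac:
  fixes g :: "real \<Rightarrow> ennreal"
  assumes g[measurable]: "g \<in> borel_measurable borel" and "m \<le> m'" and H: "H \<subseteq> {..<2 ^ m}"
  shows "(\<integral>\<^sup>+\<zeta>. indicator {\<zeta>. dyadic_index m \<zeta> \<in> H} \<zeta> * g (frac (2 ^ m' * turn \<zeta>)) \<partial>circle_lebesgue)
    = ennreal (real (card H) / 2 ^ m) * (\<integral>\<^sup>+t. g t * indicator {0..<1} t \<partial>lborel)"
proof -
  define N M :: nat where "N = 2 ^ m" and "M = 2 ^ (m' - m)"
  have NM: "0 < N" "0 < M" "2 ^ m' = real M * real N"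
    using \<open>m \<le> m'\<close> by (auto simp: N_def M_def simp flip: power_add)
  have fin: "finite H" using H finite_subset by blast
  have [measurable]: "(\<lambda>t::real. frac (c * t)) \<in> borel_measurable borel" for c unfolding frac_def by measurable
  define g' where "g' t = g (frac (M * t))" for t :: real
  have g'[measurable]: "g' \<in> borel_measurable borel" unfolding g'_def by measurable
  have gg': "g (frac (2 ^ m' * t)) = g' (frac (N * t))" for t :: real
  proof -
    \<comment> \<open>\<open>M * frac (N * t)\<close> differs from \<open>2 ^ m' * t\<close> by an
      integer, so the position in the fine grid depends on \<open>t\<close> only through
      \<open>frac (N * t)\<close>.\<close>
    have "real M * frac (N * t) = 2 ^ m' * t + of_int (- (int M * \<lfloor>N * t\<rfloor>))"
      by (simp add: NM frac_def algebra_simps)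
    then have "frac (real M * frac (N * t)) = frac (2 ^ m' * t)"
      unfolding frac_def by (simp only: floor_add_int[symmetric])
    then show ?thesis by (simp add: g'_def)
  qed
  define F where "F t = indicator {t::real. nat \<lfloor>2 ^ m * t\<rfloor> \<in> H} t * g (frac (2 ^ m' * t))" for t
  have F[measurable]: "F \<in> borel_measurable borel" unfolding F_def by measurable
  have "(\<integral>\<^sup>+\<zeta>. indicator {\<zeta>. dyadic_index m \<zeta> \<in> H} \<zeta> * g (frac (2 ^ m' * turn \<zeta>)) \<partial>circle_lebesgue)
     = (\<integral>\<^sup>+\<zeta>. F (turn \<zeta>) \<partial>circle_lebesgue)"
    by (simp add: F_def dyadic_index_def indicator_def)
  also have "\<dots> = (\<integral>\<^sup>+t. F t * indicator {0..<1} t \<partial>lborel)" by (rule nn_integral_circle_lebesgue[OF F])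
  also have "\<dots> = (\<integral>\<^sup>+t. (\<Sum>j\<in>H. g' (frac (N * t)) * indicator {real j / N..<(real j + 1) / N} t) \<partial>lborel)"
  proof (rule nn_integral_cong)
    fix t :: real
    have iff: "t \<in> {real j / N..<(real j + 1) / N} \<longleftrightarrow> 0 \<le> t \<and> nat \<lfloor>2 ^ m * t\<rfloor> = j" for j :: nat
    proof -
      have "t \<in> {real j / N..<(real j + 1) / N} \<longleftrightarrow> real j \<le> 2 ^ m * t \<and> 2 ^ m * t < real j + 1"
        by (auto simp: field_simps N_def)
      also have "\<dots> \<longleftrightarrow> \<lfloor>2 ^ m * t\<rfloor> = int j" by (auto simp: floor_eq_iff)
      also have "\<dots> \<longleftrightarrow> 0 \<le> t \<and> nat \<lfloor>2 ^ m * t\<rfloor> = j"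
      proof -
        have "0 \<le> \<lfloor>2 ^ m * t\<rfloor> \<longleftrightarrow> 0 \<le> t"
          using mult_le_cancel_left_pos[of "2 ^ m" 0 t] by simp
        moreover have "x = int j \<longleftrightarrow> 0 \<le> x \<and> nat x = j" for x by auto
        ultimately show ?thesis by metis
      qed
      finally show ?thesis .
    qed
    have "(\<Sum>j\<in>H. g' (frac (N * t)) * indicator {real j / N..<(real j + 1) / N} t)
       = (\<Sum>j\<in>H. if nat \<lfloor>2 ^ m * t\<rfloor> = j then (if 0 \<le> t then g' (frac (N * t)) else 0) else 0)"
      by (intro sum.cong refl) (simp only: indicator_def iff, auto)
    also have "\<dots> = (if nat \<lfloor>2 ^ m * t\<rfloor> \<in> H then (if 0 \<le> t then g' (frac (N * t)) else 0) else 0)"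
      using fin by simp
    also have "\<dots> = F t * indicator {0..<1} t"
    proof (cases "nat \<lfloor>2 ^ m * t\<rfloor> \<in> H \<and> 0 \<le> t")
      case True
      then have "nat \<lfloor>2 ^ m * t\<rfloor> < 2 ^ m" using H by blast
      then have "\<lfloor>2 ^ m * t\<rfloor> < 2 ^ m" using True by (simp add: nat_less_iff)
      then have "t < 1" by (simp add: floor_less_iff)
      then show ?thesis using True by (simp add: F_def indicator_def gg')
    qed (auto simp: F_def indicator_def)
    finally show "F t * indicator {0..<1} t
        = (\<Sum>j\<in>H. g' (frac (N * t)) * indicator {real j / N..<(real j + 1) / N} t)" by simp
  qed
  also have "\<dots> = (\<Sum>j\<in>H. (\<integral>\<^sup>+t. g' (frac (N * t)) * indicator {real j / N..<(real j + 1) / N} t \<partial>lborel))"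
    by (rule nn_integral_sum) measurable
  also have "\<dots> = of_nat (card H) * (ennreal (1 / N) * (\<integral>\<^sup>+t. g' t * indicator {0..<1} t \<partial>lborel))"
    unfolding nn_integral_grid_interval[OF g' NM(1)] by simp
  also have "(\<integral>\<^sup>+t. g' t * indicator {0..<1} t \<partial>lborel) = (\<integral>\<^sup>+t. g t * indicator {0..<1} t \<partial>lborel)"
    unfolding g'_def by (rule nn_integral_frac_multiple[OF g NM(2)])
  also have "of_nat (card H) * (ennreal (1 / N) * (\<integral>\<^sup>+t. g t * indicator {0..<1} t \<partial>lborel))
      = ennreal (real (card H) / 2 ^ m) * (\<integral>\<^sup>+t. g t * indicator {0..<1} t \<partial>lborel)"
  proof -
    have "of_nat (card H) * ennreal (1 / N) = ennreal (real (card H) * (1 / N))"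
      by (subst ennreal_mult) (auto simp: ennreal_of_nat_eq_real_of_nat)
    then show ?thesis by (simp add: N_def flip: mult.assoc)
  qed
  finally show ?thesis .
qed

text \<open>The arcs are closed because a set of finite entropy has to be closed; unlike the arcs
  behind \<open>dyadic_index\<close>, neighbours share an endpoint.\<close>

definition closed_dyadic_arc :: "nat \<Rightarrow> nat \<Rightarrow> complex set" where
  "closed_dyadic_arc m j = (\<lambda>t. cis (2 * pi * t)) ` {real j / 2 ^ m..(real j + 1) / 2 ^ m}"

lemma compact_closed_dyadic_arc: "compact (closed_dyadic_arc m j)"
  unfolding closed_dyadic_arc_def by (intro compact_continuous_image continuous_intros) auto

lemma closed_dyadic_arc_subset: "closed_dyadic_arc m j \<subseteq> sphere 0 1"
  unfolding closed_dyadic_arc_def by auto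

lemma dyadic_index_closed_arc: "cmod \<zeta> = 1 \<Longrightarrow> \<zeta> \<in> closed_dyadic_arc m (dyadic_index m \<zeta>)"
  unfolding closed_dyadic_arc_def
  using dyadic_index_bounds[where m = m and \<zeta> = \<zeta>] cis_turn[of \<zeta>]
  by (intro image_eqI[of _ _ "turn \<zeta>"]) auto

lemma dyadic_index_eqI:
  assumes "\<zeta> \<in> closed_dyadic_arc m j" "j < 2 ^ m" and nd: "frac (2 ^ m * turn \<zeta>) \<noteq> 0"
  shows "dyadic_index m \<zeta> = j"
proof -
  obtain s where s: "real j / 2 ^ m \<le> s" "s \<le> (real j + 1) / 2 ^ m" "\<zeta> = cis (2 * pi * s)"
    using assms(1) unfolding closed_dyadic_arc_def by auto
  have j1: "real j + 1 \<le> 2 ^ m"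
  proof -
    have "j + 1 \<le> 2 ^ m" using assms(2) by simp
    then have "real (j + 1) \<le> real (2 ^ m)" by (simp only: of_nat_le_iff)
    then show ?thesis by simp
  qed
  have s0: "0 \<le> s" using s(1) by (rule order_trans[rotated]) simp
  have "(real j + 1) / 2 ^ m \<le> 1" using j1 by simp
  then have s1: "s \<le> 1" using s(2) by linarith
  \<comment> \<open>The parameter \<open>1\<close> wraps around to \<open>turn\<close> value
    \<open>0\<close>, a dyadic point.\<close>
  have "s \<noteq> 1"
  proof
    assume "s = 1"
    then have "\<zeta> = cis (2 * pi * 0)" using s(3) by simp
    then have "turn \<zeta> = 0" using turn_cis[of 0] by simp
    then show False using nd by simp
  qed
  then have t: "turn \<zeta> = s" using s0 s1 s(3) turn_cis[of s] by simp
  have "2 ^ m * s \<noteq> real j + 1"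
  proof
    assume "2 ^ m * s = real j + 1"
    then have "2 ^ m * s = of_int (int j + 1)" by simp
    then show False using nd t by (metis frac_of_int)
  qed
  moreover have "real j \<le> 2 ^ m * s" "2 ^ m * s \<le> real j + 1" using s by (simp_all add: field_simps)
  ultimately have "\<lfloor>2 ^ m * s\<rfloor> = int j" by (simp add: floor_eq_iff)
  then show ?thesis by (simp add: dyadic_index_def t)
qed

section \<open>Distances in normalized arc length\<close>

lemma arc_dist_bounds: "0 \<le> arc_dist \<zeta> \<xi>" "arc_dist \<zeta> \<xi> \<le> 1 / 2"
proof -
  have "\<bar>Arg (\<zeta> / \<xi>)\<bar> \<le> pi" using Arg_bounded[of "\<zeta> / \<xi>"] by linarith
  then show "0 \<le> arc_dist \<zeta> \<xi>" "arc_dist \<zeta> \<xi> \<le> 1 / 2"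
    unfolding arc_dist_def by (auto simp: field_simps)
qed

lemma arc_setdist_bounds: "0 \<le> arc_setdist \<zeta> E" "arc_setdist \<zeta> E \<le> 1 / 2"
proof -
  show "0 \<le> arc_setdist \<zeta> E"
    unfolding arc_setdist_def using arc_dist_bounds by (auto intro!: cINF_greatest)
  show "arc_setdist \<zeta> E \<le> 1 / 2"
  proof (cases "E = {}")
    case False
    then obtain \<xi> where \<xi>: "\<xi> \<in> E" by blast
    have "bdd_below (arc_dist \<zeta> ` E)" using arc_dist_bounds(1) by (intro bdd_belowI[of _ 0]) auto
    then have "arc_setdist \<zeta> E \<le> arc_dist \<zeta> \<xi>"
      unfolding arc_setdist_def using \<xi> by (auto intro: cINF_lower)
    then show ?thesis using arc_dist_bounds(2)[of \<zeta> \<xi>] by linarith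
  qed (simp add: arc_setdist_def)
qed

text \<open>The two inequalities on \<open>|a - b|\<close> stand for the two ways around the circle:
  reduced modulo \<open>1\<close> to \<open>(-1/2, 1/2]\<close>, the difference has absolute value
  \<open>|a - b|\<close> or \<open>1 - |a - b|\<close>.\<close>

lemma arc_dist_cis_ge:
  assumes "d \<le> \<bar>a - b\<bar>" "\<bar>a - b\<bar> \<le> 1 - d" "0 \<le> d"
  shows "d \<le> arc_dist (cis (2 * pi * a)) (cis (2 * pi * b))"
proof -
  define x where "x = a - b"
  have quot: "cis (2 * pi * a) / cis (2 * pi * b) = cis (2 * pi * x)"
    by (simp add: cis_divide x_def right_diff_distrib)
  have shift: "cis (2 * pi * (x - 1)) = cis (2 * pi * x)" "cis (2 * pi * (x + 1)) = cis (2 * pi * x)"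
    by (simp_all add: right_diff_distrib distrib_left cis_divide[symmetric] cis_mult[symmetric])
  have Arg: "\<bar>Arg (cis (2 * pi * y))\<bar> = 2 * pi * \<bar>y\<bar>" if "- (1 / 2) < y" "y \<le> 1 / 2" for y
  proof -
    have "2 * pi * (- (1 / 2)) < 2 * pi * y" using that by (intro mult_strict_left_mono) auto
    moreover have "2 * pi * y \<le> 2 * pi * (1 / 2)" using that by (intro mult_left_mono) auto
    ultimately show ?thesis by (subst Arg_cis) (auto simp: abs_mult)
  qed
  have x: "\<bar>x\<bar> \<le> 1" using assms by (simp add: x_def)
  have "\<exists>y. cis (2 * pi * x) = cis (2 * pi * y) \<and> - (1 / 2) < y \<and> y \<le> 1 / 2 \<and> d \<le> \<bar>y\<bar>"
  proof -
    consider "- (1 / 2) < x" "x \<le> 1 / 2" | "1 / 2 < x" | "x \<le> - (1 / 2)" by linarith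
    then show ?thesis
    proof cases
      case 1
      then show ?thesis using assms by (intro exI[of _ x]) (auto simp: x_def)
    next
      case 2
      then show ?thesis using assms x shift(1) by (intro exI[of _ "x - 1"]) (auto simp: x_def)
    next
      case 3
      then show ?thesis using assms x shift(2) by (intro exI[of _ "x + 1"]) (auto simp: x_def)
    qed
  qed
  then obtain y where "cis (2 * pi * x) = cis (2 * pi * y)" "- (1 / 2) < y" "y \<le> 1 / 2" "d \<le> \<bar>y\<bar>"
    by blast
  then show ?thesis using Arg[of y] by (simp add: arc_dist_def quot)
qed

text \<open>The arc of \<open>\<zeta>\<close> is not among those covering \<open>E\<close>, so every
  way from \<open>\<zeta>\<close> to \<open>E\<close> passes an endpoint of this arc, and the nearer
  one is at distance \<open>min x (1 - x) / 2 ^ m\<close>.\<close>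

lemma arc_setdist_ge:
  assumes \<zeta>: "cmod \<zeta> = 1" and H: "H \<subseteq> {..<2 ^ m}" and E: "E \<subseteq> (\<Union>j\<in>H. closed_dyadic_arc m j)"
    and notin: "dyadic_index m \<zeta> \<notin> H" and x: "x = frac (2 ^ m * turn \<zeta>)"
  shows "min x (1 - x) / 2 ^ m \<le> arc_setdist \<zeta> E"
proof -
  define d where "d = min x (1 - x) / 2 ^ m"
  define n :: real where "n = 2 ^ m"
  have n: "1 \<le> n" by (simp add: n_def)
  define i where "i = dyadic_index m \<zeta>"
  have xb: "0 \<le> x" "x < 1" unfolding x by (auto simp: frac_lt_1)
  have i: "n * turn \<zeta> = real i + x"
  proof -
    have "0 \<le> \<lfloor>2 ^ m * turn \<zeta>\<rfloor>" using turn_ge_0[of \<zeta>] by simp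
    then show ?thesis by (simp add: i_def dyadic_index_def x frac_def n_def)
  qed
  have d0: "0 \<le> d" using xb by (simp add: d_def)
  have nd: "n * d = min x (1 - x)" by (simp add: d_def n_def)
  \<comment> \<open>This serves the case that \<open>E\<close> is empty, where
    \<open>arc_setdist\<close> is \<open>1 / 2\<close> by convention.\<close>
  have d_half: "d \<le> 1 / 2"
  proof -
    have "1 * d \<le> n * d" using n d0 by (intro mult_right_mono)
    then show ?thesis unfolding nd by linarith
  qed
  have "d \<le> arc_dist \<zeta> \<xi>" if \<xi>: "\<xi> \<in> E" for \<xi>
  proof -
    obtain j where j: "j \<in> H" "\<xi> \<in> closed_dyadic_arc m j" using subsetD[OF E \<xi>] by blast
    then obtain s where s: "real j / 2 ^ m \<le> s" "s \<le> (real j + 1) / 2 ^ m" "\<xi> = cis (2 * pi * s)"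
      unfolding closed_dyadic_arc_def by auto
    have s': "real j \<le> n * s" "n * s \<le> real j + 1" using s n by (simp_all add: field_simps n_def)
    have "j \<noteq> i" using j notin i_def by blast
    then have "real j + 1 \<le> real i \<or> real i + 1 \<le> real j" by linarith
    then have sep: "n * s \<le> real i \<or> real i + 1 \<le> n * s" using s' by linarith
    have small: "real k + 1 \<le> n" if "k < 2 ^ m" for k
    proof -
      have "k + 1 \<le> 2 ^ m" using that by simp
      then have "real (k + 1) \<le> real (2 ^ m)" by (simp only: of_nat_le_iff)
      then show ?thesis by (simp add: n_def)
    qed
    have ji: "real j + 1 \<le> n" "real i + 1 \<le> n"
      using small j H dyadic_index_less[of m \<zeta>] by (auto simp: i_def)
    have "n * d \<le> \<bar>n * turn \<zeta> - n * s\<bar>" unfolding nd i using sep xb by linarith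
    also have "\<dots> = n * \<bar>turn \<zeta> - s\<bar>" using n by (simp add: abs_mult flip: right_diff_distrib)
    finally have 1: "d \<le> \<bar>turn \<zeta> - s\<bar>" using n by simp
    \<comment> \<open>The same bound for the opposite way around the circle, which also has to leave
      the arc of \<open>\<zeta>\<close>.\<close>
    have "n * \<bar>turn \<zeta> - s\<bar> = \<bar>n * turn \<zeta> - n * s\<bar>" using n by (simp add: abs_mult flip: right_diff_distrib)
    also have "\<dots> \<le> n - n * d" unfolding nd i using sep s' xb ji by linarith
    also have "\<dots> = n * (1 - d)" by (simp add: algebra_simps)
    finally have 2: "\<bar>turn \<zeta> - s\<bar> \<le> 1 - d" using n by simp
    show ?thesis using arc_dist_cis_ge[OF 1 2 d0] s(3) cis_turn[OF \<zeta>] by simp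
  qed
  then show ?thesis unfolding d_def[symmetric] arc_setdist_def using d_half by (auto intro!: cINF_greatest)
qed

text \<open>Subadditivity gives \<open>w s powr l \<le> (2 / x) * w (x * s) powr l\<close>, a loss
  of \<open>ln (2 / x) / l\<close> in the logarithm. It is replaced by a multiple of
  \<open>x powr (- 1 / 2)\<close>, whose integral over the unit interval is elementary.\<close>

lemma majorant_log_ratio_le:
  assumes w: "majorant w" and l: "0 < l" "modulus_of_continuity (\<lambda>t. w t powr l)"
    and s: "0 < s" "s \<le> 1" and x: "0 < x" "x \<le> 1"
  shows "- ln (w (x * s)) \<le> - ln (w s) + 4 / l * x powr (- 1 / 2)"
proof -
  have xs: "0 < x * s" "x * s \<le> 1" using s x by (auto intro: mult_le_one)
  have pos: "0 < w s" "0 < w (x * s)" using majorant_pos[OF w] s xs by auto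
  have "w s powr l \<le> (s / (x * s) + 1) * w (x * s) powr l"
    using modulus_of_continuity_le[OF l(2), of "x * s" s] xs s by auto
  also have "\<dots> \<le> (2 / x) * w (x * s) powr l"
    using s x by (intro mult_right_mono) (auto simp: field_simps)
  finally have "ln (w s powr l) \<le> ln ((2 / x) * w (x * s) powr l)"
    using pos x by (subst ln_le_cancel_iff) (auto intro!: mult_pos_pos divide_pos_pos)
  then have "l * ln (w s) \<le> ln (2 / x) + l * ln (w (x * s))"
    using pos x ln_mult[of "2 / x" "w (x * s) powr l"] by (simp add: ln_powr)
  moreover have "ln (2 / x) \<le> 4 * x powr (- 1 / 2)"
  proof -
    \<comment> \<open>With \<open>y \<ge> 1\<close>, both
      \<open>ln (1 / x) = 2 * ln y \<le> 2 * y\<close> and \<open>ln 2 \<le> 1 \<le> y\<close> hold,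
      so the constant \<open>4\<close> is generous.\<close>
    define y where "y = x powr (- 1 / 2)"
    have y: "1 \<le> y"
      using x powr_mono_both'[of "-1/2" 0 x x] powr_mono'[of "-1/2" 0 x] by (simp add: y_def)
    have "ln (1 / x) = 2 * ln y" using x by (simp add: y_def ln_powr ln_div)
    also have "\<dots> \<le> 2 * y" using y ln_le_minus_one[of y] by simp
    finally have "ln (1 / x) \<le> 2 * y" .
    moreover have "ln (2 / x) = ln 2 + ln (1 / x)" using x by (simp add: ln_div)
    moreover have "ln 2 \<le> (1::real)" using ln_le_minus_one[of "2::real"] by simp
    ultimately show ?thesis using y by (simp add: y_def)
  qed
  ultimately have "l * (- ln (w (x * s))) \<le> l * (- ln (w s) + 4 / l * x powr (- 1 / 2))"
    using l by (simp add: algebra_simps)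
  from mult_left_le_imp_le[OF this l(1)] show ?thesis .
qed

lemma nn_integral_powr_endpoints:
  "(\<integral>\<^sup>+t. ennreal (t powr (- 1 / 2) + (1 - t) powr (- 1 / 2)) * indicator {0..<1} t \<partial>lborel) \<le> 4"
proof -
  let ?p = "\<lambda>t::real. t powr (- 1 / 2)"
  have I: "(?p has_integral 2) {0..1}"
    using has_integral_powr_from_0[of "-1/2" 1] by simp
  have I': "((\<lambda>t. ?p (1 - t)) has_integral 2) {0..1}"
  proof -
    have "((\<lambda>t. ?p ((-1) *\<^sub>R t + 1)) has_integral (1 / \<bar>-1\<bar> ^ DIM(real)) *\<^sub>R 2)
        ((\<lambda>x. (1 / (-1)) *\<^sub>R x + - ((1 / (-1)) *\<^sub>R 1)) ` cbox 0 1)"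
      using has_integral_affinity[OF I[unfolded cbox_interval[symmetric]], of "-1" 1] by simp
    moreover have "(\<lambda>x. (1 / (-1)) *\<^sub>R x + - ((1 / (-1)) *\<^sub>R (1::real))) ` cbox 0 1 = {0..1}"
      by (auto simp: image_iff intro!: bexI[of _ "1 - _"])
    ultimately show ?thesis by (simp add: algebra_simps)
  qed
  from has_integral_add[OF I I']
  have "((\<lambda>t. ?p t + ?p (1 - t)) has_integral 4) {0..1}" by simp
  then have "((\<lambda>t. if t \<in> {0..1} then ?p t + ?p (1 - t) else 0) has_integral 4) UNIV"
    by (simp only: has_integral_restrict_UNIV)
  then have U: "((\<lambda>t. indicator {0..1} t * (?p t + ?p (1 - t))) has_integral 4) UNIV"
    by (rule has_integral_eq[rotated]) (simp add: indicator_def)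
  have "(\<integral>\<^sup>+t. ennreal (indicator {0..1} t * (?p t + ?p (1 - t))) \<partial>lborel) = ennreal 4"
  proof (rule nn_integral_has_integral_lborel[OF _ _ U])
    show "(\<lambda>t. indicator {0..1} t * (?p t + ?p (1 - t))) \<in> borel_measurable borel" by measurable
  qed simp
  moreover have "(\<integral>\<^sup>+t. ennreal (?p t + ?p (1 - t)) * indicator {0..<1} t \<partial>lborel)
      \<le> (\<integral>\<^sup>+t. ennreal (indicator {0..1} t * (?p t + ?p (1 - t))) \<partial>lborel)"
    by (intro nn_integral_mono) (auto simp: indicator_def)
  ultimately show ?thesis by simp
qed

text \<open>Almost every point has a first generation \<open>k\<close> whose arc is not in
  \<open>H k\<close>. Its distance to \<open>E\<close> is at least that to the ends of this arc, so
  \<open>- ln w\<close> is at most \<open>B k\<close> plus an integrable function of the relative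
  position. By minimality the arc one generation earlier does belong to \<open>H (k - 1)\<close>, so
  this cost arises only on a set of measure \<open>card (H (k - 1)) / 2 ^ m (k - 1)\<close>; hence
  the shifted index of \<open>B\<close> in the summability hypothesis.\<close>

lemma finite_entropy_dyadic:
  fixes m :: "nat \<Rightarrow> nat" and H :: "nat \<Rightarrow> nat set" and B :: "nat \<Rightarrow> real"
  assumes w: "majorant w" and mono: "\<And>k. m k \<le> m (Suc k)"
    and H: "\<And>k. H k \<subseteq> {..<2 ^ m k}"
    and B: "\<And>k. - ln (w (1 / 2 ^ m k)) \<le> B k" "\<And>k. 0 \<le> B k"
    and sum: "summable (\<lambda>k. real (card (H k)) / 2 ^ m k * (B (Suc k) + 1))"
  shows "finite_entropy w (\<Inter>k. \<Union>j\<in>H k. closed_dyadic_arc (m k) j)"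
proof -
  define E where "E = (\<Inter>k. \<Union>j\<in>H k. closed_dyadic_arc (m k) j)"
  define c where "c k = real (card (H k)) / 2 ^ m k" for k
  have c: "0 \<le> c k" for k by (simp add: c_def)
  have finH: "finite (H k)" for k using H[of k] finite_subset by blast
  have closed: "closed E" unfolding E_def
    using finH compact_closed_dyadic_arc by (intro closed_INT ballI closed_UN) (auto intro: compact_imp_closed)
  have sphere: "E \<subseteq> sphere 0 1"
    unfolding E_def using closed_dyadic_arc_subset by blast
  have cl_sets: "sets circle_lebesgue = sets circle_borel" "space circle_lebesgue = sphere 0 1"
    by (auto simp: circle_lebesgue_def circle_borel_def space_restrict_space)
  have E_sets: "E \<in> sets circle_lebesgue"
  proof -
    have "E \<in> sets borel" using closed by (rule borel_closed)
    then show ?thesis unfolding cl_sets circle_borel_def sets_restrict_space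
      using sphere by (intro image_eqI[of _ _ E]) auto
  qed
  have in_E: "dyadic_index (m k) \<zeta> \<in> H k"
    if nd: "\<forall>m::nat. frac (2 ^ m * turn \<zeta>) \<noteq> 0" and \<zeta>: "\<zeta> \<in> E" for \<zeta> k
  proof -
    obtain j where j: "j \<in> H k" "\<zeta> \<in> closed_dyadic_arc (m k) j" using \<zeta> unfolding E_def by blast
    have "dyadic_index (m k) \<zeta> = j"
      by (rule dyadic_index_eqI[OF j(2)]) (use j(1) H[of k] nd in auto)
    then show ?thesis using j(1) by simp
  qed
  have c_lim: "c \<longlonglongrightarrow> 0"
  proof (rule summable_LIMSEQ_zero[OF summable_comparison_test'[OF sum]])
    show "norm (c k) \<le> real (card (H k)) / 2 ^ m k * (B (Suc k) + 1)" if "k \<ge> 0" for k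
      using mult_left_mono[of 1 "B (Suc k) + 1" "c k"] c[of k] B(2)[of "Suc k"] by (simp add: c_def)
  qed
  have null: "emeasure circle_lebesgue E = 0"
  proof -
    have "emeasure circle_lebesgue E \<le> ennreal (c k)" for k
    proof -
      have "emeasure circle_lebesgue E = (\<integral>\<^sup>+\<zeta>. indicator E \<zeta> \<partial>circle_lebesgue)" using E_sets by simp
      also have "\<dots> \<le> (\<integral>\<^sup>+\<zeta>. indicator {\<zeta>. dyadic_index (m k) \<zeta> \<in> H k} \<zeta> * 1 \<partial>circle_lebesgue)"
        by (rule nn_integral_mono_AE)
          (use AE_circle_lebesgue_nondyadic in eventually_elim, auto simp: indicator_def in_E)
      also have "\<dots> = ennreal (c k)"
        using nn_integral_dyadic_frac[of "\<lambda>_. 1" "m k" "m k", OF _ _ H] by (simp add: c_def)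
      finally show ?thesis .
    qed
    moreover have "(\<lambda>k. ennreal (c k)) \<longlonglongrightarrow> ennreal 0" by (rule tendsto_ennrealI[OF c_lim])
    ultimately have "emeasure circle_lebesgue E \<le> ennreal 0" by (intro LIMSEQ_le_const) auto
    then show ?thesis by simp
  qed
  obtain l where l: "l > 0" "modulus_of_continuity (\<lambda>t. w t powr l)"
    using w unfolding majorant_def by blast
  define p where "p t = t powr (- 1 / 2) + (1 - t) powr (- 1 / 2)" for t :: real
  have p[measurable]: "p \<in> borel_measurable borel" unfolding p_def by measurable
  have p0: "0 \<le> p t" for t by (simp add: p_def)
  \<comment> \<open>Bound for a point that leaves the arcs of \<open>H\<close> at generation
    \<open>k\<close>, as a function of its relative position \<open>t\<close> in its arc;
    \<open>p\<close> has a singularity at each of the two endpoints.\<close>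
  define g where "g k t = ennreal (B k + 4 / l * p t)" for k t
  have g[measurable]: "g k \<in> borel_measurable borel" for k unfolding g_def by measurable
  have int_g: "(\<integral>\<^sup>+t. g k t * indicator {0..<1} t \<partial>lborel) \<le> ennreal (B k + 16 / l)" for k
  proof -
    have g_eq: "g k t = ennreal (B k) + ennreal (4 / l) * ennreal (p t)" for t
    proof -
      have l4: "0 \<le> 4 / l" using l(1) by simp
      show ?thesis unfolding g_def
        by (simp only: ennreal_plus[OF B(2) mult_nonneg_nonneg[OF l4 p0]] ennreal_mult[OF l4 p0])
    qed
    have "(\<integral>\<^sup>+t. g k t * indicator {0..<1} t \<partial>lborel)
       = (\<integral>\<^sup>+t. ennreal (B k) * indicator {0..<1} t + ennreal (4 / l) * (ennreal (p t) * indicator {0..<1} t) \<partial>lborel)"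
      by (intro nn_integral_cong) (simp add: g_eq indicator_def)
    also have "\<dots> = (\<integral>\<^sup>+t. ennreal (B k) * indicator {0..<1::real} t \<partial>lborel)
        + (\<integral>\<^sup>+t. ennreal (4 / l) * (ennreal (p t) * indicator {0..<1} t) \<partial>lborel)"
      by (rule nn_integral_add) measurable
    also have "(\<integral>\<^sup>+t. ennreal (B k) * indicator {0..<1::real} t \<partial>lborel) = ennreal (B k)"
      by (subst nn_integral_cmult_indicator) auto
    also have "(\<integral>\<^sup>+t. ennreal (4 / l) * (ennreal (p t) * indicator {0..<1} t) \<partial>lborel)
        = ennreal (4 / l) * (\<integral>\<^sup>+t. ennreal (p t) * indicator {0..<1} t \<partial>lborel)"
      by (rule nn_integral_cmult) measurable
    also have "ennreal (B k) + ennreal (4 / l) * (\<integral>\<^sup>+t. ennreal (p t) * indicator {0..<1} t \<partial>lborel)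
        \<le> ennreal (B k) + ennreal (4 / l) * 4"
      using nn_integral_powr_endpoints by (intro add_left_mono mult_left_mono) (auto simp: p_def)
    also have "\<dots> = ennreal (B k + 16 / l)"
    proof -
      have "ennreal (4 / l) * 4 = ennreal (4 / l) * ennreal 4" by simp
      also have "\<dots> = ennreal (16 / l)" using l by (subst ennreal_mult[symmetric]) auto
      finally show ?thesis using B(2) l by (simp add: ennreal_plus)
    qed
    finally show ?thesis .
  qed
  define I where "I k \<zeta> = (indicator {\<zeta>. dyadic_index (m k) \<zeta> \<in> H k} \<zeta> :: ennreal)" for k \<zeta>
  \<comment> \<open>The term with \<open>g 0\<close> serves points leaving at generation
    \<open>0\<close>, which no earlier generation restricts; the \<open>k\<close>-th summand serves
    those leaving at generation \<open>Suc k\<close>.\<close>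
  define G where "G \<zeta> = g 0 (frac (2 ^ m 0 * turn \<zeta>)) + (\<Sum>k. I k \<zeta> * g (Suc k) (frac (2 ^ m (Suc k) * turn \<zeta>)))" for \<zeta>
  have mf: "(\<lambda>\<zeta>. frac (2 ^ n * turn \<zeta>)) \<in> borel_measurable circle_lebesgue" for n :: nat
  proof -
    have "(\<lambda>\<zeta>. frac (2 ^ n * turn \<zeta>)) \<in> borel_measurable borel" unfolding frac_def by measurable
    from measurable_restrict_space1[OF this, of "sphere 0 1"] show ?thesis
      using measurable_cong_sets[OF cl_sets(1) refl] unfolding circle_borel_def by blast
  qed
  have mg[measurable]: "(\<lambda>\<zeta>. g k (frac (2 ^ n * turn \<zeta>))) \<in> borel_measurable circle_lebesgue" for n k :: nat
    by (rule measurable_compose[OF mf g])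
  have mI[measurable]: "I k \<in> borel_measurable circle_lebesgue" for k
  proof -
    have "I k \<in> borel_measurable borel" unfolding I_def by measurable
    from measurable_restrict_space1[OF this, of "sphere 0 1"] show ?thesis
      using measurable_cong_sets[OF cl_sets(1) refl] unfolding circle_borel_def by blast
  qed
  have bound: "AE \<zeta> in circle_lebesgue. ennreal (- ln (w (arc_setdist \<zeta> E))) \<le> G \<zeta>"
  proof -
    have "AE \<zeta> in circle_lebesgue. \<zeta> \<notin> E" using null E_sets by (intro AE_not_in) auto
    moreover have "AE \<zeta> in circle_lebesgue. \<zeta> \<in> sphere 0 1" using AE_space[of circle_lebesgue] cl_sets by simp
    ultimately show ?thesis using AE_circle_lebesgue_nondyadic
    proof eventually_elim
      case (elim \<zeta>)
      have \<zeta>: "cmod \<zeta> = 1" using elim by simp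
      have ex: "\<exists>k. dyadic_index (m k) \<zeta> \<notin> H k"
        using elim(1) dyadic_index_closed_arc[OF \<zeta>] unfolding E_def by blast
      define k where "k = (LEAST k. dyadic_index (m k) \<zeta> \<notin> H k)"
      have k: "dyadic_index (m k) \<zeta> \<notin> H k" unfolding k_def by (rule LeastI_ex[OF ex])
      define x where "x = frac (2 ^ m k * turn \<zeta>)"
      define y where "y = min x (1 - x)"
      have "x \<noteq> 0" using elim(3) unfolding x_def by blast
      moreover have "0 \<le> x" "x < 1" unfolding x_def by (rule frac_ge_0, rule frac_lt_1)
      ultimately have x: "0 < x" "x < 1" by auto
      then have y: "0 < y" "y \<le> 1" by (auto simp: y_def)
      have dist: "y / 2 ^ m k \<le> arc_setdist \<zeta> E"
        unfolding y_def by (rule arc_setdist_ge[OF \<zeta> H _ k x_def]) (auto simp: E_def)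
      have "0 < y / 2 ^ m k" using y by simp
      moreover have "y / 2 ^ m k \<le> 1" using dist arc_setdist_bounds(2)[of \<zeta> E] by linarith
      ultimately have "0 < w (y / 2 ^ m k)" by (rule majorant_pos[OF w])
      moreover have "w (y / 2 ^ m k) \<le> w (arc_setdist \<zeta> E)"
        using dist arc_setdist_bounds(2)[of \<zeta> E] y by (intro majorant_mono[OF w]) auto
      ultimately have "ln (w (y / 2 ^ m k)) \<le> ln (w (arc_setdist \<zeta> E))" by simp
      then have "- ln (w (arc_setdist \<zeta> E)) \<le> - ln (w (y * (1 / 2 ^ m k)))" by simp
      also have "\<dots> \<le> - ln (w (1 / 2 ^ m k)) + 4 / l * y powr (- 1 / 2)"
        by (rule majorant_log_ratio_le[OF w l]) (use y in auto)
      also have "\<dots> \<le> B k + 4 / l * p x"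
      proof -
        have "y powr (- 1 / 2) \<le> p x" by (auto simp: p_def y_def min_def)
        then show ?thesis using B(1)[of k] l by (intro add_mono mult_left_mono) auto
      qed
      finally have le: "ennreal (- ln (w (arc_setdist \<zeta> E))) \<le> g k x"
        unfolding g_def by (rule ennreal_leI)
      show ?case
      proof (cases k)
        case 0
        then show ?thesis using le unfolding G_def x_def by (simp add: add_increasing2)
      next
        case (Suc n)
        have "dyadic_index (m n) \<zeta> \<in> H n" using not_less_Least[of n "\<lambda>k. dyadic_index (m k) \<zeta> \<notin> H k"] Suc k_def by auto
        then have "I n \<zeta> = 1" by (simp add: I_def)
        then have "g k x = I n \<zeta> * g (Suc n) (frac (2 ^ m (Suc n) * turn \<zeta>))" by (simp add: x_def Suc)
        also have "\<dots> = (\<Sum>k\<in>{n}. I k \<zeta> * g (Suc k) (frac (2 ^ m (Suc k) * turn \<zeta>)))" by simp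
        also have "\<dots> \<le> (\<Sum>k. I k \<zeta> * g (Suc k) (frac (2 ^ m (Suc k) * turn \<zeta>)))"
          by (rule sum_le_suminf) auto
        also have "\<dots> \<le> G \<zeta>" unfolding G_def by (simp add: add_increasing)
        finally show ?thesis using le by (rule order_trans[rotated])
      qed
    qed
  qed
  have "(\<integral>\<^sup>+\<zeta>. ennreal (- ln (w (arc_setdist \<zeta> E))) \<partial>circle_lebesgue) \<le> (\<integral>\<^sup>+\<zeta>. G \<zeta> \<partial>circle_lebesgue)"
    by (rule nn_integral_mono_AE[OF bound])
  also have "\<dots> = (\<integral>\<^sup>+\<zeta>. g 0 (frac (2 ^ m 0 * turn \<zeta>)) \<partial>circle_lebesgue)
      + (\<Sum>k. \<integral>\<^sup>+\<zeta>. I k \<zeta> * g (Suc k) (frac (2 ^ m (Suc k) * turn \<zeta>)) \<partial>circle_lebesgue)"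
    unfolding G_def by (subst nn_integral_add) (measurable, simp add: nn_integral_suminf)
  also have "\<dots> \<le> ennreal (B 0 + 16 / l) + (\<Sum>k. ennreal (c k * (B (Suc k) + 16 / l)))"
  \<comment> \<open>For the first term, generation \<open>0\<close> consists of a single arc, whose
    indicator can be inserted for free.\<close>
  proof (intro add_mono suminf_le summableI)
    have "(\<integral>\<^sup>+\<zeta>. g 0 (frac (2 ^ m 0 * turn \<zeta>)) \<partial>circle_lebesgue)
       = (\<integral>\<^sup>+\<zeta>. indicator {\<zeta>. dyadic_index 0 \<zeta> \<in> {0}} \<zeta> * g 0 (frac (2 ^ m 0 * turn \<zeta>)) \<partial>circle_lebesgue)"
      using dyadic_index_less[of 0] by (intro nn_integral_cong) (auto simp: indicator_def)
    also have "\<dots> = (\<integral>\<^sup>+t. g 0 t * indicator {0..<1} t \<partial>lborel)"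
      by (subst nn_integral_dyadic_frac[OF g]) auto
    finally show "(\<integral>\<^sup>+\<zeta>. g 0 (frac (2 ^ m 0 * turn \<zeta>)) \<partial>circle_lebesgue) \<le> ennreal (B 0 + 16 / l)"
      using int_g[of 0] by simp
    fix k
    have "(\<integral>\<^sup>+\<zeta>. I k \<zeta> * g (Suc k) (frac (2 ^ m (Suc k) * turn \<zeta>)) \<partial>circle_lebesgue)
        = ennreal (c k) * (\<integral>\<^sup>+t. g (Suc k) t * indicator {0..<1} t \<partial>lborel)"
      unfolding I_def c_def by (rule nn_integral_dyadic_frac[OF g mono H])
    also have "\<dots> \<le> ennreal (c k) * ennreal (B (Suc k) + 16 / l)"
      by (intro mult_left_mono int_g) auto
    finally show "(\<integral>\<^sup>+\<zeta>. I k \<zeta> * g (Suc k) (frac (2 ^ m (Suc k) * turn \<zeta>)) \<partial>circle_lebesgue)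
        \<le> ennreal (c k * (B (Suc k) + 16 / l))"
      using c B(2) l by (subst ennreal_mult) auto
  qed
  also have "\<dots> < \<infinity>"
  proof -
    have "summable (\<lambda>k. c k * (B (Suc k) + 16 / l))"
    proof (rule summable_comparison_test')
      show "summable (\<lambda>k. (1 + 16 / l) * (c k * (B (Suc k) + 1)))"
        using sum by (intro summable_mult) (simp add: c_def)
      show "norm (c k * (B (Suc k) + 16 / l)) \<le> (1 + 16 / l) * (c k * (B (Suc k) + 1))" if "k \<ge> 0" for k
      proof -
        have "b + q \<le> (1 + q) * (b + 1)" if "0 \<le> b" "0 \<le> q" for b q :: real
          using mult_nonneg_nonneg[OF that] by (simp add: algebra_simps)
        from this[of "B (Suc k)" "16 / l"]
        have "B (Suc k) + 16 / l \<le> (1 + 16 / l) * (B (Suc k) + 1)"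
          using B(2)[of "Suc k"] l by simp
        from mult_left_mono[OF this c[of k]] show ?thesis
          using c[of k] B(2)[of "Suc k"] l by (simp add: mult_ac)
      qed
    qed
    then have "(\<Sum>k. ennreal (c k * (B (Suc k) + 16 / l))) \<noteq> top"
      using c B(2) l by (intro ennreal_suminf_neq_top) auto
    then show ?thesis by (simp add: less_top)
  qed
  finally have neg: "(\<integral>\<^sup>+\<zeta>. ennreal (- ln (w (arc_setdist \<zeta> E))) \<partial>circle_lebesgue) < \<infinity>" .
  have "log_entropy_integral w E > -\<infinity>"
  proof -
    have "a - b > -\<infinity>" if "0 \<le> a" "0 \<le> b" "b < \<infinity>" for a b :: ereal
      using that by (cases a; cases b) auto
    moreover have "enn2ereal (\<integral>\<^sup>+\<zeta>. ennreal (- ln (w (arc_setdist \<zeta> E))) \<partial>circle_lebesgue) < \<infinity>"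
    proof -
      obtain r where "0 \<le> r" "(\<integral>\<^sup>+\<zeta>. ennreal (- ln (w (arc_setdist \<zeta> E))) \<partial>circle_lebesgue) = ennreal r"
        using neg less_top_ennreal by (auto simp: infinity_ennreal_def)
      then show ?thesis by (simp add: enn2ereal_ennreal)
    qed
    ultimately show ?thesis unfolding log_entropy_integral_def using enn2ereal_nonneg by blast
  qed
  then show ?thesis unfolding finite_entropy_def E_def[symmetric] using closed sphere null by simp
qed

section \<open>One stage of the approximation\<close>

lemma cmod_exp_minus_1_le:
  assumes "cmod u \<le> 1"
  shows "cmod (exp u - 1) \<le> 3 * cmod u"
proof -
  have "cmod (exp u - (\<Sum>k\<le>0. u ^ k / fact k)) \<le> exp \<bar>Re u\<bar> * cmod u ^ Suc 0 / fact 0"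
    by (rule Taylor_exp)
  then have "cmod (exp u - 1) \<le> exp \<bar>Re u\<bar> * cmod u" by simp
  also have "exp \<bar>Re u\<bar> \<le> exp 1" using abs_Re_le_cmod[of u] assms by simp
  also have "exp 1 \<le> (3::real)" by (rule exp_le)
  finally show ?thesis by (simp add: mult_right_mono)
qed

lemma cmod_singular_inner_le_1:
  assumes "finite_borel_on_circle \<sigma>" "cmod z < 1"
  shows "cmod (singular_inner \<sigma> z) \<le> 1"
  using Re_herglotz_nonneg[OF assms] by (simp add: singular_inner_eq)

text \<open>The product \<open>f * singular_inner \<sigma> z\<close> is \<open>exp u\<close>, where
  \<open>u\<close> is the change of the Herglotz integral under dilation. Far from the circle
  \<open>u\<close> is small; close to it only \<open>|exp u| \<le> exp (\<kappa> * L)\<close> is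
  available and the weight has to win. The factor \<open>exp (\<kappa> * L)\<close> on the left of
  the second claim anticipates the product of the earlier stages.\<close>

lemma herglotz_stage_estimate:
  assumes w: "majorant w" and l: "0 < l" "modulus_of_continuity (\<lambda>t. w t powr l)"
    and \<sigma>: "finite_borel_on_circle \<sigma>" and L: "0 \<le> L" "w (1 / 2 ^ m) \<le> exp (- L)"
    and \<kappa>: "0 < \<kappa>" "\<kappa> \<le> 1 / 8" "\<kappa> \<le> l / 8" and \<beta>: "\<beta> \<le> 1 / 4" "\<beta> \<le> l / 4"
    and small: "\<And>j. j < 2 ^ m \<Longrightarrow>
      measure \<sigma> {\<zeta> \<in> space \<sigma>. dyadic_index m \<zeta> = j} \<le> \<kappa> * L / (1 + 2 * pi)\<^sup>2 / 2 ^ m"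
    and z: "cmod z < 1"
  defines "f \<equiv> exp (herglotz \<sigma> (of_real (1 - 1 / 2 ^ m) * z))"
  shows "cmod f \<le> exp (\<kappa> * L)"
    and "w (1 - cmod z) * (exp (\<kappa> * L) * cmod (f * singular_inner \<sigma> z - 1))
      \<le> (2 * 2 powr (1 / l) + 12 * w 1) * exp (- \<beta> * L)"
proof -
  define n :: real where "n = 2 ^ m"
  define r where "r = 1 - 1 / n"
  have n: "1 \<le> n" by (simp add: n_def)
  have r: "0 \<le> r" "r < 1" "1 - r = 1 / n" using n by (auto simp: r_def field_simps)
  have "0 < (1 + 2 * pi)\<^sup>2" using pi_gt_zero by (intro zero_less_power) linarith
  moreover have "0 \<le> \<kappa> * L" using \<kappa> L by simp
  ultimately have pot: "(1 - (cmod x)\<^sup>2) * inverse_square_potential \<sigma> x \<le> \<kappa> * L"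
    if "cmod x \<le> 1 - 1 / n" for x
    using inverse_square_potential_le[OF \<sigma> _ small, of x] that by (simp add: n_def)
  have w1: "0 \<le> w 1" using majorant_nonneg[OF w] by simp
  have rz_le: "cmod (of_real r * z) \<le> 1 - 1 / n"
  proof -
    have "cmod (of_real r * z) = r * cmod z" using r by (simp add: norm_mult)
    also have "\<dots> \<le> r" using z r by (intro mult_left_le) auto
    finally show ?thesis by (simp add: r_def)
  qed
  have rz1: "cmod (of_real r * z) < 1" by (rule order_le_less_trans[OF rz_le]) (use n in simp)
  have f_eq: "f = exp (herglotz \<sigma> (of_real r * z))" by (simp add: f_def r_def n_def)
  show f: "cmod f \<le> exp (\<kappa> * L)"
    using pot[OF rz_le] Re_herglotz[OF \<sigma> rz1] by (simp add: f_eq)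
  have t: "0 < 1 - cmod z" "1 - cmod z \<le> 1" using z by auto
  \<comment> \<open>The two zones are separated at \<open>1 - |z| = A / n\<close>. Inside,
    \<open>A\<close> divides the error; outside, it enters with the power \<open>1 / l\<close>. This
    choice leaves \<open>exp (- (l * L / 2))\<close> and \<open>exp (- (L / 2))\<close>.\<close>
  define A where "A = exp (l * L / 2)"
  have A: "1 \<le> A" using l L by (simp add: A_def)
  \<comment> \<open>One factor \<open>exp (\<kappa> * L)\<close> comes from the stage itself, the
    other from the earlier stages. Since \<open>2 * \<kappa> \<le> l / 4\<close>, a decay rate of
    \<open>l / 4 \<ge> \<beta>\<close> survives.\<close>
  have exp_le': "exp (- (l * L / 2)) * exp (2 * (\<kappa> * L)) \<le> exp (- \<beta> * L)"
  proof -
    have "(- (l / 2) + 2 * \<kappa>) * L \<le> (- \<beta>) * L" using \<kappa> \<beta> L by (intro mult_right_mono) auto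
    then show ?thesis unfolding exp_add[symmetric] by (simp add: algebra_simps)
  qed
  have exp_le'': "exp (- (L / 2)) * exp (2 * (\<kappa> * L)) \<le> exp (- \<beta> * L)"
  proof -
    have "(- (1 / 2) + 2 * \<kappa>) * L \<le> (- \<beta>) * L" using \<kappa> \<beta> L by (intro mult_right_mono) auto
    then show ?thesis unfolding exp_add[symmetric] by (simp add: algebra_simps)
  qed
  show "w (1 - cmod z) * (exp (\<kappa> * L) * cmod (f * singular_inner \<sigma> z - 1))
      \<le> (2 * 2 powr (1 / l) + 12 * w 1) * exp (- \<beta> * L)"
  proof (cases "A \<le> n * (1 - cmod z)")
    case True
    define u where "u = herglotz \<sigma> (of_real r * z) - herglotz \<sigma> z"
    have "1 \<le> n * (1 - cmod z)" using True A by linarith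
    then have "cmod z \<le> 1 - 1 / n" using n by (simp add: field_simps)
    from pot[OF this] have J: "(1 - (cmod z)\<^sup>2) * inverse_square_potential \<sigma> z \<le> \<kappa> * L" .
    have "(cmod z)\<^sup>2 \<le> cmod z" using z by (simp add: power2_eq_square mult_left_le)
    then have "(1 - cmod z) * inverse_square_potential \<sigma> z \<le> (1 - (cmod z)\<^sup>2) * inverse_square_potential \<sigma> z"
      by (intro mult_right_mono inverse_square_potential_nonneg) auto
    with J have J': "(1 - cmod z) * inverse_square_potential \<sigma> z \<le> \<kappa> * L" by linarith
    have "A * cmod u \<le> n * (1 - cmod z) * cmod u" using True by (intro mult_right_mono) auto
    also have "\<dots> \<le> n * (1 - cmod z) * (4 * (1 - r) * inverse_square_potential \<sigma> z)"
      using herglotz_diff_le[OF \<sigma> z r(1,2)] t n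
      by (intro mult_left_mono) (auto simp: u_def norm_minus_commute)
    also have "\<dots> = 4 * ((1 - cmod z) * inverse_square_potential \<sigma> z)" using n by (simp add: r(3))
    also have "\<dots> \<le> 4 * (\<kappa> * L)" using J' by simp
    finally have Au: "A * cmod u \<le> 4 * (\<kappa> * L)" .
    \<comment> \<open>Here \<open>\<kappa> \<le> l / 8\<close> ensures \<open>|u| \<le> 1\<close>,
      the range of the linear estimate for \<open>exp u - 1\<close>.\<close>
    have "4 * (\<kappa> * L) \<le> l * L / 2"
      using mult_right_mono[OF \<kappa>(3) L(1)] by simp
    also have "\<dots> \<le> A" using exp_ge_add_one_self[of "l * L / 2"] unfolding A_def by linarith
    finally have "A * cmod u \<le> A * 1" using Au by simp
    then have u1: "cmod u \<le> 1" using A by (simp only: mult_le_cancel_left_pos)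
    have "f * singular_inner \<sigma> z = exp u"
      by (simp add: f_eq singular_inner_eq u_def exp_diff exp_minus divide_inverse)
    then have "cmod (f * singular_inner \<sigma> z - 1) \<le> 3 * cmod u"
      using cmod_exp_minus_1_le[OF u1] by simp
    also have "cmod u \<le> 4 * (\<kappa> * L) / A" using Au A by (simp add: field_simps)
    finally have "cmod (f * singular_inner \<sigma> z - 1) \<le> 12 * (\<kappa> * L) / A" by simp
    also have "\<dots> \<le> 12 * exp (\<kappa> * L) / A"
    proof -
      have "\<kappa> * L \<le> exp (\<kappa> * L)" using exp_ge_add_one_self[of "\<kappa> * L"] by linarith
      then show ?thesis using A by (intro divide_right_mono mult_left_mono) auto
    qed
    also have "\<dots> = 12 * exp (\<kappa> * L) * exp (- (l * L / 2))" by (simp add: A_def exp_minus field_simps)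
    finally have "exp (\<kappa> * L) * cmod (f * singular_inner \<sigma> z - 1)
        \<le> exp (\<kappa> * L) * (12 * exp (\<kappa> * L) * exp (- (l * L / 2)))" by (intro mult_left_mono) auto
    also have "\<dots> = 12 * (exp (- (l * L / 2)) * exp (2 * (\<kappa> * L)))"
      by (simp only: mult_2 exp_add) (simp add: mult_ac)
    also have "\<dots> \<le> 12 * exp (- \<beta> * L)" using exp_le' by simp
    finally have le: "exp (\<kappa> * L) * cmod (f * singular_inner \<sigma> z - 1) \<le> 12 * exp (- \<beta> * L)" .
    have "w (1 - cmod z) * (exp (\<kappa> * L) * cmod (f * singular_inner \<sigma> z - 1))
        \<le> w 1 * (12 * exp (- \<beta> * L))"
      by (rule mult_mono[OF _ le]) (use t w1 majorant_mono[OF w, of "1 - cmod z" 1] in auto)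
    also have "\<dots> \<le> (2 * 2 powr (1 / l) + 12 * w 1) * exp (- \<beta> * L)"
      by (simp add: distrib_right)
    finally show ?thesis .
  next
    case False
    define s where "s = 1 / n"
    have s: "0 < s" "s \<le> 1" using n by (auto simp: s_def)
    have ws: "0 < w s" "w s \<le> exp (- L)" using majorant_pos[OF w s] L by (auto simp: s_def n_def)
    have wt: "0 < w (1 - cmod z)" using majorant_pos[OF w t] .
    \<comment> \<open>The weight at distance less than \<open>A / n\<close> is compared with its
      value at \<open>s = 1 / n\<close>, which is at most \<open>exp (- L)\<close>.\<close>
    have "w (1 - cmod z) powr l \<le> ((1 - cmod z) / s + 1) * w s powr l"
      using modulus_of_continuity_le[OF l(2) s, of "1 - cmod z"] t by simp
    also have "\<dots> \<le> 2 * A * w s powr l"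
      using False A n by (intro mult_right_mono) (auto simp: s_def mult.commute)
    also have "\<dots> \<le> 2 * A * exp (- L) powr l"
      using ws l A by (intro mult_left_mono powr_mono2) auto
    finally have "(w (1 - cmod z) powr l) powr (1 / l) \<le> (2 * A * exp (- L) powr l) powr (1 / l)"
      using l by (intro powr_mono2) auto
    moreover have "(w (1 - cmod z) powr l) powr (1 / l) = w (1 - cmod z)"
      using wt l by (simp add: powr_powr)
    moreover have "(2 * A * exp (- L) powr l) powr (1 / l) = 2 powr (1 / l) * exp (- (L / 2))"
    proof -
      have "(2 * A * exp (- L) powr l) powr (1 / l) = 2 powr (1 / l) * A powr (1 / l) * (exp (- L) powr l) powr (1 / l)"
        using A by (simp add: powr_mult)
      also have "A powr (1 / l) = exp (L / 2)" using l by (simp add: A_def powr_def)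
      also have "(exp (- L) powr l) powr (1 / l) = exp (- L)" using l by (simp add: powr_powr)
      finally show ?thesis by (simp add: mult.assoc flip: exp_add)
    qed
    ultimately have wle: "w (1 - cmod z) \<le> 2 powr (1 / l) * exp (- (L / 2))" by simp
    have "cmod (f * singular_inner \<sigma> z - 1) \<le> cmod (f * singular_inner \<sigma> z) + 1"
      using norm_triangle_ineq4[of "f * singular_inner \<sigma> z" 1] by simp
    also have "cmod (f * singular_inner \<sigma> z) \<le> exp (\<kappa> * L) * 1"
      unfolding norm_mult using f cmod_singular_inner_le_1[OF \<sigma> z] by (intro mult_mono) auto
    also have "exp (\<kappa> * L) * 1 + 1 \<le> 2 * exp (\<kappa> * L)" using \<open>0 \<le> \<kappa> * L\<close> by simp
    finally have le: "exp (\<kappa> * L) * cmod (f * singular_inner \<sigma> z - 1) \<le> exp (\<kappa> * L) * (2 * exp (\<kappa> * L))"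
      by (intro mult_left_mono) auto
    have "w (1 - cmod z) * (exp (\<kappa> * L) * cmod (f * singular_inner \<sigma> z - 1))
        \<le> 2 powr (1 / l) * exp (- (L / 2)) * (exp (\<kappa> * L) * (2 * exp (\<kappa> * L)))"
      by (rule mult_mono[OF wle le]) auto
    also have "\<dots> = 2 * 2 powr (1 / l) * (exp (- (L / 2)) * exp (2 * (\<kappa> * L)))"
      by (simp only: mult_2 exp_add) (simp add: algebra_simps)
    also have "\<dots> \<le> 2 * 2 powr (1 / l) * exp (- \<beta> * L)" using exp_le'' by (intro mult_left_mono) auto
    also have "\<dots> \<le> (2 * 2 powr (1 / l) + 12 * w 1) * exp (- \<beta> * L)"
      using w1 by (intro mult_right_mono) auto
    finally show ?thesis .
  qed
qed

section \<open>Roberts' decomposition\<close>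

lemma measurable_on_circle:
  assumes "finite_borel_on_circle \<sigma>" "f \<in> measurable borel N"
  shows "f \<in> measurable \<sigma> N"
proof -
  have "f \<in> measurable circle_borel N"
    unfolding circle_borel_def by (rule measurable_restrict_space1[OF assms(2)])
  then show ?thesis
    using measurable_cong_sets[of \<sigma> circle_borel N N] assms(1)
    by (auto simp: finite_borel_on_circle_def)
qed

text \<open>All pieces will be densities with respect to the one measure \<open>\<nu>\<close>, so
  that splitting the measure amounts to splitting integrands.\<close>

lemma density_on_circle:
  assumes \<nu>: "finite_borel_on_circle \<nu>" and \<theta>: "\<theta> \<in> borel_measurable borel"
    and bounds: "\<And>\<zeta>. 0 \<le> \<theta> \<zeta>" "\<And>\<zeta>. \<theta> \<zeta> \<le> (1::real)"
  shows "finite_borel_on_circle (density \<nu> \<theta>)"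
    and "A \<in> sets \<nu> \<Longrightarrow> measure (density \<nu> \<theta>) A = (LINT \<zeta>|\<nu>. \<theta> \<zeta> * indicator A \<zeta>)"
    and "cmod z < 1 \<Longrightarrow> herglotz (density \<nu> \<theta>) z = (LINT \<zeta>|\<nu>. \<theta> \<zeta> *\<^sub>R ((\<zeta> + z) / (\<zeta> - z)))"
proof -
  interpret finite_measure \<nu> using \<nu> by (simp add: finite_borel_on_circle_def)
  have m[measurable]: "\<theta> \<in> borel_measurable \<nu>" by (rule measurable_on_circle[OF \<nu> \<theta>])
  have "emeasure (density \<nu> \<theta>) (space \<nu>) \<le> emeasure \<nu> (space \<nu>)"
  proof -
    have "emeasure (density \<nu> \<theta>) (space \<nu>) = (\<integral>\<^sup>+\<zeta>. ennreal (\<theta> \<zeta>) * indicator (space \<nu>) \<zeta> \<partial>\<nu>)"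
      by (rule emeasure_density) auto
    also have "\<dots> \<le> (\<integral>\<^sup>+\<zeta>. indicator (space \<nu>) \<zeta> \<partial>\<nu>)"
      using bounds by (intro nn_integral_mono) (auto simp: indicator_def)
    finally show ?thesis by simp
  qed
  then have fin: "emeasure (density \<nu> \<theta>) (space \<nu>) \<noteq> \<infinity>"
    using emeasure_finite by (auto simp: top_unique)
  then have "finite_measure (density \<nu> \<theta>)" by (intro finite_measureI) simp
  then show "finite_borel_on_circle (density \<nu> \<theta>)"
    using \<nu> by (simp add: finite_borel_on_circle_def)
  then interpret d: finite_measure "density \<nu> \<theta>" by (simp add: finite_borel_on_circle_def)
  show "measure (density \<nu> \<theta>) A = (LINT \<zeta>|\<nu>. \<theta> \<zeta> * indicator A \<zeta>)" if A: "A \<in> sets \<nu>"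
  proof -
    have "measure (density \<nu> \<theta>) A = (LINT \<zeta>|density \<nu> \<theta>. indicator A \<zeta>)"
      using A sets.sets_into_space[OF A] by (simp add: Int_absorb2)
    also have "\<dots> = (LINT \<zeta>|\<nu>. \<theta> \<zeta> *\<^sub>R indicator A \<zeta>)"
      using A bounds by (intro integral_density) auto
    finally show ?thesis by simp
  qed
  show "herglotz (density \<nu> \<theta>) z = (LINT \<zeta>|\<nu>. \<theta> \<zeta> *\<^sub>R ((\<zeta> + z) / (\<zeta> - z)))" if "cmod z < 1"
    unfolding herglotz_def
    using bounds integrable_herglotz[OF \<nu> that] by (intro integral_density) auto
qed

definition arc_mass :: "complex measure \<Rightarrow> (complex \<Rightarrow> real) \<Rightarrow> nat \<Rightarrow> nat \<Rightarrow> real" where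
  "arc_mass \<nu> \<rho> m j = (LINT \<zeta>|\<nu>. \<rho> \<zeta> * indicator {\<zeta>. dyadic_index m \<zeta> = j} \<zeta>)"

text \<open>
  The density of what is left of \<open>\<nu>\<close> after the first stages: stage \<open>k\<close> removes from each dyadic arc
  of generation \<open>m k\<close> as much mass as possible, but at most \<open>\<tau> k\<close>.
\<close>

primrec roberts_rest :: "complex measure \<Rightarrow> (nat \<Rightarrow> nat) \<Rightarrow> (nat \<Rightarrow> real) \<Rightarrow> nat \<Rightarrow> complex \<Rightarrow> real" where
  "roberts_rest \<nu> m \<tau> 0 = (\<lambda>\<zeta>. 1)"
| "roberts_rest \<nu> m \<tau> (Suc k) = (\<lambda>\<zeta>.
     (let M = arc_mass \<nu> (roberts_rest \<nu> m \<tau> k) (m k) (dyadic_index (m k) \<zeta>)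
      in if \<tau> k < M then 1 - \<tau> k / M else 0) * roberts_rest \<nu> m \<tau> k \<zeta>)"

section \<open>Successive removal of mass\<close>

locale roberts =
  fixes \<nu> :: "complex measure" and m :: "nat \<Rightarrow> nat" and \<tau> :: "nat \<Rightarrow> real"
  assumes \<nu>: "finite_borel_on_circle \<nu>" and \<tau>_pos: "\<And>k. 0 < \<tau> k"
begin

abbreviation "\<rho> \<equiv> roberts_rest \<nu> m \<tau>"

definition "M k j = arc_mass \<nu> (\<rho> k) (m k) j"

definition "heavy k = {j. j < 2 ^ m k \<and> \<tau> k < M k j}"

definition "piece k \<zeta> = \<rho> k \<zeta> - \<rho> (Suc k) \<zeta>"

text \<open>Scaling an arc of mass \<open>M k j > \<tau> k\<close> by
  \<open>1 - \<tau> k / M k j\<close> leaves the mass \<open>M k j - \<tau> k\<close>; the value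
  \<open>0\<close> empties the arc.\<close>

definition "keep k j = (if \<tau> k < M k j then 1 - \<tau> k / M k j else 0)"

lemma rest_Suc: "\<rho> (Suc k) \<zeta> = keep k (dyadic_index (m k) \<zeta>) * \<rho> k \<zeta>"
  by (simp add: keep_def M_def Let_def)

declare roberts_rest.simps(2) [simp del]

lemma keep_bounds: "0 \<le> keep k j" "keep k j \<le> 1"
proof -
  have "0 \<le> \<tau> k / M k j \<and> \<tau> k / M k j \<le> 1" if "\<tau> k < M k j"
    using that \<tau>_pos[of k] by simp
  then show "0 \<le> keep k j" "keep k j \<le> 1" by (auto simp: keep_def)
qed

lemma rest_bounds: "0 \<le> \<rho> k \<zeta>" "\<rho> k \<zeta> \<le> 1"
proof (induction k)
  case (Suc k)
  { case 1 show ?case unfolding rest_Suc using Suc keep_bounds by simp }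
  { case 2 show ?case unfolding rest_Suc using Suc keep_bounds by (simp add: mult_le_one) }
qed auto

lemma rest_measurable [measurable]: "\<rho> k \<in> borel_measurable borel"
proof (induction k)
  case (Suc k)
  have "(\<lambda>\<zeta>. keep k (dyadic_index (m k) \<zeta>)) \<in> borel_measurable borel"
    by (rule measurable_compose[OF measurable_dyadic_index]) simp
  then have "(\<lambda>\<zeta>. keep k (dyadic_index (m k) \<zeta>) * \<rho> k \<zeta>) \<in> borel_measurable borel"
    using Suc by measurable
  then show ?case unfolding rest_Suc[abs_def] .
qed simp

lemma piece_eq: "piece k \<zeta> = (1 - keep k (dyadic_index (m k) \<zeta>)) * \<rho> k \<zeta>"
  by (simp add: piece_def rest_Suc algebra_simps)

lemma piece_bounds: "0 \<le> piece k \<zeta>" "piece k \<zeta> \<le> 1"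
  using rest_bounds keep_bounds by (auto simp: piece_eq mult_le_one)

lemma piece_measurable [measurable]: "piece k \<in> borel_measurable borel"
  unfolding piece_def[abs_def] by measurable

lemma integrable_bounded:
  fixes f :: "complex \<Rightarrow> real"
  assumes "f \<in> borel_measurable borel" "\<And>\<zeta>. \<bar>f \<zeta>\<bar> \<le> B"
  shows "integrable \<nu> f"
  by (rule integrable_bounded_on_circle[OF \<nu> measurable_on_circle[OF \<nu> assms(1)]]) (use assms(2) in auto)

lemma integrable_piece: "integrable \<nu> (piece k)"
  by (rule integrable_bounded[of _ 1]) (use piece_bounds in auto)

lemma arc_mass_piece: "arc_mass \<nu> (piece k) (m k) j = (1 - keep k j) * M k j"
proof -
  have "arc_mass \<nu> (piece k) (m k) j
      = (LINT \<zeta>|\<nu>. (1 - keep k j) * (\<rho> k \<zeta> * indicator {\<zeta>. dyadic_index (m k) \<zeta> = j} \<zeta>))"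
    unfolding arc_mass_def
    by (intro Bochner_Integration.integral_cong refl) (auto simp: piece_eq indicator_def)
  then show ?thesis by (simp add: M_def arc_mass_def)
qed

lemma arc_mass_piece_le: "arc_mass \<nu> (piece k) (m k) j \<le> \<tau> k"
  unfolding arc_mass_piece using \<tau>_pos[of k] by (auto simp: keep_def)

lemma arc_mass_piece_heavy: "j \<in> heavy k \<Longrightarrow> arc_mass \<nu> (piece k) (m k) j = \<tau> k"
  unfolding arc_mass_piece using \<tau>_pos[of k] by (auto simp: keep_def heavy_def)

lemma finite_heavy: "finite (heavy k)"
  unfolding heavy_def by simp

text \<open>A heavy arc loses exactly \<open>\<tau> k\<close>, and different arcs are disjoint.
  Counting heavy arcs by removed mass converts the finiteness of \<open>\<nu>\<close> into the
  summability behind finite entropy.\<close>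

lemma card_heavy_le: "real (card (heavy k)) * \<tau> k \<le> (LINT \<zeta>|\<nu>. piece k \<zeta>)"
proof -
  have int: "integrable \<nu> (\<lambda>\<zeta>. piece k \<zeta> * indicator {\<zeta>. dyadic_index (m k) \<zeta> = j} \<zeta>)" for j
    by (rule integrable_bounded[of _ 1]) (measurable, use piece_bounds in \<open>auto simp: indicator_def\<close>)
  have "real (card (heavy k)) * \<tau> k = (\<Sum>j\<in>heavy k. arc_mass \<nu> (piece k) (m k) j)"
    by (simp add: arc_mass_piece_heavy)
  also have "\<dots> = (LINT \<zeta>|\<nu>. (\<Sum>j\<in>heavy k. piece k \<zeta> * indicator {\<zeta>. dyadic_index (m k) \<zeta> = j} \<zeta>))"
    unfolding arc_mass_def using int by (subst Bochner_Integration.integral_sum) auto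
  also have "\<dots> \<le> (LINT \<zeta>|\<nu>. piece k \<zeta>)"
  proof (rule integral_mono)
    show "integrable \<nu> (\<lambda>\<zeta>. \<Sum>j\<in>heavy k. piece k \<zeta> * indicator {\<zeta>. dyadic_index (m k) \<zeta> = j} \<zeta>)"
      using int by auto
    show "(\<Sum>j\<in>heavy k. piece k \<zeta> * indicator {\<zeta>. dyadic_index (m k) \<zeta> = j} \<zeta>) \<le> piece k \<zeta>" for \<zeta>
    proof -
      have "(\<Sum>j\<in>heavy k. piece k \<zeta> * indicator {\<zeta>. dyadic_index (m k) \<zeta> = j} \<zeta>)
          = (\<Sum>j\<in>heavy k. if dyadic_index (m k) \<zeta> = j then piece k \<zeta> else 0)"
        by (intro sum.cong) auto
      then show ?thesis using finite_heavy[of k] piece_bounds(1)[of k \<zeta>] by simp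
    qed
  qed (rule integrable_piece)
  finally show ?thesis .
qed

lemma sum_piece: "(\<Sum>k<N. piece k \<zeta>) + \<rho> N \<zeta> = 1"
  by (induction N) (auto simp: piece_def)

lemma sum_integral_piece_le: "(\<Sum>k<N. (LINT \<zeta>|\<nu>. piece k \<zeta>)) \<le> measure \<nu> (space \<nu>)"
proof -
  interpret finite_measure \<nu> using \<nu> by (simp add: finite_borel_on_circle_def)
  have "(\<Sum>k<N. (LINT \<zeta>|\<nu>. piece k \<zeta>)) = (LINT \<zeta>|\<nu>. (\<Sum>k<N. piece k \<zeta>))"
    using integrable_piece by (subst Bochner_Integration.integral_sum) auto
  also have "\<dots> \<le> (LINT \<zeta>|\<nu>. 1)"
  proof (rule integral_mono)
    show "(\<Sum>k<N. piece k \<zeta>) \<le> 1" for \<zeta>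
      using sum_piece[where N = N and \<zeta> = \<zeta>] rest_bounds(1)[of N \<zeta>] by linarith
  qed (use integrable_piece in auto)
  finally show ?thesis by simp
qed

text \<open>An arc that is not heavy gives up all it has, and the recursion is multiplicative, so
  the density stays zero from then on.\<close>

lemma rest_eq_0:
  assumes "dyadic_index (m k) \<zeta> \<notin> heavy k" "k < n"
  shows "\<rho> n \<zeta> = 0"
proof -
  have "keep k (dyadic_index (m k) \<zeta>) = 0"
    using assms(1) dyadic_index_less[of "m k" \<zeta>] by (simp add: heavy_def keep_def)
  then have "\<rho> (Suc k) \<zeta> = 0" by (simp add: rest_Suc)
  moreover have "\<rho> (Suc k + i) \<zeta> = 0" if "\<rho> (Suc k) \<zeta> = 0" for i
  proof (induction i)
    case 0
    then show ?case using that by (simp only: add_0_right)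
  next
    case (Suc i)
    then show ?case by (simp only: add_Suc_right rest_Suc)
  qed
  ultimately show ?thesis using assms(2) by (metis Suc_leI le_Suc_ex)
qed

text \<open>A point of the circle outside the intersection lies at some generation in an arc that is
  not heavy, after which its density vanishes. Dominated convergence with the bound \<open>1\<close>
  applies.\<close>

lemma integral_rest_tendsto_0:
  assumes null: "emeasure \<nu> (\<Inter>k. \<Union>j\<in>heavy k. closed_dyadic_arc (m k) j) = 0"
    and sets: "(\<Inter>k. \<Union>j\<in>heavy k. closed_dyadic_arc (m k) j) \<in> sets \<nu>"
  shows "(\<lambda>k. LINT \<zeta>|\<nu>. \<rho> k \<zeta>) \<longlonglongrightarrow> 0"
proof -
  interpret finite_measure \<nu> using \<nu> by (simp add: finite_borel_on_circle_def)
  have "(\<lambda>k. LINT \<zeta>|\<nu>. \<rho> k \<zeta>) \<longlonglongrightarrow> (LINT \<zeta>|\<nu>. 0)"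
  proof (rule integral_dominated_convergence[where w = "\<lambda>_. 1"])
    show "\<rho> k \<in> borel_measurable \<nu>" for k by (rule measurable_on_circle[OF \<nu>]) measurable
    show "AE \<zeta> in \<nu>. norm (\<rho> k \<zeta>) \<le> 1" for k using rest_bounds by auto
    have "AE \<zeta> in \<nu>. \<zeta> \<notin> (\<Inter>k. \<Union>j\<in>heavy k. closed_dyadic_arc (m k) j)"
      using null sets by (intro AE_not_in) auto
    moreover have "AE \<zeta> in \<nu>. \<zeta> \<in> sphere 0 1"
      using AE_space[of \<nu>] space_finite_borel_on_circle[OF \<nu>] by simp
    ultimately show "AE \<zeta> in \<nu>. (\<lambda>k. \<rho> k \<zeta>) \<longlonglongrightarrow> 0"
    proof eventually_elim
      case (elim \<zeta>)
      then obtain k where "dyadic_index (m k) \<zeta> \<notin> heavy k"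
        using dyadic_index_closed_arc[of \<zeta>] by auto
      then have "eventually (\<lambda>n. \<rho> n \<zeta> = 0) sequentially"
        using rest_eq_0[of k \<zeta>] by (intro eventually_mono[OF eventually_gt_at_top[of k]]) auto
      then show ?case by (rule tendsto_eventually)
    qed
  qed auto
  then show ?thesis by simp
qed

end

section \<open>Cyclicity\<close>

text \<open>Telescoping arranged so that each error is weighted by the earlier factors only; the
  \<open>k\<close>-th error could not compensate the growing bounds of the later ones.\<close>

lemma norm_prod_minus_1_le:
  fixes a :: "nat \<Rightarrow> 'a::{real_normed_algebra_1, comm_monoid_mult}"
  shows "norm ((\<Prod>k<N. a k) - 1) \<le> (\<Sum>k<N. (\<Prod>j<k. norm (a j)) * norm (a k - 1))"
proof (induction N)
  case (Suc N)
  have "(\<Prod>k<Suc N. a k) - 1 = (\<Prod>k<N. a k) * (a N - 1) + ((\<Prod>k<N. a k) - 1)"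
    by (simp add: algebra_simps)
  then have "norm ((\<Prod>k<Suc N. a k) - 1) \<le> norm ((\<Prod>k<N. a k) * (a N - 1)) + norm ((\<Prod>k<N. a k) - 1)"
    by (metis norm_triangle_ineq)
  also have "norm ((\<Prod>k<N. a k) * (a N - 1)) \<le> norm (\<Prod>k<N. a k) * norm (a N - 1)"
    by (rule norm_mult_ineq)
  also have "norm (\<Prod>k<N. a k) \<le> (\<Prod>k<N. norm (a k))" by (rule norm_prod_le)
  finally show ?case using Suc by (simp add: mult_right_mono)
qed simp

text \<open>\<open>m k\<close> is the first dyadic scale at which \<open>- ln w\<close> reaches
  \<open>2 ^ k * L\<close>. It overshoots by at most \<open>L\<close>, because halving the distance
  raises \<open>- ln w\<close> by at most a constant, which \<open>L\<close> dominates.\<close>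

lemma dyadic_scales:
  assumes w: "majorant w"
  obtains L0 where "0 < L0"
    "\<And>L. L0 \<le> L \<Longrightarrow> \<exists>m. (\<forall>k. m k \<le> m (Suc k)) \<and>
      (\<forall>k. 2 ^ k * L \<le> - ln (w (1 / 2 ^ m k))) \<and> (\<forall>k. - ln (w (1 / 2 ^ m k)) \<le> 2 ^ k * L + L)"
proof -
  obtain l where l: "l > 0" "modulus_of_continuity (\<lambda>t. w t powr l)"
    using w unfolding majorant_def by blast
  define D where "D = 4 / l * (1 / 2) powr (- 1 / 2)"
  \<comment> \<open>\<open>D\<close> bounds the increase per halving, \<open>- ln (w 1)\<close>
    covers the case that scale \<open>0\<close> already qualifies, and \<open>1\<close> makes
    \<open>L0\<close> positive.\<close>
  define L0 where "L0 = max 1 (max D (- ln (w 1)))"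
  show thesis
  proof (rule that)
    show "0 < L0" by (simp add: L0_def)
    fix L assume L: "L0 \<le> L"
    then have L': "1 \<le> L" "D \<le> L" "- ln (w 1) \<le> L" by (auto simp: L0_def)
    have pos: "0 < w (1 / 2 ^ n)" for n :: nat by (rule majorant_pos[OF w]) auto
    have ex: "\<exists>n. 2 ^ k * L \<le> - ln (w (1 / 2 ^ n))" for k :: nat
    proof -
      obtain d where d: "0 < d" "\<And>t. 0 \<le> t \<Longrightarrow> t \<le> d \<Longrightarrow> w t < exp (- (2 ^ k * L))"
        using majorant_tendsto_0[OF w, of "exp (- (2 ^ k * L))"] by auto
      obtain n where "(1 / 2) ^ n < d" using real_arch_pow_inv[of d "1 / 2"] d(1) by auto
      then have "w (1 / 2 ^ n) < exp (- (2 ^ k * L))" by (intro d(2)) (auto simp: power_one_over)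
      then have "ln (w (1 / 2 ^ n)) < ln (exp (- (2 ^ k * L)))" using pos by (subst ln_less_cancel_iff) auto
      then show ?thesis by (intro exI[of _ n]) simp
    qed
    define m where "m k = (LEAST n. 2 ^ k * L \<le> - ln (w (1 / 2 ^ n)))" for k :: nat
    have m: "2 ^ k * L \<le> - ln (w (1 / 2 ^ m k))" for k
      unfolding m_def by (rule LeastI_ex[OF ex])
    have "m k \<le> m (Suc k)" for k
    proof -
      have "2 ^ k * L \<le> 2 ^ Suc k * L" using L' by (intro mult_right_mono) auto
      then have "2 ^ k * L \<le> - ln (w (1 / 2 ^ m (Suc k)))" using m[of "Suc k"] by linarith
      then show ?thesis unfolding m_def[of k] by (rule Least_le)
    qed
    moreover have "- ln (w (1 / 2 ^ m k)) \<le> 2 ^ k * L + L" for k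
    proof (cases "m k")
      case 0
      have "0 \<le> 2 ^ k * L" using L' by simp
      moreover have "- ln (w (1 / 2 ^ m k)) \<le> L" using 0 L' by simp
      ultimately show ?thesis by linarith
    next
      case (Suc n)
      have "\<not> 2 ^ k * L \<le> - ln (w (1 / 2 ^ n))" using Suc not_less_Least[of n "\<lambda>n. 2 ^ k * L \<le> - ln (w (1 / 2 ^ n))"] unfolding m_def by simp
      moreover have "- ln (w (1 / 2 * (1 / 2 ^ n))) \<le> - ln (w (1 / 2 ^ n)) + D"
        unfolding D_def by (rule majorant_log_ratio_le[OF w l]) auto
      ultimately show ?thesis using L' Suc by simp
    qed
    ultimately show "\<exists>m. (\<forall>k. m k \<le> m (Suc k)) \<and>
      (\<forall>k. 2 ^ k * L \<le> - ln (w (1 / 2 ^ m k))) \<and> (\<forall>k. - ln (w (1 / 2 ^ m k)) \<le> 2 ^ k * L + L)"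
      using m by blast
  qed
qed

section \<open>Factorization along the stages and the remaining factor\<close>

context roberts
begin

lemma integrable_density_kernel:
  assumes "\<theta> \<in> borel_measurable borel" "\<And>\<zeta>. 0 \<le> \<theta> \<zeta>" "\<And>\<zeta>. \<theta> \<zeta> \<le> (1::real)" "cmod z < 1"
  shows "integrable \<nu> (\<lambda>\<zeta>. \<theta> \<zeta> *\<^sub>R ((\<zeta> + z) / (\<zeta> - z)))"
proof (rule Bochner_Integration.integrable_bound[OF integrable_herglotz[OF \<nu> assms(4)]])
  show "(\<lambda>\<zeta>. \<theta> \<zeta> *\<^sub>R ((\<zeta> + z) / (\<zeta> - z))) \<in> borel_measurable \<nu>"
    using measurable_on_circle[OF \<nu> assms(1)] integrable_herglotz[OF \<nu> assms(4)] by measurable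
  have "\<bar>\<theta> \<zeta>\<bar> * c \<le> c" if "0 \<le> c" for \<zeta> c
    using assms(2,3)[of \<zeta>] that by (simp add: mult_left_le_one_le)
  then show "AE \<zeta> in \<nu>. norm (\<theta> \<zeta> *\<^sub>R ((\<zeta> + z) / (\<zeta> - z))) \<le> norm ((\<zeta> + z) / (\<zeta> - z))"
    by (simp only: norm_scaleR) simp
qed

lemma herglotz_decomposition:
  assumes z: "cmod z < 1"
  shows "herglotz \<nu> z = (\<Sum>k<N. herglotz (density \<nu> (piece k)) z) + herglotz (density \<nu> (\<rho> N)) z"
proof -
  have int: "integrable \<nu> (\<lambda>\<zeta>. piece k \<zeta> *\<^sub>R ((\<zeta> + z) / (\<zeta> - z)))" for k
    by (rule integrable_density_kernel[OF piece_measurable piece_bounds z])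
  have int': "integrable \<nu> (\<lambda>\<zeta>. \<rho> N \<zeta> *\<^sub>R ((\<zeta> + z) / (\<zeta> - z)))"
    by (rule integrable_density_kernel[OF rest_measurable rest_bounds z])
  have "herglotz \<nu> z = (LINT \<zeta>|\<nu>. (\<Sum>k<N. piece k \<zeta> *\<^sub>R ((\<zeta> + z) / (\<zeta> - z)))
      + \<rho> N \<zeta> *\<^sub>R ((\<zeta> + z) / (\<zeta> - z)))"
    unfolding herglotz_def
    by (intro Bochner_Integration.integral_cong refl)
      (simp only: scaleR_sum_left[symmetric] scaleR_add_left[symmetric] sum_piece scaleR_one)
  also have "\<dots> = (\<Sum>k<N. (LINT \<zeta>|\<nu>. piece k \<zeta> *\<^sub>R ((\<zeta> + z) / (\<zeta> - z))))
      + (LINT \<zeta>|\<nu>. \<rho> N \<zeta> *\<^sub>R ((\<zeta> + z) / (\<zeta> - z)))"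
    using int int' by (subst Bochner_Integration.integral_add)
      (auto simp: Bochner_Integration.integral_sum intro!: Bochner_Integration.integrable_sum)
  also have "\<dots> = (\<Sum>k<N. herglotz (density \<nu> (piece k)) z) + herglotz (density \<nu> (\<rho> N)) z"
    using density_on_circle(3)[OF \<nu> piece_measurable piece_bounds z]
      density_on_circle(3)[OF \<nu> rest_measurable rest_bounds z] by simp
  finally show ?thesis .
qed

lemma singular_inner_decomposition:
  assumes "cmod z < 1"
  shows "singular_inner \<nu> z =
    (\<Prod>k<N. singular_inner (density \<nu> (piece k)) z) * singular_inner (density \<nu> (\<rho> N)) z"
  unfolding singular_inner_eq herglotz_decomposition[OF assms, of N]
  by (simp add: exp_sum exp_add exp_diff exp_minus divide_inverse flip: prod_inversef sum_negf)

lemma measure_piece_arc_le: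
  "measure (density \<nu> (piece k)) {\<zeta> \<in> space (density \<nu> (piece k)). dyadic_index (m k) \<zeta> = j} \<le> \<tau> k"
proof -
  have "dyadic_index (m k) \<in> measurable \<nu> (count_space UNIV)"
    by (rule measurable_on_circle[OF \<nu> measurable_dyadic_index])
  then have "{\<zeta> \<in> space \<nu>. dyadic_index (m k) \<zeta> = j} \<in> sets \<nu>" by measurable
  from density_on_circle(2)[OF \<nu> piece_measurable piece_bounds this]
  have "measure (density \<nu> (piece k)) {\<zeta> \<in> space \<nu>. dyadic_index (m k) \<zeta> = j}
      = (LINT \<zeta>|\<nu>. piece k \<zeta> * indicator {\<zeta> \<in> space \<nu>. dyadic_index (m k) \<zeta> = j} \<zeta>)" .
  also have "\<dots> = arc_mass \<nu> (piece k) (m k) j"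
    unfolding arc_mass_def by (intro Bochner_Integration.integral_cong refl) (auto simp: indicator_def)
  finally show ?thesis using arc_mass_piece_le[of k j] by simp
qed

text \<open>The remaining measure has small mass. At distance more than \<open>d\<close> from the
  circle its Herglotz integral is therefore small; within \<open>d\<close> the weight is small
  enough for the trivial bound \<open>2\<close>.\<close>

lemma singular_inner_rest_approx:
  assumes w: "majorant w" and lim: "(\<lambda>k. LINT \<zeta>|\<nu>. \<rho> k \<zeta>) \<longlonglongrightarrow> 0" and "0 < e"
  obtains N where "\<And>z. cmod z < 1 \<Longrightarrow>
    w (1 - cmod z) * cmod (singular_inner (density \<nu> (\<rho> N)) z - 1) \<le> e"
proof -
  have w1: "0 < w 1" using majorant_pos[OF w] by simp
  obtain d where d: "0 < d" "d \<le> 1" "\<And>t. 0 \<le> t \<Longrightarrow> t \<le> d \<Longrightarrow> w t < e / 2"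
    using majorant_tendsto_0[OF w, of "e / 2"] \<open>0 < e\<close> by auto
  \<comment> \<open>This makes \<open>2 / d * \<delta>\<close> equal to
    \<open>min 1 (e / (3 * w 1))\<close>: at most \<open>1\<close> for the linear estimate of the
    exponential, whose constant \<open>3\<close> is cancelled by the second entry.\<close>
  define \<delta> where "\<delta> = d / 2 * min 1 (e / (3 * w 1))"
  have "0 < \<delta>" using d(1) \<open>0 < e\<close> w1 by (simp add: \<delta>_def)
  then have "eventually (\<lambda>k. (LINT \<zeta>|\<nu>. \<rho> k \<zeta>) < \<delta>) sequentially"
    by (rule order_tendstoD(2)[OF lim])
  then obtain N where N: "(LINT \<zeta>|\<nu>. \<rho> N \<zeta>) < \<delta>"
    unfolding eventually_sequentially by blast
  let ?\<sigma> = "density \<nu> (\<rho> N)"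
  note \<sigma> = density_on_circle(1)[OF \<nu> rest_measurable rest_bounds, of N]
  have mass: "measure ?\<sigma> (space ?\<sigma>) = (LINT \<zeta>|\<nu>. \<rho> N \<zeta>)"
  proof -
    have "measure ?\<sigma> (space \<nu>) = (LINT \<zeta>|\<nu>. \<rho> N \<zeta> * indicator (space \<nu>) \<zeta>)"
      by (rule density_on_circle(2)[OF \<nu> rest_measurable rest_bounds sets.top])
    also have "\<dots> = (LINT \<zeta>|\<nu>. \<rho> N \<zeta>)"
      by (intro Bochner_Integration.integral_cong refl) simp
    finally show ?thesis by simp
  qed
  show thesis
  proof (rule that[of N])
    fix z assume z: "cmod z < 1"
    have t: "0 \<le> 1 - cmod z" "1 - cmod z \<le> 1" using z by auto
    note T1 = cmod_singular_inner_le_1[OF \<sigma> z]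
    show "w (1 - cmod z) * cmod (singular_inner ?\<sigma> z - 1) \<le> e"
    proof (cases "1 - cmod z \<le> d")
      case True
      have "cmod (singular_inner ?\<sigma> z - 1) \<le> 2"
        using norm_triangle_ineq4[of "singular_inner ?\<sigma> z" 1] T1 by simp
      then have "w (1 - cmod z) * cmod (singular_inner ?\<sigma> z - 1) \<le> e / 2 * 2"
        using d(3)[OF t(1) True] \<open>0 < e\<close> by (intro mult_mono) auto
      then show ?thesis by simp
    next
      case False
      have "cmod (herglotz ?\<sigma> z) \<le> 2 / (1 - cmod z) * measure ?\<sigma> (space ?\<sigma>)"
        by (rule cmod_herglotz_le[OF \<sigma> z])
      also have "\<dots> \<le> 2 / d * \<delta>"
      proof (rule mult_mono)
        show "measure ?\<sigma> (space ?\<sigma>) \<le> \<delta>" using N mass by simp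
      qed (use False d(1) z in \<open>auto intro!: divide_left_mono\<close>)
      also have "\<dots> = min 1 (e / (3 * w 1))" using d(1) by (simp add: \<delta>_def)
      finally have h: "cmod (herglotz ?\<sigma> z) \<le> 1" "cmod (herglotz ?\<sigma> z) \<le> e / (3 * w 1)" by auto
      have "cmod (singular_inner ?\<sigma> z - 1) \<le> 3 * cmod (herglotz ?\<sigma> z)"
        using cmod_exp_minus_1_le[of "- herglotz ?\<sigma> z"] h(1) by (simp add: singular_inner_eq)
      also have "\<dots> \<le> e / w 1" using h(2) w1 by (simp add: field_simps)
      finally have "w (1 - cmod z) * cmod (singular_inner ?\<sigma> z - 1) \<le> w 1 * (e / w 1)"
        using w1 t majorant_mono[OF w, of "1 - cmod z" 1] by (intro mult_mono) auto
      then show ?thesis using w1 by simp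
    qed
  qed
qed

end

text \<open>Half of \<open>e\<close> goes to the stages, half to the remainder. A large
  \<open>L\<close> keeps the stage errors below \<open>e / 2\<close> however many stages are used;
  since scales and pieces depend on \<open>L\<close>, the number \<open>N\<close> of stages is
  chosen only after it.\<close>

lemma cyclic_singular_inner:
  assumes w: "majorant w" and \<nu>: "finite_borel_on_circle \<nu>"
    and null: "\<And>E. finite_entropy w E \<Longrightarrow> emeasure \<nu> E = 0"
  shows "cyclic_in_growth_space w (singular_inner \<nu>)"
proof (rule cyclic_in_growth_spaceI[OF w])
  show "singular_inner \<nu> holomorphic_on ball 0 1"
    unfolding singular_inner_eq[abs_def]
    using herglotz_holomorphic[OF \<nu>] by (intro holomorphic_intros)
  show "cmod (singular_inner \<nu> z) \<le> 1" if "cmod z < 1" for z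
    by (rule cmod_singular_inner_le_1[OF \<nu> that])
  fix e :: real assume "0 < e"
  obtain l where l: "l > 0" "modulus_of_continuity (\<lambda>t. w t powr l)"
    using w unfolding majorant_def by blast
  \<comment> \<open>\<open>\<kappa>\<close> and \<open>\<beta>\<close> are the largest values that
    \<open>herglotz_stage_estimate\<close> admits, \<open>C\<close> is its constant, and
    \<open>K\<close> is the comparison constant of
    \<open>inverse_square_potential_le\<close>.\<close>
  define \<kappa> \<beta> K C where "\<kappa> = min 1 l / 8" and "\<beta> = min 1 l / 4" and "K = (1 + 2 * pi)\<^sup>2"
    and "C = 2 * 2 powr (1 / l) + 12 * w 1"
  have \<kappa>: "0 < \<kappa>" "\<kappa> \<le> 1 / 8" "\<kappa> \<le> l / 8" and \<beta>: "0 < \<beta>" "\<beta> \<le> 1 / 4" "\<beta> \<le> l / 4"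
    using l(1) by (auto simp: \<kappa>_def \<beta>_def)
  have K: "0 < K" unfolding K_def using pi_gt_zero by (intro zero_less_power) linarith
  have C: "0 < C" unfolding C_def using majorant_nonneg[OF w, of 1] by (intro add_pos_nonneg) auto
  obtain L0 where L0: "0 < L0"
    "\<And>L. L0 \<le> L \<Longrightarrow> \<exists>m. (\<forall>k. m k \<le> m (Suc k)) \<and>
      (\<forall>k. 2 ^ k * L \<le> - ln (w (1 / 2 ^ m k))) \<and> (\<forall>k. - ln (w (1 / 2 ^ m k)) \<le> 2 ^ k * L + L)"
    using dyadic_scales[OF w] by blast
  \<comment> \<open>As a bound for \<open>q\<close>, the entry \<open>1 / 2\<close> gives stage
    errors of total at most \<open>2 * C * q\<close>, and \<open>e / (4 * C)\<close> makes this at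
    most \<open>e / 2\<close>.\<close>
  define \<delta> where "\<delta> = min (1 / 2) (e / (4 * C))"
  have \<delta>: "0 < \<delta>" using \<open>0 < e\<close> C by (simp add: \<delta>_def)
  define L where "L = max L0 (- ln \<delta> / \<beta>)"
  have L: "0 < L" "L0 \<le> L" using L0(1) by (auto simp: L_def)
  define q where "q = exp (- \<beta> * L)"
  have q: "0 < q" "q \<le> 1 / 2" "q \<le> e / (4 * C)"
  proof -
    have "\<beta> * (- ln \<delta> / \<beta>) \<le> \<beta> * L" using \<beta>(1) by (intro mult_left_mono) (auto simp: L_def)
    then have "- \<beta> * L \<le> ln \<delta>" using \<beta>(1) by simp
    then have "q \<le> \<delta>" unfolding q_def using \<delta> by (metis exp_le_cancel_iff exp_ln)
    then show "0 < q" "q \<le> 1 / 2" "q \<le> e / (4 * C)" by (auto simp: q_def \<delta>_def)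
  qed
  obtain m where m: "\<And>k. m k \<le> m (Suc k)" "\<And>k. 2 ^ k * L \<le> - ln (w (1 / 2 ^ m k))"
    "\<And>k. - ln (w (1 / 2 ^ m k)) \<le> 2 ^ k * L + L"
    using L0(2)[OF L(2)] by blast
  \<comment> \<open>The largest mass per arc for which the piece of stage \<open>k\<close> meets the
    smallness hypothesis of \<open>herglotz_stage_estimate\<close> at level
    \<open>2 ^ k * L\<close>.\<close>
  define \<tau> where "\<tau> k = \<kappa> * (2 ^ k * L) / K / 2 ^ m k" for k
  interpret roberts \<nu> m \<tau> by unfold_locales (use \<nu> \<kappa> L K in \<open>auto simp: \<tau>_def\<close>)
  define E where "E = (\<Inter>k. \<Union>j\<in>heavy k. closed_dyadic_arc (m k) j)"
  have "finite_entropy w E"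
    unfolding E_def
  proof (rule finite_entropy_dyadic[where B = "\<lambda>k. 2 ^ k * L + L" and m = m and H = heavy, OF w m(1) _ m(3)])
    show "heavy k \<subseteq> {..<2 ^ m k}" for k by (auto simp: heavy_def)
    show "0 \<le> 2 ^ k * L + L" for k using L by simp
    have "summable (\<lambda>k. LINT \<zeta>|\<nu>. piece k \<zeta>)"
      by (rule summableI_nonneg_bounded[OF _ sum_integral_piece_le])
        (use piece_bounds in \<open>auto intro!: Bochner_Integration.integral_nonneg\<close>)
    then have "summable (\<lambda>k. (3 + 1 / L) * K / \<kappa> * (LINT \<zeta>|\<nu>. piece k \<zeta>))" by (rule summable_mult)
    then show "summable (\<lambda>k. real (card (heavy k)) / 2 ^ m k * (2 ^ Suc k * L + L + 1))"
    proof (rule summable_comparison_test')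
      fix k :: nat
      \<comment> \<open>Because the levels only double, the entropy cost one generation later is at
        most a constant times \<open>2 ^ k * L\<close>, hence
        \<open>card (heavy k) / 2 ^ m k\<close> times this cost is at most a constant times the mass
        removed at stage \<open>k\<close>.\<close>
      have "L + 1 \<le> 2 ^ k * (L + 1)" using L by simp
      then have "2 ^ Suc k * L + L + 1 \<le> (3 + 1 / L) * (2 ^ k * L)"
        using L by (simp add: algebra_simps)
      then have "real (card (heavy k)) / 2 ^ m k * (2 ^ Suc k * L + L + 1)
          \<le> real (card (heavy k)) / 2 ^ m k * ((3 + 1 / L) * (2 ^ k * L))"
        by (intro mult_left_mono) auto
      also have "\<dots> = (3 + 1 / L) * K / \<kappa> * (real (card (heavy k)) * \<tau> k)"
        using K \<kappa>(1) by (simp add: \<tau>_def)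
      also have "\<dots> \<le> (3 + 1 / L) * K / \<kappa> * (LINT \<zeta>|\<nu>. piece k \<zeta>)"
        using K \<kappa>(1) L by (intro mult_left_mono card_heavy_le) auto
      finally show "norm (real (card (heavy k)) / 2 ^ m k * (2 ^ Suc k * L + L + 1))
          \<le> (3 + 1 / L) * K / \<kappa> * (LINT \<zeta>|\<nu>. piece k \<zeta>)" using L by simp
    qed
  qed
  then have E0: "emeasure \<nu> E = 0" and E: "closed E" "E \<subseteq> sphere 0 1"
    using null unfolding finite_entropy_def by auto
  have "E \<in> sets \<nu>"
  proof -
    have "E \<in> sets circle_borel"
      unfolding circle_borel_def sets_restrict_space
      using E by (intro image_eqI[of _ _ E]) auto
    then show ?thesis using \<nu> by (simp add: finite_borel_on_circle_def)
  qed
  with E0 have lim: "(\<lambda>k. LINT \<zeta>|\<nu>. \<rho> k \<zeta>) \<longlonglongrightarrow> 0"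
    unfolding E_def by (rule integral_rest_tendsto_0)
  have "0 < e / 2" using \<open>0 < e\<close> by simp
  from singular_inner_rest_approx[OF w lim this] obtain N where
    rest: "\<And>z. cmod z < 1 \<Longrightarrow> w (1 - cmod z) * cmod (singular_inner (density \<nu> (\<rho> N)) z - 1) \<le> e / 2"
    by blast
  note \<sigma> = density_on_circle(1)[OF \<nu> piece_measurable piece_bounds]
  define r :: "nat \<Rightarrow> real" where "r k = 1 - 1 / 2 ^ m k" for k
  define f where "f k z = exp (herglotz (density \<nu> (piece k)) (of_real (r k) * z))" for k z
  define S where "S k z = singular_inner (density \<nu> (piece k)) z" for k z
  define F where "F z = (\<Prod>k<N. f k z)" for z
  have stage: "cmod (f k z) \<le> exp (\<kappa> * (2 ^ k * L))"
    "w (1 - cmod z) * (exp (\<kappa> * (2 ^ k * L)) * cmod (f k z * S k z - 1)) \<le> C * exp (- \<beta> * (2 ^ k * L))"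
    if z: "cmod z < 1" for k z
  proof -
    have "0 < w (1 / 2 ^ m k)" by (rule majorant_pos[OF w]) auto
    then have wk: "w (1 / 2 ^ m k) \<le> exp (- (2 ^ k * L))"
      using m(2)[of k] by (metis exp_le_cancel_iff exp_ln le_minus_iff minus_le_iff)
    have Lk: "0 \<le> 2 ^ k * L" using L by simp
    note est = herglotz_stage_estimate[OF w l \<sigma> Lk wk \<kappa> \<beta>(2,3) _ z]
    show "cmod (f k z) \<le> exp (\<kappa> * (2 ^ k * L))"
      unfolding f_def r_def
      by (rule est(1)) (use measure_piece_arc_le[of k] in \<open>simp add: \<tau>_def K_def\<close>)
    show "w (1 - cmod z) * (exp (\<kappa> * (2 ^ k * L)) * cmod (f k z * S k z - 1)) \<le> C * exp (- \<beta> * (2 ^ k * L))"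
      unfolding f_def r_def S_def C_def
      by (rule est(2)) (use measure_piece_arc_le[of k] in \<open>simp add: \<tau>_def K_def\<close>)
  qed
  have prod_le: "(\<Prod>j<k. cmod (f j z * S j z)) \<le> exp (\<kappa> * (2 ^ k * L))" if z: "cmod z < 1" for k z
  proof -
    \<comment> \<open>The exponent with \<open>2 ^ k - 1\<close> is the exact sum of the earlier
      levels, which is what the induction reproduces.\<close>
    have "(\<Prod>j<k. cmod (f j z * S j z)) \<le> exp (\<kappa> * ((2 ^ k - 1) * L))"
    proof (induction k)
      case (Suc k)
      have "cmod (f k z * S k z) \<le> exp (\<kappa> * (2 ^ k * L)) * 1"
        unfolding norm_mult S_def using stage(1)[OF z] cmod_singular_inner_le_1[OF \<sigma> z]
        by (intro mult_mono) auto
      with Suc have "(\<Prod>j<Suc k. cmod (f j z * S j z))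
          \<le> exp (\<kappa> * ((2 ^ k - 1) * L)) * (exp (\<kappa> * (2 ^ k * L)) * 1)"
        unfolding prod.lessThan_Suc by (intro mult_mono prod_nonneg) auto
      also have "\<dots> = exp (\<kappa> * ((2 ^ Suc k - 1) * L))"
        by (simp add: algebra_simps flip: exp_add)
      finally show ?case .
    qed simp
    also have "\<dots> \<le> exp (\<kappa> * (2 ^ k * L))" using \<kappa>(1) L by simp
    finally show ?thesis .
  qed
  \<comment> \<open>From \<open>2 ^ k \<ge> k + 1\<close> and \<open>q \<le> 1 / 2\<close>, the
    doubly exponential decay is weakened to a geometric one that retains one factor
    \<open>q\<close>.\<close>
  have geom: "exp (- \<beta> * (2 ^ k * L)) \<le> q * (1 / 2) ^ k" for k
  proof -
    have "exp (- \<beta> * (2 ^ k * L)) = exp (of_nat (2 ^ k) * (- \<beta> * L))" by (simp add: mult_ac)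
    also have "\<dots> = q ^ (2 ^ k)" unfolding q_def by (rule exp_of_nat_mult)
    also have "\<dots> \<le> q ^ Suc k" using q by (intro power_decreasing Suc_leI less_exp) auto
    also have "\<dots> \<le> q * (1 / 2) ^ k" using q by (simp add: power_mono)
    finally show ?thesis .
  qed
  have sum_half: "(\<Sum>k<N. (1 / 2) ^ k) \<le> (2::real)"
  proof -
    have "(\<Sum>k<N. (1 / 2) ^ k) = 2 - 2 * (1 / 2 :: real) ^ N" by (induction N) (auto simp: field_simps)
    then show ?thesis by simp
  qed
  have main: "w (1 - cmod z) * cmod ((\<Prod>k<N. f k z * S k z) - 1) \<le> e / 2" if z: "cmod z < 1" for z
  proof -
    have nn: "0 \<le> w (1 - cmod z)" using z by (intro majorant_nonneg[OF w]) auto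
    have "w (1 - cmod z) * cmod ((\<Prod>k<N. f k z * S k z) - 1)
        \<le> w (1 - cmod z) * (\<Sum>k<N. (\<Prod>j<k. cmod (f j z * S j z)) * cmod (f k z * S k z - 1))"
      using nn norm_prod_minus_1_le by (intro mult_left_mono)
    also have "\<dots> \<le> w (1 - cmod z) * (\<Sum>k<N. exp (\<kappa> * (2 ^ k * L)) * cmod (f k z * S k z - 1))"
      using nn prod_le[OF z] by (intro mult_left_mono sum_mono mult_right_mono) auto
    also have "\<dots> \<le> (\<Sum>k<N. C * (q * (1 / 2) ^ k))"
      unfolding sum_distrib_left using stage(2)[OF z] geom C
      by (intro sum_mono) (meson less_imp_le mult_left_mono order_trans)
    also have "\<dots> = C * q * (\<Sum>k<N. (1 / 2) ^ k)" by (simp add: sum_distrib_left mult_ac)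
    also have "\<dots> \<le> C * (e / (4 * C)) * 2"
      using C q sum_half \<open>0 < e\<close> by (intro mult_mono) (auto intro!: sum_nonneg)
    also have "\<dots> = e / 2" using C by simp
    finally show ?thesis .
  qed
  have "w (1 - cmod z) * cmod (F z * singular_inner \<nu> z - 1) \<le> e" if z: "cmod z < 1" for z
  proof -
    define T where "T = singular_inner (density \<nu> (\<rho> N)) z"
    have nn: "0 \<le> w (1 - cmod z)" using z by (intro majorant_nonneg[OF w]) auto
    have T: "cmod T \<le> 1"
      unfolding T_def
      by (rule cmod_singular_inner_le_1[OF density_on_circle(1)[OF \<nu> rest_measurable rest_bounds] z])
    \<comment> \<open>The stages are separated from the remaining factor \<open>T\<close>; as
      \<open>|T| \<le> 1\<close>, the stage error is not enlarged.\<close>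
    have "F z * singular_inner \<nu> z - 1 = ((\<Prod>k<N. f k z * S k z) - 1) * T + (T - 1)"
      unfolding singular_inner_decomposition[OF z, of N] F_def S_def T_def
      by (simp add: prod.distrib algebra_simps)
    then have "cmod (F z * singular_inner \<nu> z - 1) \<le> cmod (((\<Prod>k<N. f k z * S k z) - 1) * T) + cmod (T - 1)"
      by (metis norm_triangle_ineq)
    also have "cmod (((\<Prod>k<N. f k z * S k z) - 1) * T) \<le> cmod ((\<Prod>k<N. f k z * S k z) - 1)"
      using T by (simp add: norm_mult mult_left_le)
    finally have "w (1 - cmod z) * cmod (F z * singular_inner \<nu> z - 1)
        \<le> w (1 - cmod z) * (cmod ((\<Prod>k<N. f k z * S k z) - 1) + cmod (T - 1))"
      using nn by (intro mult_left_mono) auto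
    then show ?thesis using main[OF z] rest[OF z] by (simp add: T_def distrib_left)
  qed
  moreover have "\<exists>R>1. F holomorphic_on ball 0 R"
  proof -
    \<comment> \<open>Every dilation radius \<open>r k\<close> with \<open>k < N\<close> is at most
      \<open>1 - p\<close>, so all factors are holomorphic up to radius
      \<open>1 / (1 - p) > 1\<close>. The successor in the exponent keeps \<open>1 - p\<close>
      positive even if \<open>m N = 0\<close>.\<close>
    define p :: real where "p = 1 / 2 ^ Suc (m N)"
    define R where "R = 1 / (1 - p)"
    have p: "0 < p" "p \<le> 1 / 2" by (auto simp: p_def field_simps)
    have R: "1 < R" unfolding R_def using p by (subst less_divide_eq_1_pos) linarith+
    have "f k holomorphic_on ball 0 R" if "k < N" for k
    proof -
      have "m k \<le> Suc (m N)" using lift_Suc_mono_le[of m k N] m(1) that by (simp add: le_SucI)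
      then have "p \<le> 1 / 2 ^ m k" unfolding p_def by (intro divide_left_mono power_increasing) auto
      then have "0 \<le> r k" "r k \<le> 1 - p" by (simp_all add: r_def)
      moreover from this have "r k * R \<le> (1 - p) * R" using R by (intro mult_right_mono) auto
      ultimately have rk: "0 \<le> r k" "r k * R \<le> 1" using p by (simp_all add: R_def)
      have "cmod (of_real (r k) * z) < 1" if "cmod z < R" for z
      proof (cases "r k = 0")
        case False
        then have "r k * cmod z < r k * R" using rk(1) that by (intro mult_strict_left_mono) auto
        then show ?thesis using rk by (simp add: norm_mult)
      qed simp
      then have "(herglotz (density \<nu> (piece k)) \<circ> (\<lambda>z. of_real (r k) * z)) holomorphic_on ball 0 R"
        by (intro holomorphic_on_compose_gen[OF _ herglotz_holomorphic[OF \<sigma>]] holomorphic_intros) auto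
      then show ?thesis unfolding f_def by (intro holomorphic_intros) (simp add: o_def)
    qed
    then show ?thesis unfolding F_def using R by (intro exI[of _ R]) (auto intro!: holomorphic_intros)
  qed
  ultimately show "\<exists>F R. 1 < R \<and> F holomorphic_on ball 0 R \<and>
      (\<forall>z. cmod z < 1 \<longrightarrow> w (1 - cmod z) * cmod (F z * singular_inner \<nu> z - 1) \<le> e)"
    by blast
qed

theorem theorem2p1:
  fixes w :: "real \<Rightarrow> real" and \<mu> \<mu>P \<mu>C :: "complex measure"
  assumes "majorant w"
    and "finite_borel_on_circle \<mu>"
    and "singular_on_circle \<mu>"
    and "entropy_decomposition w \<mu> \<mu>P \<mu>C"
  shows "cyclic_in_growth_space w (singular_inner \<mu>C)"
proof (rule cyclic_singular_inner[OF assms(1)])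
  note dec = assms(4)[unfolded entropy_decomposition_def]
  show "emeasure \<mu>C E = 0" if "finite_entropy w E" for E using dec that by blast
  have sets: "sets \<mu>C = sets \<mu>" using dec by blast
  then have space: "space \<mu>C = space \<mu>" by (rule sets_eq_imp_space_eq)
  \<comment> \<open>By additivity \<open>\<mu>C\<close> lies below the finite measure
    \<open>\<mu>\<close>.\<close>
  have "emeasure \<mu> (space \<mu>) = emeasure \<mu>P (space \<mu>) + emeasure \<mu>C (space \<mu>)"
    using dec sets.top by blast
  moreover have "emeasure \<mu> (space \<mu>) \<noteq> \<infinity>"
    using assms(2) finite_measure.emeasure_finite by (auto simp: finite_borel_on_circle_def)
  ultimately have "emeasure \<mu>C (space \<mu>C) \<noteq> \<infinity>" by (simp add: space)
  then show "finite_borel_on_circle \<mu>C"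
    using assms(2) sets by (simp add: finite_borel_on_circle_def finite_measureI)
qed

end
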